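(* Let $s>1$, let $U\subset\mathbb{R}$ be a neighborhood of the origin, and let $c:U\to\mathbb{R}$ satisfy $c(\theta)>0$ for all $\theta\in U$ and $$c\in G^s(U),\qquad c(0)=1,\qquad c^{(m)}(0)=0\ \text{ for all integers } m\ge1 .$$ Let $\varphi\in C_b^2(\mathbb{R})$ and $\psi\in C_b^1(\mathbb{R})$. For $\varepsilon>0$ let $T^*=T^*(\varepsilon)$ be the lifespan (defined in the context) of the classical solution of $$u_{tt}-c(u_x)^2u_{xx}=0,\qquad u(0,x)=\varepsilon\varphi(x),\quad u_t(0,x)=\varepsilon\psi(x),\qquad x\in\mathbb{R}.$$ (a) There exist $\varepsilon_0>0$ and constants $C_1,C_2>0$ independent of $\varepsilon$ such that $$C_1e^{C_2\varepsilon^{-\frac1{s-1}}}\le T^*(\varepsilon)\qquad\text{for all }0<\varepsilon\le\varepsilon_0 .$$ (b) Suppose in addition that $\varphi_x(x)\to0$ and $\psi(x)\to0$ as $|x|\to\infty$, that there exists $x_0\in\mathbb{R}$ such that at least one of $\psi_x(x_0)+\varphi_{xx}(x_0)>0$ or $\psi_x(x_0)-\varphi_{xx}(x_0)>0$ holds, and that there is a constant $C>0$ such that $$Ce^{-C|\theta|^{-\frac1{s-1}}}\le c'(\theta)\qquad\text{for all }\theta\ne0\text{ near }0 .$$ Then there exist $\varepsilon_0>0$ and constants $C_3,C_4>0$ independent of $\varepsilon$ such that $$T^*(\varepsilon)\le C_3e^{C_4\varepsilon^{-\frac1{s-1}}}\qquad\text{for all }0<\varepsilon\le\varepsilon_0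 .$$
   Context: Gevrey class: for $\Omega\subset\mathbb{R}$ open and $s>1$, a (smooth) function $f$ belongs to $G^s(\Omega)$ if there exist constants $C,A>0$ such that $|f^{(m)}(\theta)|\le CA^m(m!)^s$ for all $m\in\mathbb{N}$ and all $\theta\in\Omega$. $C_b^m(\mathbb{R})$ is the set of $m$-times differentiable functions which, together with all their derivatives up to order $m$, are bounded and continuous on $\mathbb{R}$. Local-in-time existence and uniqueness of classical ($C^2$) solutions of the Cauchy problem is known for $\varphi\in C_b^2(\mathbb{R})$, $\psi\in C_b^1(\mathbb{R})$ (Courant–Lax, Hartman–Wintner, Douglis). The lifespan $T^*$ is the supremum of all $T>0$ such that the classical solution $u$ exists on $[0,T)\times\mathbb{R}$ with $$\sup_{t\in[0,T)}\bigl(\|u(t)\|_{L^\infty}+\|u_t(t)\|_{L^\infty}+\|u_x(t)\|_{L^\infty}+\|u_{tt}(t)\|_{L^\infty}+\|u_{tx}(t)\|_{L^\infty}+\|u_{xx}(t)\|_{L^\infty}\bigr)<\infty$$ and $\overline{u_x([0,T)\times\mathbb{R})}\subset U$. *)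

theory Defs
  imports "HOL-Analysis.Analysis" "HOL-Probability.Essential_Supremum"
begin

definition gevrey :: "real \<Rightarrow> real set \<Rightarrow> (real \<Rightarrow> real) set" where
  "gevrey s \<Omega> =
     {f. (\<forall>m. \<forall>\<theta>\<in>\<Omega>. (deriv ^^ m) f differentiable (at \<theta>)) \<and>
         (\<exists>C>0. \<exists>A>0. \<forall>m. \<forall>\<theta>\<in>\<Omega>. \<bar>(deriv ^^ m) f \<theta>\<bar> \<le> C * A ^ m * fact m powr s)}"

definition Cb :: "nat \<Rightarrow> (real \<Rightarrow> real) set" where
  "Cb m =
     {f. (\<forall>k<m. \<forall>x. (deriv ^^ k) f differentiable (at x)) \<and>
         (\<forall>k\<le>m. continuous_on UNIV ((deriv ^^ k) f) \<and> bounded (range ((deriv ^^ k) f)))}"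

text \<open>Functions of time and space are written \<open>u t x\<close>. The time derivative on the strip
  \<open>[0,T) \<times> \<real>\<close> is taken within \<open>[0,T)\<close>: two-sided for \<open>t > 0\<close>, one-sided at \<open>t = 0\<close>.\<close>

definition Dt :: "real \<Rightarrow> (real \<Rightarrow> real \<Rightarrow> real) \<Rightarrow> real \<Rightarrow> real \<Rightarrow> real" where
  "Dt T u t x = vector_derivative (\<lambda>\<tau>. u \<tau> x) (at t within {0..<T})"

definition Dx :: "(real \<Rightarrow> real \<Rightarrow> real) \<Rightarrow> real \<Rightarrow> real \<Rightarrow> real" where
  "Dx u t x = deriv (u t) x"

definition C1_strip :: "real \<Rightarrow> (real \<Rightarrow> real \<Rightarrow> real) \<Rightarrow> bool" where
  "C1_strip T u \<longleftrightarrow>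
     (\<forall>t\<in>{0..<T}. \<forall>x. (\<lambda>\<tau>. u \<tau> x) differentiable (at t within {0..<T}) \<and>
                     u t differentiable (at x)) \<and>
     continuous_on ({0..<T} \<times> UNIV) (\<lambda>(t, x). u t x) \<and>
     continuous_on ({0..<T} \<times> UNIV) (\<lambda>(t, x). Dt T u t x) \<and>
     continuous_on ({0..<T} \<times> UNIV) (\<lambda>(t, x). Dx u t x)"

definition C2_strip :: "real \<Rightarrow> (real \<Rightarrow> real \<Rightarrow> real) \<Rightarrow> bool" where
  "C2_strip T u \<longleftrightarrow> C1_strip T u \<and> C1_strip T (Dt T u) \<and> C1_strip T (Dx u)"

definition classical_solution ::
  "(real \<Rightarrow> real) \<Rightarrow> (real \<Rightarrow> real) \<Rightarrow> (real \<Rightarrow> real) \<Rightarrow> real \<Rightarrow> (real \<Rightarrow> real \<Rightarrow> real) \<Rightarrow> bool" where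
  "classical_solution c f g T u \<longleftrightarrow>
     C2_strip T u \<and>
     (\<forall>t\<in>{0..<T}. \<forall>x. Dt T (Dt T u) t x - (c (Dx u t x))\<^sup>2 * Dx (Dx u) t x = 0) \<and>
     (\<forall>x. u 0 x = f x) \<and>
     (\<forall>x. Dt T u 0 x = g x)"

definition Linf_norm :: "(real \<Rightarrow> real) \<Rightarrow> ereal" where
  "Linf_norm f = esssup lborel (\<lambda>x. ereal \<bar>f x\<bar>)"

text \<open>The lifespan for initial data \<open>u(0) = f\<close>, \<open>u\<^sub>t(0) = g\<close>; it is \<open>\<infinity>\<close> for global solutions.
  Values of \<open>c\<close> outside \<open>U\<close> play no role, because of the condition on the range of \<open>u\<^sub>x\<close>.\<close>

definition lifespan ::
  "(real \<Rightarrow> real) \<Rightarrow> real set \<Rightarrow> (real \<Rightarrow> real) \<Rightarrow> (real \<Rightarrow> real) \<Rightarrow> ereal" where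
  "lifespan c U f g =
     Sup {ereal T | T. T > 0 \<and>
       (\<exists>u. classical_solution c f g T u \<and>
            (SUP t\<in>{0..<T}. Linf_norm (u t) + Linf_norm (Dt T u t) + Linf_norm (Dx u t)
               + Linf_norm (Dt T (Dt T u) t) + Linf_norm (Dx (Dt T u) t)
               + Linf_norm (Dx (Dx u) t)) < \<infinity> \<and>
            closure ((\<lambda>(t, x). Dx u t x) ` ({0..<T} \<times> UNIV)) \<subseteq> U)}"

end

theory Submission
  imports Defs
begin

text \<open>With \<open>F' = c\<close> the Riemann invariants \<open>R = u\<^sub>t + F(u\<^sub>x)\<close> and \<open>S = u\<^sub>t - F(u\<^sub>x)\<close> are constant
  along the characteristics \<open>x' = -c\<close> and \<open>x' = c\<close>, so they stay of size \<open>\<epsilon>\<close>. Along the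
  first family \<open>z = \<surd>c R\<^sub>x\<close> satisfies the Riccati equation \<open>z' = c'(u\<^sub>x) / (2 c\<^sup>3\<^sup>/\<^sup>2) z\<^sup>2\<close>.
  A Gevrey function that is flat at \<open>0\<close> satisfies \<open>\<bar>c'(\<theta>)\<bar> \<le> B exp (- \<beta> \<bar>\<theta>\<bar> powr (-1/(s-1)))\<close> by
  Taylor's formula of optimal order.

  For the lower bound, the solution is constructed in characteristic coordinates: there \<open>R\<close> and
  \<open>S\<close>, and hence \<open>c(u\<^sub>x)\<close>, are known functions, the physical coordinates \<open>t, x\<close> solve a linear
  Goursat problem, and the change of coordinates stays close to an isometry as long as
  \<open>T \<epsilon> sup \<bar>c'\<bar>\<close> is small. For the upper bound, one follows a characteristic of the first family along
  which \<open>R\<close> is a nonzero multiple of \<open>\<epsilon>\<close> and \<open>R\<^sub>x > 0\<close>. It crosses characteristics of the second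
  family with feet tending to \<open>-\<infinity>\<close>, so after a time independent of \<open>\<epsilon>\<close> the invariant \<open>S\<close> is
  negligible, \<open>\<bar>u\<^sub>x\<bar>\<close> is bounded below by a multiple of \<open>\<epsilon>\<close>, and the lower bound on \<open>c'\<close> makes
  \<open>z\<close> blow up.\<close>

section \<open>Primitives and near-identity maps\<close>

text \<open>Low regularity shapes the proof. For C2 solutions the invariants and the speed are only
  C1, so the Goursat problem has merely continuous coefficients, each unknown is controlled in one
  variable only, and the Riccati equation cannot be obtained by differentiating the equation for
  \<open>R\<close> twice. Inverting the coordinate change directly also avoids local existence and
  continuation: the solution appears at once on the whole time interval. The product of
  \<open>T\<close>, \<open>\<epsilon>\<close> and the sup of \<open>\<bar>c'\<bar>\<close> arises
  because the logarithmic derivatives of the speed in characteristic coordinates have size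
  \<epsilon> times that sup and are integrated over lengths comparable to \<open>T\<close>. Flatness
  at scale \<epsilon> then yields the exponential times \<open>1 / \<epsilon>\<close>. The lower
  bound drops this factor; the upper bound absorbs it by enlarging the exponent. In the upper bound
  \<open>u_x\<close> is a function of \<open>R - S\<close>, so a nonzero \<open>R\<close> alone does
  not keep it away from 0; the decay of the data at infinity excludes the cancellation.\<close>

abbreviation cont2_on :: "real set \<Rightarrow> (real \<Rightarrow> real \<Rightarrow> real) \<Rightarrow> bool" where
  "cont2_on A f \<equiv> continuous_on (A \<times> UNIV) (\<lambda>(x, y). f x y)"

abbreviation cont2 :: "(real \<Rightarrow> real \<Rightarrow> real) \<Rightarrow> bool" where
  "cont2 f \<equiv> continuous_on UNIV (\<lambda>(x, y). f x y)"

text \<open>The integral from \<open>0\<close> to \<open>x\<close>, oriented for \<open>x < 0\<close> and rescaled to a fixed interval so that the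
  theorems on integrals with parameters apply.\<close>

definition prim :: "(real \<Rightarrow> real) \<Rightarrow> real \<Rightarrow> real" where
  "prim f x = integral {0..1} (\<lambda>s. x * f (s * x))"

text \<open>Derivatives are taken within a convex \<open>S\<close>, so that one-sided derivatives at
  an endpoint suffice; the time interval \<open>{0..<T}\<close> needs this.\<close>

lemma prim_eq_diff:
  assumes S: "convex S" "0 \<in> S" "x \<in> S"
    and F: "\<And>y. y \<in> S \<Longrightarrow> (F has_real_derivative f y) (at y within S)"
  shows "prim f x = F x - F 0"
proof -
  have sub: "(\<lambda>s. s * x) ` {0..1} \<subseteq> S"
    using convexD_alt[OF S(1) S(2) S(3)] by auto
  have "((\<lambda>s. x * f (s * x)) has_integral (F (1 * x) - F (0 * x))) {0..1}"
  proof (rule fundamental_theorem_of_calculus)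
    fix s :: real assume s: "s \<in> {0..1}"
    have "(F \<circ> (\<lambda>s. s * x) has_real_derivative f (s * x) * x) (at s within {0..1})"
    proof (rule DERIV_image_chain)
      show "(F has_real_derivative f (s * x)) (at (s * x) within (\<lambda>s. s * x) ` {0..1})"
        by (rule DERIV_subset[OF F sub]) (use sub s in blast)+
    qed (auto intro!: derivative_eq_intros)
    then show "((\<lambda>s. F (s * x)) has_vector_derivative x * f (s * x)) (at s within {0..1})"
      by (simp add: has_real_derivative_iff_has_vector_derivative o_def mult.commute)
  qed simp
  from integral_unique[OF this] show ?thesis
    unfolding prim_def by (simp only: mult_1 mult_zero_left)
qed

lemma prim_0 [simp]: "prim f 0 = 0"
  by (simp add: prim_def)

lemma DERIV_prim_interval:
  assumes "continuous_on {p..q} f" "0 \<in> {p..q}" "x \<in> {p..q}"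
  shows "(prim f has_real_derivative f x) (at x within {p..q})"
proof -
  obtain g where "\<forall>y\<in>{p..q}. (g has_vector_derivative f y) (at y within {p..q})"
    using antiderivative_continuous[OF assms(1)] by metis
  then have g: "(g has_real_derivative f y) (at y within {p..q})" if "y \<in> {p..q}" for y
    using that by (auto simp: has_real_derivative_iff_has_vector_derivative)
  have eq: "g y - g 0 = prim f y" if "y \<in> {p..q}" for y
    using prim_eq_diff[of "{p..q}" y g f] g that assms(2) by auto
  have "((\<lambda>y. g y - g 0) has_real_derivative f x) (at x within {p..q})"
    using g[OF assms(3)] by (auto intro!: derivative_eq_intros)
  then show ?thesis
    by (rule has_field_derivative_transform_within[where d=1]) (use eq assms(3) in auto)
qed

lemma DERIV_prim:
  assumes "continuous_on UNIV f"
  shows "(prim f has_real_derivative f x) (at x)"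
proof -
  define N where "N = \<bar>x\<bar> + 1"
  have N: "- N < x" "x < N" "0 \<in> {-N..N}" by (auto simp: N_def)
  have "(prim f has_real_derivative f x) (at x within {-N..N})"
    by (rule DERIV_prim_interval[OF continuous_on_subset[OF assms]]) (use N in auto)
  then show ?thesis using N by (simp add: at_within_Icc_at)
qed

lemma DERIV_prim_open:
  assumes f: "continuous_on I f" and I: "open I" "convex I" "0 \<in> I" "x \<in> I"
  shows "(prim f has_real_derivative f x) (at x)"
proof -
  have ends: "\<exists>e>0. y - e \<in> I \<and> y + e \<in> I" if "y \<in> I" for y
  proof -
    obtain e where e: "e > 0" "ball y e \<subseteq> I" using I(1) \<open>y \<in> I\<close> unfolding open_contains_ball by blast
    have "y - e / 2 \<in> ball y e" "y + e / 2 \<in> ball y e" using e(1) by (auto simp: dist_real_def)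
    then show ?thesis using e by (intro exI[of _ "e / 2"]) auto
  qed
  have "min 0 x \<in> I" "max 0 x \<in> I" using I(3,4) by (auto simp: min_def max_def)
  then obtain e1 e2 where e: "e1 > 0" "e2 > 0" "min 0 x - e1 \<in> I" "max 0 x + e2 \<in> I"
    using ends by meson
  define p q where "p = min 0 x - e1" and "q = max 0 x + e2"
  have pq: "p < 0" "p < x" "0 < q" "x < q" "p \<in> I" "q \<in> I" using e by (auto simp: p_def q_def)
  have "{p..q} \<subseteq> I"
    using convex_contains_segment[THEN iffD1, OF I(2), rule_format, OF pq(5,6)] pq by (simp add: closed_segment_eq_real_ivl)
  then have "(prim f has_real_derivative f x) (at x within {p..q})"
    by (rule DERIV_prim_interval[OF continuous_on_subset[OF f]]) (use pq in auto)
  then show ?thesis using pq by (simp add: at_within_Icc_at)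
qed

lemma DERIV_prim_Ico:
  assumes f: "continuous_on {0..<T} f" and t: "t \<in> {0..<T}"
  shows "(prim f has_real_derivative f t) (at t within {0..<T})"
proof -
  obtain b where b: "t < b" "b < T" using dense t by auto
  have "(prim f has_real_derivative f t) (at t within {0..b})"
    by (rule DERIV_prim_interval[OF continuous_on_subset[OF f]]) (use b t in auto)
  moreover have "at t within {0..b} = at t within {0..<T}"
    by (rule at_within_nhd[of t "{..<b}"]) (use b in auto)
  ultimately show ?thesis by simp
qed

lemma continuous_on_compose_pair:
  assumes "continuous_on (A \<times> B) (\<lambda>(x, y). f x y)" "continuous_on S g" "continuous_on S h"
    "\<And>z. z \<in> S \<Longrightarrow> g z \<in> A" "\<And>z. z \<in> S \<Longrightarrow> h z \<in> B"
  shows "continuous_on S (\<lambda>z. f (g z) (h z))"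
proof -
  have "(\<lambda>z. (g z, h z)) ` S \<subseteq> A \<times> B" using assms(4,5) by blast
  from continuous_on_compose2[OF assms(1) continuous_on_Pair[OF assms(2,3)] this]
  show ?thesis by simp
qed

lemma continuous_on_prim:
  assumes f: "continuous_on (A \<times> S) (\<lambda>(a, y). f a y)" and S: "convex S" "0 \<in> S"
  shows "continuous_on (A \<times> S) (\<lambda>(a, y). prim (f a) y)"
proof -
  have sub: "s * y \<in> S" if "s \<in> {0..1}" "y \<in> S" for s y
    using convexD_alt[OF S(1) S(2) that(2), of s] that by auto
  have "continuous_on ((A \<times> S) \<times> cbox 0 1) (\<lambda>(z, s). snd z * f (fst z) (s * snd z))"
    unfolding case_prod_unfold
    by (intro continuous_intros continuous_on_compose_pair[OF f]) (auto intro!: sub)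
  from integral_continuous_on_param[OF this]
  show ?thesis by (simp add: prim_def case_prod_unfold)
qed

lemma DERIV_prim_param:
  assumes f: "\<And>a y. a \<in> A \<Longrightarrow> y \<in> S \<Longrightarrow> ((\<lambda>a. f a y) has_real_derivative f' a y) (at a within A)"
    and cf: "\<And>a. a \<in> A \<Longrightarrow> continuous_on S (f a)"
    and cf': "continuous_on (A \<times> S) (\<lambda>(a, y). f' a y)"
    and A: "convex A" "a \<in> A" and S: "convex S" "0 \<in> S" "y \<in> S"
  shows "((\<lambda>a. prim (f a) y) has_real_derivative prim (f' a) y) (at a within A)"
proof -
  have sub: "s * y \<in> S" if "s \<in> {0..1}" for s
    using convexD_alt[OF S(1) S(2) S(3), of s] that by auto
  have "((\<lambda>a. integral (cbox 0 1) (\<lambda>s. y * f a (s * y))) has_real_derivative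
      integral (cbox 0 1) (\<lambda>s. y * f' a (s * y))) (at a within A)"
  proof (rule leibniz_rule_field_derivative)
    fix a s assume "a \<in> A" "s \<in> cbox (0::real) 1"
    then show "((\<lambda>a. y * f a (s * y)) has_real_derivative y * f' a (s * y)) (at a within A)"
      using f[of a "s * y"] sub by (auto intro!: derivative_eq_intros)
  next
    fix a assume "a \<in> A"
    then show "(\<lambda>s. y * f a (s * y)) integrable_on cbox 0 1"
      by (intro integrable_continuous continuous_intros continuous_on_compose2[OF cf])
        (auto intro!: sub)
  next
    show "continuous_on (A \<times> cbox 0 1) (\<lambda>(a, s). y * f' a (s * y))"
      unfolding case_prod_unfold
      by (intro continuous_intros continuous_on_compose_pair[OF cf']) (auto intro!: sub)
  qed (use A in auto)
  then show ?thesis by (simp add: prim_def)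
qed

text \<open>Poincare lemma for the form \<open>p dx + q dy\<close>. Only the mixed derivatives are
  assumed, since the Goursat unknowns are not known to possess others. \<open>H\<close> integrates
  \<open>p\<close> along the horizontal axis and then \<open>q\<close> vertically; its derivative in
  \<open>x\<close> is recovered by differentiating under the integral.\<close>

lemma potential_exists:
  fixes p q r :: "real \<Rightarrow> real \<Rightarrow> real"
  assumes py: "\<And>x y. (p x has_real_derivative r x y) (at y)"
    and qx: "\<And>x y. ((\<lambda>x. q x y) has_real_derivative r x y) (at x)"
    and cont: "cont2 p" "cont2 q"
      "cont2 r"
  obtains H :: "real \<Rightarrow> real \<Rightarrow> real" where "H 0 0 = 0"
    "\<And>x y. ((\<lambda>x. H x y) has_real_derivative p x y) (at x)"
    "\<And>x y. (H x has_real_derivative q x y) (at y)"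
proof -
  define H where "H = (\<lambda>x y. prim (\<lambda>s. p s 0) x + prim (q x) y)"
  have 0: "H 0 0 = 0" by (simp add: H_def)
  have c: "cont2_on UNIV p" "cont2_on UNIV q"
      "cont2_on UNIV r"
    using cont by auto
  have cq: "continuous_on UNIV (q x)" for x
    by (rule continuous_on_compose_pair[OF c(2), where g="\<lambda>_. x" and h="\<lambda>y. y"]) (auto intro!: continuous_intros)
  have 1: "(H x has_real_derivative q x y) (at y)" for x y
    unfolding H_def using DERIV_prim[OF cq, of x y] by (auto intro!: derivative_eq_intros)
  have cp: "continuous_on UNIV (\<lambda>s. p s 0)"
    by (rule continuous_on_compose_pair[OF c(1), where g="\<lambda>s. s" and h="\<lambda>_. 0"]) (auto intro!: continuous_intros)
  have 2: "((\<lambda>x. H x y) has_real_derivative p x y) (at x)" for x y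
  proof -
    have "((\<lambda>x. prim (q x) y) has_real_derivative prim (r x) y) (at x)"
      by (rule DERIV_prim_param[where S=UNIV, of UNIV]) (use qx cq c(3) in auto)
    moreover have "prim (r x) y = p x y - p x 0"
      by (rule prim_eq_diff[where S=UNIV]) (use py in auto)
    ultimately show ?thesis
      unfolding H_def using DERIV_prim[OF cp, of x] by (auto intro!: derivative_eq_intros)
  qed
  show ?thesis using that 0 1 2 by blast
qed

text \<open>Continuity of one partial derivative suffices; the other need only exist at the point.
  The set \<open>X\<close> may be an interval with endpoints, where that derivative is
  one-sided.\<close>

lemma has_derivative_partials_real:
  fixes f :: "real \<Rightarrow> real \<Rightarrow> real"
  assumes fx: "((\<lambda>x. f x y) has_real_derivative fx) (at x within X)"
    and fy: "\<And>x y. x \<in> X \<Longrightarrow> (f x has_real_derivative fy x y) (at y)"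
    and c: "cont2_on X fy" and x: "x \<in> X"
  shows "((\<lambda>(x, y). f x y) has_derivative (\<lambda>(h, k). fx * h + fy x y * k)) (at (x, y) within X \<times> UNIV)"
proof -
  have "((\<lambda>(x, y). f x y) has_derivative (\<lambda>(h, k). fx * h + blinfun_mult_right (fy x y) k))
      (at (x, y) within X \<times> UNIV)"
  proof (rule has_derivative_partialsI)
    show "((\<lambda>x. f x y) has_derivative (*) fx) (at x within X)"
      using fx by (simp add: has_field_derivative_def)
    show "(f x has_derivative blinfun_apply (blinfun_mult_right (fy x y))) (at y within UNIV)"
      if "x \<in> X" for x y
      using fy[OF that, of y] by (simp add: has_field_derivative_def)
    have "continuous_on (X \<times> UNIV) (\<lambda>(x, y). blinfun_mult_right (fy x y))"
      using c unfolding case_prod_unfold by (intro continuous_intros)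
    then show "continuous (at (x, y) within X \<times> UNIV) (\<lambda>(x, y). blinfun_mult_right (fy x y))"
      using x by (auto simp: continuous_on_eq_continuous_within)
  qed auto
  then show ?thesis by simp
qed

lemma DERIV_along_curve:
  fixes f :: "real \<Rightarrow> real \<Rightarrow> real"
  assumes "((\<lambda>x. f x (Y t)) has_real_derivative fx) (at t within X)"
    and "\<And>x y. x \<in> X \<Longrightarrow> (f x has_real_derivative fy x y) (at y)"
    and "cont2_on X fy" and "t \<in> X"
    and Y: "(Y has_real_derivative Y') (at t within X)"
  shows "((\<lambda>t. f t (Y t)) has_real_derivative fx + fy t (Y t) * Y') (at t within X)"
proof -
  have "((\<lambda>(x, y). f x y) has_derivative (\<lambda>(h, k). fx * h + fy t (Y t) * k)) (at (t, Y t) within X \<times> UNIV)"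
    by (rule has_derivative_partials_real) (use assms in auto)
  then have "((\<lambda>(x, y). f x y) has_derivative (\<lambda>(h, k). fx * h + fy t (Y t) * k))
      (at (t, Y t) within (\<lambda>t. (t, Y t)) ` X)"
    by (rule has_derivative_subset) auto
  moreover have "((\<lambda>t. (t, Y t)) has_derivative (\<lambda>h. (h, Y' * h))) (at t within X)"
    using Y by (auto intro!: derivative_eq_intros simp: has_field_derivative_def)
  ultimately have "((\<lambda>t. (\<lambda>(x, y). f x y) (t, Y t)) has_derivative
     (\<lambda>h. (\<lambda>(h, k). fx * h + fy t (Y t) * k) (h, Y' * h))) (at t within X)"
    by (rule has_derivative_in_compose[rotated])
  then show ?thesis
    by (auto simp: has_field_derivative_def algebra_simps elim!: has_derivative_eq_rhs)
qed

text \<open>Solving \<open>z + E z = w\<close> means finding the fixed point of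
  \<open>\<lambda>z. w - E z\<close>, a contraction with factor 1/2. The same Lipschitz bound shows
  that adding \<open>E\<close> shrinks distances by at most a factor 2, so the inverse is
  2-Lipschitz.\<close>

lemma near_identity_inverse:
  fixes E :: "'a::{complete_space, real_normed_vector} \<Rightarrow> 'a"
  assumes E: "\<And>z w. norm (E z - E w) \<le> norm (z - w) / 2"
  obtains g where "\<And>w. g w + E (g w) = w" "\<And>z. g (z + E z) = z" "continuous_on UNIV g"
proof -
  have "\<exists>!z. w - E z = z" for w
    by (rule banach_fix_type[where c="1/2"]) (use E in \<open>auto simp: dist_norm norm_minus_commute\<close>)
  then obtain g where g: "\<And>w. w - E (g w) = g w" by metis
  have 1: "g w + E (g w) = w" for w using g[of w] by (metis diff_add_cancel)
  have inj: "norm (z - z') \<le> 2 * norm ((z + E z) - (z' + E z'))" for z z'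
  proof -
    have "z - z' = ((z + E z) - (z' + E z')) - (E z - E z')" by simp
    then have "norm (z - z') \<le> norm ((z + E z) - (z' + E z')) + norm (E z - E z')"
      by (metis norm_triangle_ineq4)
    then show ?thesis using E[of z z'] by simp
  qed
  have 2: "g (z + E z) = z" for z
    using inj[of "g (z + E z)" z] 1[of "z + E z"] by simp
  have "norm (g w - g w') \<le> 2 * norm (w - w')" for w w'
    using inj[of "g w" "g w'"] 1 by simp
  then have "2-lipschitz_on UNIV g" by (auto intro!: lipschitz_onI simp: dist_norm)
  then show ?thesis using 1 2 that lipschitz_on_continuous_on by blast
qed

section \<open>A Goursat problem\<close>

lemma DERIV_bound:
  fixes F :: "real \<Rightarrow> real"
  assumes "\<And>z. (F has_real_derivative f z) (at z)" "\<And>z. z \<in> closed_segment x y \<Longrightarrow> \<bar>f z\<bar> \<le> B"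
  shows "\<bar>F y - F x\<bar> \<le> B * \<bar>y - x\<bar>"
  using field_differentiable_bound[where S="closed_segment x y" and f=F and f'=f and B=B and x=x and y=y]
    assms by (auto intro: DERIV_subset simp: norm_minus_commute abs_minus_commute)

lemma prim_support_bound:
  assumes f: "continuous_on UNIV f" and b: "\<And>s. \<bar>f s\<bar> \<le> \<eta>"
    and supp: "\<And>s. \<bar>s - x\<bar> \<ge> D \<Longrightarrow> f s = 0" and D: "D \<ge> 0"
  shows "\<bar>prim f y - prim f x\<bar> \<le> \<eta> * D"
proof -
  \<comment> \<open>Clamping \<open>y\<close> to the window of radius \<open>D\<close> around
    \<open>x\<close> changes nothing, because \<open>f\<close> vanishes between \<open>y'\<close>
    and \<open>y\<close>. This makes the bound independent of \<open>y\<close>.\<close>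
  define y' where "y' = max (x - D) (min (x + D) y)"
  have \<eta>: "\<eta> \<ge> 0" using b[of 0] by linarith
  have "\<bar>prim f y - prim f y'\<bar> \<le> 0 * \<bar>y - y'\<bar>"
  proof (cases "y' = y")
    case False
    show ?thesis
      by (rule DERIV_bound[OF DERIV_prim[OF f]])
        (use D False in \<open>auto simp: y'_def closed_segment_eq_real_ivl min_def max_def intro!: supp split: if_splits\<close>)
  qed simp
  moreover have "\<bar>prim f y' - prim f x\<bar> \<le> \<eta> * \<bar>y' - x\<bar>"
    by (rule DERIV_bound[OF DERIV_prim[OF f] b])
  moreover have "\<eta> * \<bar>y' - x\<bar> \<le> \<eta> * D"
    using D by (intro mult_left_mono \<eta>) (auto simp: y'_def)
  ultimately show ?thesis by linarith
qed

lemma DERIV_pos_part_square: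
  fixes x :: real
  shows "((\<lambda>x. (max 0 x)\<^sup>2) has_real_derivative 2 * max 0 x) (at x)"
proof -
  consider "x < 0" | "x = 0" | "x > 0" by linarith
  then show ?thesis
  proof cases
    case 1
    have "((\<lambda>x. 0) has_real_derivative 2 * max 0 x) (at x)"
      using 1 by (auto intro!: derivative_eq_intros)
    then show ?thesis
      by (rule has_field_derivative_transform_within_open[where S="{..<0}"]) (use 1 in auto)
  next
    case 2
    have "isCont (\<lambda>x::real. max 0 x) 0" by (intro continuous_intros)
    then show ?thesis
      unfolding CARAT_DERIV by (intro exI[of _ "\<lambda>x. max 0 x"]) (auto simp: 2 power2_eq_square)
  next
    case 3
    have "((\<lambda>x. x\<^sup>2) has_real_derivative 2 * max 0 x) (at x)"
      using 3 by (auto intro!: derivative_eq_intros)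
    then show ?thesis
      by (rule has_field_derivative_transform_within_open[where S="{0<..}"]) (use 3 in auto)
  qed
qed

text \<open>Squared positive parts are C1 and can be nested: \<open>m\<close> vanishes on the unit
  interval, \<open>n\<close> vanishes once \<open>x\<^sup>2 \<ge> 2\<close>. C1 is enough, because
  the speed is differentiated only once.\<close>

lemma cutoff_exists:
  obtains \<rho> \<rho>' :: "real \<Rightarrow> real" where
    "\<And>x. (\<rho> has_real_derivative \<rho>' x) (at x)" "continuous_on UNIV \<rho>'"
    "\<And>x. \<rho> x \<in> {0..1}" "\<And>x. \<bar>x\<bar> \<le> 1 \<Longrightarrow> \<rho> x = 1"
    "\<And>x. \<bar>x\<bar> \<ge> 2 \<Longrightarrow> \<rho> x = 0" "\<And>x. \<bar>x\<bar> \<ge> 2 \<Longrightarrow> \<rho>' x = 0" "\<And>x. \<bar>\<rho>' x\<bar> \<le> 16"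
proof -
  define m where "m = (\<lambda>x::real. max 0 (x\<^sup>2 - 1))"
  define n where "n = (\<lambda>x::real. max 0 (1 - (m x)\<^sup>2))"
  define \<rho> where "\<rho> = (\<lambda>x. (n x)\<^sup>2)"
  define \<rho>' where "\<rho>' = (\<lambda>x. 2 * n x * (- (2 * m x * (2 * x))))"
  have dm: "((\<lambda>x. (m x)\<^sup>2) has_real_derivative 2 * m x * (2 * x)) (at x)" for x
    unfolding m_def
    by (rule DERIV_chain2[OF DERIV_pos_part_square, where g="\<lambda>x. x\<^sup>2 - 1"]) (auto intro!: derivative_eq_intros)
  have dn: "((\<lambda>x. 1 - (m x)\<^sup>2) has_real_derivative - (2 * m x * (2 * x))) (at x)" for x
    using DERIV_diff[OF DERIV_const dm] by simp
  have d: "(\<rho> has_real_derivative \<rho>' x) (at x)" for x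
    unfolding \<rho>_def \<rho>'_def n_def
    by (rule DERIV_chain2[OF DERIV_pos_part_square dn])
  have c: "continuous_on UNIV \<rho>'"
    unfolding \<rho>'_def n_def m_def by (intro continuous_intros)
  have n1: "n x \<in> {0..1}" for x by (auto simp: n_def)
  have \<rho>1: "\<rho> x \<in> {0..1}" for x
    using n1[of x] by (auto simp: \<rho>_def power_le_one)
  have in1: "\<rho> x = 1" if "\<bar>x\<bar> \<le> 1" for x
  proof -
    have "x\<^sup>2 \<le> 1" using that by (simp add: abs_square_le_1)
    then show ?thesis by (simp add: \<rho>_def n_def m_def)
  qed
  have n0: "n x = 0" if "x\<^sup>2 \<ge> 2" for x
  proof -
    have "m x \<ge> 1" using that by (simp add: m_def)
    then have "(m x)\<^sup>2 \<ge> 1" by simp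
    then show ?thesis by (simp add: n_def)
  qed
  have sq2: "x\<^sup>2 \<ge> 2" if "\<bar>x\<bar> \<ge> 2" for x :: real
    using power_mono[of 2 "\<bar>x\<bar>" 2] that by simp
  have "\<bar>\<rho>' x\<bar> \<le> 16" for x
  proof (cases "x\<^sup>2 \<ge> 2")
    case True then show ?thesis by (simp add: \<rho>'_def n0)
  next
    case False
    then have x2: "\<bar>x\<bar> \<le> 2" using sq2[of x] by linarith
    have m1: "0 \<le> m x" "m x \<le> 1" using False by (auto simp: m_def)
    \<comment> \<open>Here \<open>\<rho>' x\<close> is \<open>- 8 * n x * m x * x\<close>, so the
      bound 16 comes from \<open>n x * m x \<le> 1\<close> and
      \<open>\<bar>x\<bar> \<le> 2\<close>.\<close>
    have "n x * m x \<le> 1" using n1[of x] m1 by (simp add: mult_le_one)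
    then have "(n x * m x) * \<bar>x\<bar> \<le> 1 * 2" using x2 n1[of x] m1 by (intro mult_mono) auto
    then show ?thesis using n1[of x] m1 by (simp add: \<rho>'_def abs_mult mult.commute mult.left_commute)
  qed
  then show ?thesis
    using that[of \<rho> \<rho>'] d c \<rho>1 in1 n0 sq2 by (simp add: \<rho>_def \<rho>'_def)
qed

text \<open>The equation \<open>P_y = a Q\<close> with \<open>P = g\<close> on the diagonal, in
  integral form: the difference of the two primitives is the integral for \<open>s\<close> from
  \<open>x\<close> to \<open>y\<close>.\<close>

definition goursat_op :: "(real \<Rightarrow> real) \<Rightarrow> (real \<Rightarrow> real \<Rightarrow> real) \<Rightarrow> (real \<Rightarrow> real \<Rightarrow> real) \<Rightarrow> real \<Rightarrow> real \<Rightarrow> real"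
  where "goursat_op g a Q x y = g x + prim (\<lambda>s. a x s * Q x s) y - prim (\<lambda>s. a x s * Q x s) x"

text \<open>Since \<open>a\<close> is at most \<open>\<eta>\<close> and vanishes at distance
  \<open>D\<close> from the diagonal, integrating \<open>a * Q\<close> from the diagonal costs at
  most \<open>\<eta> * D\<close> times the sup of \<open>\<bar>Q\<bar>\<close>, however long the
  path. This allows a contraction on the whole plane.\<close>

locale goursat_coeff =
  fixes a :: "real \<Rightarrow> real \<Rightarrow> real" and g :: "real \<Rightarrow> real" and \<eta> D B :: real
  assumes cont_a: "cont2 a"
    and cont_g: "continuous_on UNIV g"
    and a_bound: "\<And>x y. \<bar>a x y\<bar> \<le> \<eta>" and a_supp: "\<And>x y. \<bar>x - y\<bar> \<ge> D \<Longrightarrow> a x y = 0"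
    and g_bound: "\<And>x. \<bar>g x\<bar> \<le> B" and D: "D \<ge> 0"
begin

lemma cont_section:
  assumes "cont2 Q"
  shows "continuous_on UNIV (\<lambda>s. a x s * Q x s)"
proof -
  have 1: "cont2_on UNIV a" "cont2_on UNIV Q"
    using assms cont_a by auto
  show ?thesis
    by (intro continuous_intros continuous_on_compose_pair[OF 1(1), where g="\<lambda>_. x" and h="\<lambda>s. s"]
        continuous_on_compose_pair[OF 1(2), where g="\<lambda>_. x" and h="\<lambda>s. s"]) auto
qed

lemma goursat_op_cont:
  assumes Q: "cont2 Q"
  shows "continuous_on UNIV (\<lambda>(x, y). goursat_op g a Q x y)"
proof -
  have "continuous_on (UNIV \<times> UNIV) (\<lambda>(x, s). a x s * Q x s)"
    using Q cont_a unfolding case_prod_unfold by (intro continuous_intros) auto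
  from continuous_on_prim[OF this]
  have *: "continuous_on (UNIV \<times> UNIV) (\<lambda>(x, y). prim (\<lambda>s. a x s * Q x s) y)" by simp
  show ?thesis
    unfolding goursat_op_def case_prod_unfold
    by (intro continuous_intros continuous_on_compose2[OF cont_g]
       continuous_on_compose_pair[OF *, where g=fst and h=snd]
       continuous_on_compose_pair[OF *, where g=fst and h=fst]) auto
qed

lemma goursat_op_diff:
  assumes Q: "cont2 Q" "cont2 Q'"
    and d: "\<And>x y. \<bar>Q x y - Q' x y\<bar> \<le> d"
  shows "\<bar>goursat_op g a Q x y - goursat_op g a Q' x y\<bar> \<le> \<eta> * D * d"
proof -
  let ?f = "\<lambda>s. a x s * Q x s" and ?f' = "\<lambda>s. a x s * Q' x s"
  have \<eta>: "\<eta> \<ge> 0" using a_bound[of 0 0] by linarith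
  have e: "prim (\<lambda>s. ?f s - ?f' s) y = prim ?f y - prim ?f' y" for y
    by (rule prim_eq_diff[where S=UNIV and F="\<lambda>y. prim ?f y - prim ?f' y", simplified])
      (auto intro!: derivative_intros DERIV_prim cont_section Q)
  have "\<bar>prim (\<lambda>s. ?f s - ?f' s) y - prim (\<lambda>s. ?f s - ?f' s) x\<bar> \<le> (\<eta> * d) * D"
  proof (rule prim_support_bound)
    show "continuous_on UNIV (\<lambda>s. ?f s - ?f' s)"
      by (intro continuous_on_diff cont_section Q)
    show "\<bar>?f s - ?f' s\<bar> \<le> \<eta> * d" for s
    proof -
      have "\<bar>?f s - ?f' s\<bar> = \<bar>a x s\<bar> * \<bar>Q x s - Q' x s\<bar>" by (simp add: abs_mult[symmetric] right_diff_distrib)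
      also have "\<dots> \<le> \<eta> * d" by (intro mult_mono a_bound d \<eta>) auto
      finally show ?thesis .
    qed
    show "?f s - ?f' s = 0" if "D \<le> \<bar>s - x\<bar>" for s
      using a_supp[of x s] that by (simp add: abs_minus_commute)
  qed (rule D)
  then show ?thesis unfolding goursat_op_def e by (simp add: algebra_simps)
qed

lemma goursat_op_const_bound:
  assumes "cont2 Q" "\<And>x y. \<bar>Q x y\<bar> \<le> d"
  shows "\<bar>goursat_op g a Q x y - g x\<bar> \<le> \<eta> * D * d"
  using goursat_op_diff[of Q "\<lambda>_ _. 0" d x y] assms by (simp add: goursat_op_def prim_def case_prod_unfold)

lemma DERIV_goursat_op:
  assumes "cont2 Q"
  shows "(goursat_op g a Q x has_real_derivative a x y * Q x y) (at y)"
  unfolding goursat_op_def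
  by (auto intro!: derivative_eq_intros DERIV_prim[OF cont_section] assms)

lemma goursat_op_bcontfun:
  fixes q :: "(real \<times> real) \<Rightarrow>\<^sub>C real"
  shows "(\<lambda>z. goursat_op g a (\<lambda>x y. q (x, y)) (fst z) (snd z)) \<in> bcontfun"
proof -
  have cq: "continuous_on UNIV (\<lambda>(x, y). q (x, y))" by simp
  obtain d where d: "\<And>z. \<bar>q z\<bar> \<le> d"
    using bounded_apply_bcontfun[of q] unfolding bounded_iff by auto
  have "\<bar>goursat_op g a (\<lambda>x y. q (x, y)) (fst z) (snd z)\<bar> \<le> \<eta> * D * d + B" for z
    using goursat_op_const_bound[OF cq, of d "fst z" "snd z"] d g_bound[of "fst z"] by fastforce
  then have "bounded (range (\<lambda>z. goursat_op g a (\<lambda>x y. q (x, y)) (fst z) (snd z)))"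
    by (intro boundedI[of _ "\<eta> * D * d + B"]) auto
  then show ?thesis
    using goursat_op_cont[OF cq] by (simp add: bcontfun_def case_prod_unfold)
qed

definition goursat_bc :: "((real \<times> real) \<Rightarrow>\<^sub>C real) \<Rightarrow> ((real \<times> real) \<Rightarrow>\<^sub>C real)"
  where "goursat_bc q = Bcontfun (\<lambda>z. goursat_op g a (\<lambda>x y. q (x, y)) (fst z) (snd z))"

lemma goursat_bc_apply: "goursat_bc q z = goursat_op g a (\<lambda>x y. q (x, y)) (fst z) (snd z)"
  unfolding goursat_bc_def by (simp add: Bcontfun_inverse goursat_op_bcontfun)

lemma goursat_bc_dist: "dist (goursat_bc q) (goursat_bc q') \<le> \<eta> * D * dist q q'"
proof (rule dist_bound)
  fix z
  show "dist (goursat_bc q z) (goursat_bc q' z) \<le> \<eta> * D * dist q q'"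
    unfolding goursat_bc_apply dist_real_def
    by (rule goursat_op_diff) (use dist_bounded[of q _ q'] in \<open>auto simp: dist_real_def\<close>)
qed

end

text \<open>The equation for \<open>Q\<close> is integrated in the first variable; exchanging the
  variables lets one operator serve both equations.\<close>

definition swap_bc :: "((real \<times> real) \<Rightarrow>\<^sub>C real) \<Rightarrow> ((real \<times> real) \<Rightarrow>\<^sub>C real)"
  where "swap_bc q = Bcontfun (\<lambda>z. q (snd z, fst z))"

lemma swap_bc_apply: "swap_bc q z = q (snd z, fst z)"
proof -
  have "continuous_on UNIV (\<lambda>z. q (snd z, fst z))"
    by (rule continuous_on_compose2[OF continuous_on_apply_bcontfun[of UNIV]]) (auto intro!: continuous_intros)
  moreover have "bounded (range (\<lambda>z. q (snd z, fst z)))"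
    by (rule bounded_subset[OF bounded_apply_bcontfun[of q]]) auto
  ultimately show ?thesis by (simp add: swap_bc_def Bcontfun_inverse bcontfun_def)
qed

lemma swap_bc_dist: "dist (swap_bc q) (swap_bc q') \<le> dist q q'"
  by (rule dist_bound) (simp add: swap_bc_apply dist_bounded)

text \<open>Substituting one integral equation into the other gives a fixed-point problem for
  \<open>P\<close> alone, a contraction on bounded continuous functions on the plane. The estimates
  around \<open>g\<close> follow by absorption: the common supremum \<open>M\<close> of
  \<open>\<bar>P\<bar>\<close> and \<open>\<bar>Q\<bar>\<close> satisfies
  \<open>M \<le> \<eta> * D * M + B\<close>, and \<open>\<eta> * D \<le> 1/2\<close>.\<close>

lemma goursat_system:
  assumes a: "goursat_coeff a g \<eta> D B" and b: "goursat_coeff (\<lambda>y x. b x y) g \<eta> D B"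
    and small: "\<eta> * D \<le> 1/2"
  obtains P Q :: "real \<Rightarrow> real \<Rightarrow> real" where
    "cont2 P" "cont2 Q"
    "\<And>x. P x x = g x" "\<And>x. Q x x = g x"
    "\<And>x y. (P x has_real_derivative a x y * Q x y) (at y)"
    "\<And>x y. ((\<lambda>x. Q x y) has_real_derivative b x y * P x y) (at x)"
    "\<And>x y. \<bar>P x y - g x\<bar> \<le> \<eta> * D * (2 * B)" "\<And>x y. \<bar>Q x y - g y\<bar> \<le> \<eta> * D * (2 * B)"
proof -
  interpret a: goursat_coeff a g \<eta> D B by (rule a)
  interpret b: goursat_coeff "\<lambda>y x. b x y" g \<eta> D B by (rule b)
  have \<eta>: "\<eta> * D \<ge> 0" using a.a_bound[of 0 0] a.D by simp
  define K where "K = (\<lambda>p. a.goursat_bc (swap_bc (b.goursat_bc (swap_bc p))))"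
  have "dist (K p) (K p') \<le> 1/2 * dist p p'" for p p'
  proof -
    have "dist (K p) (K p') \<le> \<eta> * D * dist (swap_bc (b.goursat_bc (swap_bc p))) (swap_bc (b.goursat_bc (swap_bc p')))"
      unfolding K_def by (rule a.goursat_bc_dist)
    also have "\<dots> \<le> \<eta> * D * dist (b.goursat_bc (swap_bc p)) (b.goursat_bc (swap_bc p'))"
      by (intro mult_left_mono swap_bc_dist \<eta>)
    also have "\<dots> \<le> \<eta> * D * (\<eta> * D * dist (swap_bc p) (swap_bc p'))"
      by (intro mult_left_mono b.goursat_bc_dist \<eta>)
    also have "\<dots> \<le> \<eta> * D * (\<eta> * D * dist p p')"
      by (intro mult_left_mono swap_bc_dist \<eta>)
    also have "\<dots> \<le> 1/2 * (1 * dist p p')"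
    proof (rule mult_mono[OF small])
      show "\<eta> * D * dist p p' \<le> 1 * dist p p'" using small by (intro mult_right_mono) auto
    qed (use mult_nonneg_nonneg[OF \<eta> zero_le_dist] in auto)
    finally show ?thesis by simp
  qed
  then obtain p where p: "K p = p"
    using banach_fix_type[where c="1/2" and f=K] by auto
  define q where "q = swap_bc (b.goursat_bc (swap_bc p))"
  define P Q where "P = (\<lambda>x y. p (x, y))" and "Q = (\<lambda>x y. q (x, y))"
  have cP: "cont2 P" and cQ: "cont2 Q"
    by (simp_all add: P_def Q_def)
  have cP': "continuous_on UNIV (\<lambda>(y, x). P x y)"
    unfolding P_def case_prod_unfold
    by (rule continuous_on_compose2[OF continuous_on_apply_bcontfun[of UNIV]]) (auto intro!: continuous_intros)
  have P: "P x y = goursat_op g a Q x y" for x y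
    using arg_cong[OF p, of "\<lambda>p. p (x, y)"] unfolding K_def q_def[symmetric]
    by (simp add: a.goursat_bc_apply P_def Q_def)
  have Q: "Q x y = goursat_op g (\<lambda>y x. b x y) (\<lambda>y x. P x y) y x" for x y
    by (simp add: Q_def q_def swap_bc_apply b.goursat_bc_apply P_def)
  obtain m where m: "\<And>x y. \<bar>P x y\<bar> \<le> m" "\<And>x y. \<bar>Q x y\<bar> \<le> m"
  proof -
    obtain m1 where "\<And>z. \<bar>p z\<bar> \<le> m1"
      using bounded_apply_bcontfun[of p] unfolding bounded_iff by auto
    moreover obtain m2 where "\<And>z. \<bar>q z\<bar> \<le> m2"
      using bounded_apply_bcontfun[of q] unfolding bounded_iff by auto
    ultimately show ?thesis by (intro that[of "max m1 m2"]) (auto simp: P_def Q_def le_max_iff_disj)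
  qed
  define M where "M = Sup (range (\<lambda>(x, y). \<bar>P x y\<bar>) \<union> range (\<lambda>(x, y). \<bar>Q x y\<bar>))" (is "M = Sup ?S")
  have bdd: "bdd_above ?S"
    unfolding bdd_above_def using m by (intro exI[of _ m]) auto
  have PM: "\<bar>P x y\<bar> \<le> M" and QM: "\<bar>Q x y\<bar> \<le> M" for x y
    unfolding M_def by (intro cSup_upper bdd; force)+
  have dP: "\<bar>P x y - g x\<bar> \<le> \<eta> * D * M" for x y
    unfolding P by (rule a.goursat_op_const_bound[OF cQ QM])
  have dQ: "\<bar>Q x y - g y\<bar> \<le> \<eta> * D * M" for x y
    unfolding Q by (rule b.goursat_op_const_bound[OF cP' PM])
  have M0: "M \<ge> 0" using PM[of 0 0] by linarith
  have "M \<le> \<eta> * D * M + B"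
  proof (subst M_def, rule cSup_least)
    fix s assume "s \<in> ?S"
    then show "s \<le> \<eta> * D * M + B"
    proof
      assume "s \<in> range (\<lambda>(x, y). \<bar>P x y\<bar>)"
      then obtain x y where s: "s = \<bar>P x y\<bar>" by auto
      show ?thesis using dP[of x y] a.g_bound[of x] unfolding s by linarith
    next
      assume "s \<in> range (\<lambda>(x, y). \<bar>Q x y\<bar>)"
      then obtain x y where s: "s = \<bar>Q x y\<bar>" by auto
      show ?thesis using dQ[of x y] a.g_bound[of y] unfolding s by linarith
    qed
  qed auto
  moreover have "\<eta> * D * M \<le> 1/2 * M" using small M0 by (intro mult_right_mono)
  ultimately have "M \<le> 2 * B" by linarith
  then have M2: "\<eta> * D * M \<le> \<eta> * D * (2 * B)" by (intro mult_left_mono \<eta>)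
  show ?thesis
  proof (rule that[OF cP cQ])
    show "P x x = g x" for x unfolding P by (simp add: goursat_op_def)
    show "Q x x = g x" for x unfolding Q by (simp add: goursat_op_def)
    show "(P x has_real_derivative a x y * Q x y) (at y)" for x y
      using a.DERIV_goursat_op[OF cQ, of x y] by (simp add: P[abs_def])
    show "((\<lambda>x. Q x y) has_real_derivative b x y * P x y) (at x)" for x y
      using b.DERIV_goursat_op[OF cP', of y x] by (simp add: Q)
    show "\<bar>P x y - g x\<bar> \<le> \<eta> * D * (2 * B)" for x y using dP[of x y] M2 by linarith
    show "\<bar>Q x y - g y\<bar> \<le> \<eta> * D * (2 * B)" for x y using dQ[of x y] M2 by linarith
  qed
qed

section \<open>Characteristic coordinates\<close>

lemma cont2_compose:
  assumes "cont2 f" "continuous_on S g" "continuous_on S h"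
  shows "continuous_on S (\<lambda>z. f (g z) (h z))"
  by (rule continuous_on_compose_pair[where A=UNIV and B=UNIV, OF _ assms(2,3)]) (use assms(1) in auto)

text \<open>For unit speed \<open>p = q = 1/2\<close>, and \<open>X + T\<close>,
  \<open>X - T\<close> are the two coordinates up to constants; \<open>E\<close> is the deviation
  from this. Its four partial derivatives are at most 1/10, so its Lipschitz constant is at most
  2/5. The derivatives of \<open>A\<close> and \<open>B\<close> are the entries of the inverse
  Jacobian of \<open>(T, X)\<close>, whose determinant is \<open>2 * k * p * q\<close>.\<close>

lemma near_identity_coordinates:
  fixes T X p q k :: "real \<Rightarrow> real \<Rightarrow> real"
  assumes T: "\<And>x y. ((\<lambda>x. T x y) has_real_derivative p x y) (at x)"
      "\<And>x y. (T x has_real_derivative - q x y) (at y)"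
    and X: "\<And>x y. ((\<lambda>x. X x y) has_real_derivative k x y * p x y) (at x)"
      "\<And>x y. (X x has_real_derivative k x y * q x y) (at y)"
    and cont: "cont2 p" "cont2 q"
      "cont2 k"
    and bds: "\<And>x y. \<bar>p x y - 1/2\<bar> \<le> 1/20" "\<And>x y. \<bar>q x y - 1/2\<bar> \<le> 1/20"
      "\<And>x y. \<bar>k x y * p x y - 1/2\<bar> \<le> 1/20" "\<And>x y. \<bar>k x y * q x y - 1/2\<bar> \<le> 1/20"
      "\<And>x y. k x y > 0"
  obtains A B :: "real \<Rightarrow> real \<Rightarrow> real" where
    "\<And>t x. T (A t x) (B t x) = t" "\<And>t x. X (A t x) (B t x) = x"
    "\<And>\<alpha> \<beta>. A (T \<alpha> \<beta>) (X \<alpha> \<beta>) = \<alpha>" "\<And>\<alpha> \<beta>. B (T \<alpha> \<beta>) (X \<alpha> \<beta>) = \<beta>"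
    "cont2 A" "cont2 B"
    "\<And>t x. ((\<lambda>t. A t x) has_real_derivative 1 / (2 * p (A t x) (B t x))) (at t)"
    "\<And>t x. (A t has_real_derivative 1 / (2 * k (A t x) (B t x) * p (A t x) (B t x))) (at x)"
    "\<And>t x. ((\<lambda>t. B t x) has_real_derivative - 1 / (2 * q (A t x) (B t x))) (at t)"
    "\<And>t x. (B t has_real_derivative 1 / (2 * k (A t x) (B t x) * q (A t x) (B t x))) (at x)"
proof -
  define E where "E = (\<lambda>z::real\<times>real. (X (fst z) (snd z) + T (fst z) (snd z) - fst z,
    X (fst z) (snd z) - T (fst z) (snd z) - snd z))"
  have lip: "norm (E z - E w) \<le> norm (z - w) / 2" for z w
  proof -
    have bb: "\<bar>k x y * p x y + p x y - 1\<bar> \<le> 1/10" "\<bar>k x y * q x y - q x y\<bar> \<le> 1/10"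
      "\<bar>k x y * p x y - p x y\<bar> \<le> 1/10" "\<bar>k x y * q x y + q x y - 1\<bar> \<le> 1/10" for x y
      using bds(1-4)[of x y] by linarith+
    obtain x y where z: "z = (x, y)" by force
    obtain x' y' where w: "w = (x', y')" by force
    have 1: "\<bar>(X x y + T x y - x) - (X x' y + T x' y - x')\<bar> \<le> 1/10 * \<bar>x - x'\<bar>"
      by (rule DERIV_bound[where f="\<lambda>x. k x y * p x y + p x y - 1"])
        (use bb in \<open>auto intro!: derivative_eq_intros T X\<close>)
    have 2: "\<bar>(X x' y + T x' y - x') - (X x' y' + T x' y' - x')\<bar> \<le> 1/10 * \<bar>y - y'\<bar>"
      by (rule DERIV_bound[where f="\<lambda>y. k x' y * q x' y - q x' y"])
        (use bb in \<open>auto intro!: derivative_eq_intros T X\<close>)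
    have 3: "\<bar>(X x y - T x y - y) - (X x' y - T x' y - y)\<bar> \<le> 1/10 * \<bar>x - x'\<bar>"
      by (rule DERIV_bound[where f="\<lambda>x. k x y * p x y - p x y"])
        (use bb in \<open>auto intro!: derivative_eq_intros T X\<close>)
    have 4: "\<bar>(X x' y - T x' y - y) - (X x' y' - T x' y' - y')\<bar> \<le> 1/10 * \<bar>y - y'\<bar>"
      by (rule DERIV_bound[where f="\<lambda>y. k x' y * q x' y + q x' y - 1"])
        (use bb in \<open>auto intro!: derivative_eq_intros T X\<close>)
    have tri: "\<bar>a - c\<bar> \<le> r + s" if "\<bar>a - b\<bar> \<le> r" "\<bar>b - c\<bar> \<le> s" for a b c r s :: real
      using that by linarith
    have "norm (E z - E w) \<le> \<bar>fst (E z - E w)\<bar> + \<bar>snd (E z - E w)\<bar>"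
      using norm_Pair_le[of "fst (E z - E w)" "snd (E z - E w)"] unfolding prod.collapse real_norm_def .
    also have "\<dots> \<le> 1/5 * (\<bar>x - x'\<bar> + \<bar>y - y'\<bar>)"
      using tri[OF 1 2] tri[OF 3 4] unfolding E_def z w fst_conv snd_conv fst_diff snd_diff
      by (simp add: algebra_simps)
    also have "\<bar>x - x'\<bar> + \<bar>y - y'\<bar> \<le> 2 * norm (z - w)"
      using norm_fst_le[of "x - x'" "y - y'"] norm_snd_le[of "y - y'" "x - x'"] by (simp add: z w)
    finally show ?thesis using norm_ge_zero[of "z - w"] by linarith
  qed
  obtain g where g1: "\<And>w. g w + E (g w) = w" and g2: "\<And>z. g (z + E z) = z" and gc: "continuous_on UNIV g"
    using near_identity_inverse[of E] lip by blast
  \<comment> \<open>\<open>g\<close> inverts the pair \<open>(X + T, X - T)\<close>; feeding it with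
    \<open>(x + t, x - t)\<close> inverts \<open>(T, X)\<close>.\<close>
  define G where "G = (\<lambda>z::real\<times>real. g (snd z + fst z, snd z - fst z))"
  define F where "F = (\<lambda>z. (T (fst z) (snd z), X (fst z) (snd z)))"
  have FG: "F (G z) = z" for z
    using g1[of "(snd z + fst z, snd z - fst z)"] unfolding G_def F_def E_def
    by (auto simp: prod_eq_iff)
  have GF: "G (F z) = z" for z
  proof -
    have "(snd (F z) + fst (F z), snd (F z) - fst (F z)) = z + E z"
      unfolding F_def E_def by (auto simp: prod_eq_iff)
    then show ?thesis unfolding G_def using g2[of z] by simp
  qed
  have Gc: "continuous_on UNIV G"
    unfolding G_def by (rule continuous_on_compose2[OF gc]) (auto intro!: continuous_intros)
  define A B where "A = (\<lambda>t x. fst (G (t, x)))" and "B = (\<lambda>t x. snd (G (t, x)))"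
  have GAB: "G (t, x) = (A t x, B t x)" for t x by (simp add: A_def B_def)
  have cA: "cont2 A" and cB: "cont2 B"
    using continuous_on_fst[OF Gc] continuous_on_snd[OF Gc] by (simp_all add: A_def B_def case_prod_unfold)
  have c: "continuous_on (UNIV \<times> UNIV) (\<lambda>(x, y). - q x y)" "continuous_on (UNIV \<times> UNIV) (\<lambda>(x, y). k x y * q x y)"
    using cont by (auto simp: case_prod_unfold intro!: continuous_intros)
  have dF: "(F has_derivative (\<lambda>(h, l). (p x y * h + - q x y * l, k x y * p x y * h + k x y * q x y * l))) (at (x, y))" for x y
  proof -
    have "((\<lambda>(x, y). T x y) has_derivative (\<lambda>(h, l). p x y * h + - q x y * l)) (at (x, y) within UNIV \<times> UNIV)"
      by (rule has_derivative_partials_real[OF _ _ c(1)]) (use T in auto)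
    moreover have "((\<lambda>(x, y). X x y) has_derivative (\<lambda>(h, l). k x y * p x y * h + k x y * q x y * l)) (at (x, y) within UNIV \<times> UNIV)"
      by (rule has_derivative_partials_real[OF _ _ c(2)]) (use X in auto)
    ultimately show ?thesis
      unfolding F_def using has_derivative_Pair by (fastforce simp: case_prod_unfold)
  qed
  have dG: "(G has_derivative (\<lambda>(h, l). (h / (2 * p (A t x) (B t x)) + l / (2 * k (A t x) (B t x) * p (A t x) (B t x)),
      - h / (2 * q (A t x) (B t x)) + l / (2 * k (A t x) (B t x) * q (A t x) (B t x))))) (at (t, x))" for t x
  proof (rule has_derivative_inverse_basic[where f=F and T=UNIV and g=G and y="(t, x)", OF dF[of "A t x" "B t x", folded GAB]])
    let ?p = "p (A t x) (B t x)" and ?q = "q (A t x) (B t x)" and ?k = "k (A t x) (B t x)"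
    have pos: "?p > 0" "?q > 0" "?k > 0"
      using bds(1,2)[of "A t x" "B t x"] bds(5)[of "A t x" "B t x"] by linarith+
    show "bounded_linear (\<lambda>(h, l). (h / (2 * ?p) + l / (2 * ?k * ?p), - h / (2 * ?q) + l / (2 * ?k * ?q)))"
      unfolding case_prod_unfold divide_inverse
      by (intro bounded_linear_Pair bounded_linear_add bounded_linear_mult_left
          bounded_linear_mult_const bounded_linear_minus bounded_linear_fst bounded_linear_snd)
    show "(\<lambda>(h, l). (h / (2 * ?p) + l / (2 * ?k * ?p), - h / (2 * ?q) + l / (2 * ?k * ?q))) \<circ>
        (\<lambda>(h, l). (?p * h + - ?q * l, ?k * ?p * h + ?k * ?q * l)) = id"
      using pos by (auto simp: fun_eq_iff field_simps)
    show "continuous (at (t, x)) G"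
      using Gc by (simp add: continuous_on_eq_continuous_at)
  qed (auto simp: FG)
  have dt: "((\<lambda>t. (t, x)) has_derivative (\<lambda>h. (h, 0))) (at t)" for t x :: real
    by (auto intro!: derivative_eq_intros)
  have dx: "((\<lambda>x. (t, x)) has_derivative (\<lambda>h. (0, h))) (at x)" for t x :: real
    by (auto intro!: derivative_eq_intros)
  note Gt = has_derivative_compose[OF dt dG] and Gx = has_derivative_compose[OF dx dG]
  show ?thesis
  proof (rule that[of A B])
    show "T (A t x) (B t x) = t" "X (A t x) (B t x) = x" for t x
      using FG[of "(t, x)"] by (auto simp: F_def A_def B_def)
    show "A (T \<alpha> \<beta>) (X \<alpha> \<beta>) = \<alpha>" "B (T \<alpha> \<beta>) (X \<alpha> \<beta>) = \<beta>" for \<alpha> \<beta>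
      using GF[of "(\<alpha>, \<beta>)"] by (auto simp: F_def A_def B_def)
    show "((\<lambda>t. A t x) has_real_derivative 1 / (2 * p (A t x) (B t x))) (at t)"
      "((\<lambda>t. B t x) has_real_derivative - 1 / (2 * q (A t x) (B t x))) (at t)" for t x
      using has_derivative_fst[OF Gt[of x t]] has_derivative_snd[OF Gt[of x t]]
      by (auto simp: has_field_derivative_def A_def B_def elim!: has_derivative_eq_rhs)
    show "(A t has_real_derivative 1 / (2 * k (A t x) (B t x) * p (A t x) (B t x))) (at x)"
      "(B t has_real_derivative 1 / (2 * k (A t x) (B t x) * q (A t x) (B t x))) (at x)" for t x
      using has_derivative_fst[OF Gx[of t x]] has_derivative_snd[OF Gx[of t x]]
      by (auto simp: has_field_derivative_def A_def[abs_def] B_def[abs_def] elim!: has_derivative_eq_rhs)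
  qed (rule cA cB)+
qed

text \<open>The coordinates \<open>A\<close> and \<open>B\<close> label the characteristics of the two families by their feet.
  Conversely \<open>dt = p dA - q dB\<close> and \<open>dx = k (p dA + q dB)\<close>, and both forms are closed iff
  \<open>P = \<surd>k p\<close> and \<open>Q = \<surd>k q\<close> solve a Goursat system with coefficients
  \<open>k\<^sub>A / (2 k)\<close> and \<open>k\<^sub>B / (2 k)\<close>. The speed \<open>k0\<close> is replaced by \<open>1\<close> away from the diagonal, so that
  these coefficients have small integrals and the coordinates are global.\<close>

lemma characteristic_coordinates:
  fixes k0 k0x k0y :: "real \<Rightarrow> real \<Rightarrow> real"
  assumes d0: "\<And>x y. ((\<lambda>x. k0 x y) has_real_derivative k0x x y) (at x)"
      "\<And>x y. (k0 x has_real_derivative k0y x y) (at y)"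
    and c0: "cont2 k0" "cont2 k0x" "cont2 k0y"
    and b0: "\<And>x y. \<bar>k0 x y - 1\<bar> \<le> \<eta>0" "\<And>x y. \<bar>k0x x y\<bar> \<le> \<eta>" "\<And>x y. \<bar>k0y x y\<bar> \<le> \<eta>"
    and L: "L > 0" and small: "2 * L * \<eta> + 32 * \<eta>0 \<le> 1/100"
  obtains A B \<kappa> a b :: "real \<Rightarrow> real \<Rightarrow> real" where
    "\<And>x. A 0 x = x" "\<And>x. B 0 x = x"
    "\<And>t x. ((\<lambda>t. A t x) has_real_derivative \<kappa> t x * a t x) (at t)"
    "\<And>t x. (A t has_real_derivative a t x) (at x)"
    "\<And>t x. ((\<lambda>t. B t x) has_real_derivative - \<kappa> t x * b t x) (at t)"
    "\<And>t x. (B t has_real_derivative b t x) (at x)"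
    "cont2 A" "cont2 B"
    "cont2 \<kappa>"
    "cont2 a" "cont2 b"
    "\<And>t x. \<bar>a t x\<bar> \<le> 2" "\<And>t x. \<bar>b t x\<bar> \<le> 2"
    "\<And>t x. \<bar>t\<bar> < L / 4 \<Longrightarrow> \<kappa> t x = k0 (A t x) (B t x)"
proof -

  \<comment> \<open>The speed, cut off away from the diagonal\<close>
  obtain \<rho> \<rho>' :: "real \<Rightarrow> real" where \<rho>: "\<And>x. (\<rho> has_real_derivative \<rho>' x) (at x)" "continuous_on UNIV \<rho>'"
    "\<And>x. \<rho> x \<in> {0..1}" "\<And>x. \<bar>x\<bar> \<le> 1 \<Longrightarrow> \<rho> x = 1"
    "\<And>x. \<bar>x\<bar> \<ge> 2 \<Longrightarrow> \<rho> x = 0" "\<And>x. \<bar>x\<bar> \<ge> 2 \<Longrightarrow> \<rho>' x = 0" "\<And>x. \<bar>\<rho>' x\<bar> \<le> 16"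
    using cutoff_exists by blast
  have c\<rho>: "continuous_on UNIV \<rho>"
    using \<rho>(1) by (meson DERIV_isCont continuous_at_imp_continuous_on)
  have \<eta>0: "\<eta>0 \<ge> 0" and \<eta>: "\<eta> \<ge> 0" using b0(1,2)[of 0 0] by linarith+
  have "2 * L * \<eta> \<ge> 0" using L \<eta> by simp
  then have \<eta>0s: "\<eta>0 \<le> 1/3200" using small by linarith
  define k where "k = (\<lambda>x y. 1 + \<rho> ((x - y) / L) * (k0 x y - 1))"
  define kx where "kx = (\<lambda>x y. \<rho>' ((x - y) / L) / L * (k0 x y - 1) + \<rho> ((x - y) / L) * k0x x y)"
  define ky where "ky = (\<lambda>x y. - (\<rho>' ((x - y) / L) / L) * (k0 x y - 1) + \<rho> ((x - y) / L) * k0y x y)"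
  have dkx: "((\<lambda>x. k x y) has_real_derivative kx x y) (at x)" for x y
    unfolding k_def kx_def using L
    by (auto intro!: derivative_eq_intros DERIV_chain2[OF \<rho>(1)] d0)
  have dky: "(k x has_real_derivative ky x y) (at y)" for x y
    unfolding k_def ky_def using L
    by (auto intro!: derivative_eq_intros DERIV_chain2[OF \<rho>(1)] d0)
  have c0': "continuous_on UNIV (\<lambda>z. k0 (fst z) (snd z))" "continuous_on UNIV (\<lambda>z. k0x (fst z) (snd z))"
      "continuous_on UNIV (\<lambda>z. k0y (fst z) (snd z))"
    using c0 by (simp_all add: case_prod_unfold)
  have ck: "continuous_on UNIV (\<lambda>z. k (fst z) (snd z))"
    unfolding k_def using L
    by (intro continuous_intros continuous_on_compose2[OF c\<rho>] c0') auto
  have ckx: "continuous_on UNIV (\<lambda>z. kx (fst z) (snd z))"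
    unfolding kx_def using L
    by (intro continuous_intros continuous_on_compose2[OF c\<rho>] continuous_on_compose2[OF \<rho>(2)] c0') auto
  have cky: "continuous_on UNIV (\<lambda>z. ky (fst z) (snd z))"
    unfolding ky_def using L
    by (intro continuous_intros continuous_on_compose2[OF c\<rho>] continuous_on_compose2[OF \<rho>(2)] c0') auto
  have k1: "\<bar>k x y - 1\<bar> \<le> 1/3200" for x y
  proof -
    have "\<bar>\<rho> ((x - y) / L)\<bar> * \<bar>k0 x y - 1\<bar> \<le> 1 * (1/3200)"
      by (rule mult_mono) (use \<rho>(3)[of "(x - y) / L"] b0(1)[of x y] \<eta>0s in auto)
    then show ?thesis by (simp add: k_def abs_mult)
  qed
  \<comment> \<open>The cutoff has slope at most \<open>16 / L\<close> and multiplies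
    \<open>k0 - 1\<close>, which adds \<open>16 * \<eta>0 / L\<close>. Times the radius
    \<open>2 * L\<close> of the support this becomes \<open>2 * L * \<eta> + 32 * \<eta>0\<close>,
    the quantity assumed small.\<close>
  define \<eta>' where "\<eta>' = \<eta> + 16 * \<eta>0 / L"
  have bk: "\<bar>kx x y\<bar> \<le> \<eta>'" "\<bar>ky x y\<bar> \<le> \<eta>'" for x y
  proof -
    have 1: "\<bar>\<rho>' ((x - y) / L) / L * (k0 x y - 1)\<bar> \<le> 16 / L * \<eta>0"
      unfolding abs_mult abs_divide using L b0(1)[of x y] \<rho>(7) \<eta>0 by (intro mult_mono divide_mono) auto
    have 2: "\<bar>\<rho> ((x - y) / L) * k0x x y\<bar> \<le> 1 * \<eta>" "\<bar>\<rho> ((x - y) / L) * k0y x y\<bar> \<le> 1 * \<eta>"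
      unfolding abs_mult using b0(2,3)[of x y] \<rho>(3)[of "(x - y) / L"] by (intro mult_mono; auto)+
    show "\<bar>kx x y\<bar> \<le> \<eta>'" "\<bar>ky x y\<bar> \<le> \<eta>'"
      using abs_triangle_ineq[of "\<rho>' ((x - y) / L) / L * (k0 x y - 1)" "\<rho> ((x - y) / L) * k0x x y"]
        abs_triangle_ineq[of "- (\<rho>' ((x - y) / L) / L * (k0 x y - 1))" "\<rho> ((x - y) / L) * k0y x y"] 1 2
      unfolding kx_def ky_def \<eta>'_def abs_minus_cancel minus_mult_left[symmetric] by (simp_all add: field_simps)
  qed
  have supp: "kx x y = 0" "ky x y = 0" if "\<bar>x - y\<bar> \<ge> 2 * L" for x y
  proof -
    have "\<bar>(x - y) / L\<bar> \<ge> 2" using that L by (simp add: field_simps)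
    then show "kx x y = 0" "ky x y = 0" using \<rho>(5,6) by (auto simp: kx_def ky_def)
  qed
  have kpos: "k x y > 0" for x y using k1[of x y] by linarith
  define w where "w = (\<lambda>x y. sqrt (k x y))"
  have w2: "w x y * w x y = k x y" for x y using kpos[of x y] by (simp add: w_def)
  have w1: "\<bar>w x y - 1\<bar> \<le> 1/1000" for x y
  proof -
    have k: "k x y \<le> 3201/3200" "k x y \<ge> 3199/3200" using k1[of x y] by linarith+
    have "w x y \<le> 1001/1000" unfolding w_def
      by (rule real_le_lsqrt) (use k in \<open>simp_all add: power2_eq_square\<close>)
    moreover have "w x y \<ge> 999/1000" unfolding w_def
      by (rule real_le_rsqrt) (use k in \<open>simp_all add: power2_eq_square\<close>)
    ultimately show ?thesis by linarith
  qed
  have w3: "w x y \<ge> 999/1000" for x y using w1[of x y] by linarith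
  have wpos: "w x y > 0" for x y using w1[of x y] by linarith
  have cw: "continuous_on UNIV (\<lambda>z. w (fst z) (snd z))"
    unfolding w_def by (intro continuous_intros ck)
  have dwx: "((\<lambda>x. w x y) has_real_derivative kx x y / (2 * w x y)) (at x)" for x y
    unfolding w_def using kpos[of x y] by (auto intro!: derivative_eq_intros dkx simp: field_simps)
  have dwy: "(w x has_real_derivative ky x y / (2 * w x y)) (at y)" for x y
    unfolding w_def using kpos[of x y] by (auto intro!: derivative_eq_intros dky simp: field_simps)

  \<comment> \<open>The Goursat system for the rescaled derivatives of time and space\<close>
  define a where "a = (\<lambda>x y. kx x y / (2 * k x y))"
  define b where "b = (\<lambda>x y. ky x y / (2 * k x y))"
  \<comment> \<open>On the diagonal, which represents the initial line, this gives
    \<open>p = q = 1 / (2 * k)\<close>; hence \<open>T\<close> is constant and \<open>X\<close> has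
    slope 1 there.\<close>
  define g where "g = (\<lambda>x. 1 / (2 * w x x))"
  have ab: "\<bar>a x y\<bar> \<le> \<eta>'" "\<bar>b x y\<bar> \<le> \<eta>'" for x y
  proof -
    have k: "2 * k x y \<ge> 1" using k1[of x y] by linarith
    have "\<bar>kx x y\<bar> / (2 * k x y) \<le> \<bar>kx x y\<bar> / 1" "\<bar>ky x y\<bar> / (2 * k x y) \<le> \<bar>ky x y\<bar> / 1"
      using k by (intro divide_left_mono; simp)+
    then show "\<bar>a x y\<bar> \<le> \<eta>'" "\<bar>b x y\<bar> \<le> \<eta>'"
      using bk[of x y] k unfolding a_def b_def abs_divide by (auto simp: abs_of_pos)
  qed
  have g1: "\<bar>g x - 1/2\<bar> \<le> 1/900" for x
  proof -
    have "\<bar>g x - 1/2\<bar> = \<bar>w x x - 1\<bar> / (2 * w x x)"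
      using wpos[of x x] by (simp add: g_def field_simps abs_if)
    also have "\<dots> \<le> (1/1000) / (2 * (999/1000))"
      using w1[of x x] w3[of x x] by (intro frac_le) auto
    finally show ?thesis by simp
  qed
  have cg: "continuous_on UNIV g"
    unfolding g_def using wpos
    by (intro continuous_intros continuous_on_compose2[OF cw, where f="\<lambda>x. (x, x)", simplified])
       (auto intro!: continuous_intros simp: less_imp_neq[THEN not_sym])
  have cab: "cont2 a" "cont2 b"
    unfolding a_def b_def case_prod_unfold using kpos
    by (intro continuous_intros ck ckx cky; simp add: less_imp_neq[THEN not_sym])+
  have cb': "continuous_on UNIV (\<lambda>(y, x). b x y)"
    unfolding case_prod_unfold
    by (rule cont2_compose[OF cab(2)]) (auto intro!: continuous_intros)
  have gB: "\<bar>g x\<bar> \<le> 11/20" for x using g1[of x] by linarith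
  have ga: "goursat_coeff a g \<eta>' (2 * L) (11/20)"
    by unfold_locales (use cab(1) cg ab supp L gB in \<open>auto simp: a_def\<close>)
  have gb: "goursat_coeff (\<lambda>y x. b x y) g \<eta>' (2 * L) (11/20)"
    by unfold_locales (use cb' cg ab supp L gB in \<open>auto simp: b_def abs_minus_commute\<close>)
  have sm: "\<eta>' * (2 * L) \<le> 1/100"
  proof -
    have "\<eta>' * (2 * L) = 2 * L * \<eta> + 32 * \<eta>0" using L by (simp add: \<eta>'_def field_simps)
    then show ?thesis using small by simp
  qed
  obtain P Q where cP: "cont2 P" and cQ: "cont2 Q"
    and PQd: "\<And>x. P x x = g x" "\<And>x. Q x x = g x"
    and dP: "\<And>x y. (P x has_real_derivative a x y * Q x y) (at y)"
    and dQ: "\<And>x y. ((\<lambda>x. Q x y) has_real_derivative b x y * P x y) (at x)"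
    and PQb: "\<And>x y. \<bar>P x y - g x\<bar> \<le> \<eta>' * (2 * L) * (2 * (11/20))"
      "\<And>x y. \<bar>Q x y - g y\<bar> \<le> \<eta>' * (2 * L) * (2 * (11/20))"
    by (rule goursat_system[OF ga gb]) (use sm in \<open>auto\<close>)
  have P1: "\<bar>P x y - 1/2\<bar> \<le> 1/50" and Q1: "\<bar>Q x y - 1/2\<bar> \<le> 1/50" for x y
    using PQb(1)[of x y] PQb(2)[of x y] g1[of x] g1[of y] sm by linarith+

  \<comment> \<open>The two closed forms and their potentials\<close>
  define p where "p = (\<lambda>x y. P x y / w x y)"
  define q where "q = (\<lambda>x y. Q x y / w x y)"
  \<comment> \<open>\<open>r\<close> is the common mixed derivative that closes the form for
    \<open>T\<close>, and \<open>r2\<close> the one for \<open>X\<close>; the Goursat equations make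
    both pairs of mixed derivatives agree.\<close>
  define r where "r = (\<lambda>x y. (kx x y * Q x y - ky x y * P x y) / (2 * w x y * w x y * w x y))"
  define r2 where "r2 = (\<lambda>x y. (kx x y * Q x y + ky x y * P x y) / (2 * w x y))"
  have cP': "continuous_on UNIV (\<lambda>z. P (fst z) (snd z))" and cQ': "continuous_on UNIV (\<lambda>z. Q (fst z) (snd z))"
    using cP cQ by (simp_all add: case_prod_unfold)
  have wn: "w x y \<noteq> 0" for x y using wpos[of x y] by simp
  have cp: "cont2 p" and cq: "cont2 q"
    and cr: "cont2 r" and cr2: "cont2 r2"
    unfolding p_def q_def r_def r2_def case_prod_unfold
    by (intro continuous_intros cP' cQ' cw ckx cky; simp add: wn)+
  have dp: "(p x has_real_derivative r x y) (at y)" for x y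
    unfolding p_def r_def using wn[of x y]
    by (auto intro!: derivative_eq_intros dP dwy simp: a_def w2[symmetric] field_simps)
  have dq: "((\<lambda>x. - q x y) has_real_derivative r x y) (at x)" for x y
    unfolding q_def r_def using wn[of x y]
    by (auto intro!: derivative_eq_intros dQ dwx simp: b_def w2[symmetric] field_simps)
  have kp: "k x y * p x y = w x y * P x y" and kq: "k x y * q x y = w x y * Q x y" for x y
    using wn[of x y] by (simp_all add: p_def q_def w2[symmetric])
  have dkp: "((\<lambda>y. k x y * p x y) has_real_derivative r2 x y) (at y)" for x y
    unfolding kp r2_def using wn[of x y]
    by (auto intro!: derivative_eq_intros dP dwy simp: a_def w2[symmetric] field_simps)
  have dkq: "((\<lambda>x. k x y * q x y) has_real_derivative r2 x y) (at x)" for x y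
    unfolding kq r2_def using wn[of x y]
    by (auto intro!: derivative_eq_intros dQ dwx simp: b_def w2[symmetric] field_simps)
  have cpq: "continuous_on UNIV (\<lambda>(x, y). - q x y)" "continuous_on UNIV (\<lambda>(x, y). k x y * p x y)"
     "continuous_on UNIV (\<lambda>(x, y). k x y * q x y)"
    using cp cq ck by (auto simp: case_prod_unfold intro!: continuous_intros)
  obtain T where T0: "T 0 0 = 0" and T: "\<And>x y. ((\<lambda>x. T x y) has_real_derivative p x y) (at x)"
    "\<And>x y. (T x has_real_derivative - q x y) (at y)"
    by (rule potential_exists[OF dp dq cp cpq(1) cr]) blast
  obtain X where X0: "X 0 0 = 0" and X: "\<And>x y. ((\<lambda>x. X x y) has_real_derivative k x y * p x y) (at x)"
    "\<And>x y. (X x has_real_derivative k x y * q x y) (at y)"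
    by (rule potential_exists[OF dkp dkq cpq(2,3) cr2]) blast
  have pd: "p x x = q x x" "k x x * p x x + k x x * q x x = 1" for x
    using wn[of x x] unfolding kp kq by (simp_all add: p_def q_def PQd g_def field_simps)
  have Td: "T x x = 0" for x
  proof -
    have "((\<lambda>x. T x x) has_real_derivative 0) (at x)" for x
      using DERIV_along_curve[of "\<lambda>x y. T x y" "\<lambda>x. x" x "p x x" UNIV "\<lambda>x y. - q x y" 1] T(1)[of x x] T(2) cpq(1) pd(1)[of x]
      by auto
    then have "T x x = T 0 0" by (intro DERIV_isconst_all) auto
    then show ?thesis using T0 by simp
  qed
  have Xd: "X x x = x" for x
  proof -
    have "((\<lambda>x. X x x - x) has_real_derivative 0) (at x)" for x
    proof -
      have "((\<lambda>x. X x x) has_real_derivative 1) (at x)"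
        using DERIV_along_curve[of "\<lambda>x y. X x y" "\<lambda>x. x" x "k x x * p x x" UNIV "\<lambda>x y. k x y * q x y" 1] X(1)[of x x] X(2) cpq(3) pd(2)[of x]
        by auto
      then show ?thesis by (auto intro!: derivative_eq_intros)
    qed
    then have "X x x - x = X 0 0 - 0" by (intro DERIV_isconst_all[where f="\<lambda>x. X x x - x"]) auto
    then show ?thesis using X0 by simp
  qed
  have mulw: "\<bar>w x y * c - 1/2\<bar> \<le> 1/20" "\<bar>c / w x y - 1/2\<bar> \<le> 1/20" if c: "\<bar>c - 1/2\<bar> \<le> 1/50" for c x y
  proof -
    have c1: "\<bar>c\<bar> \<le> 1" using c by linarith
    have "\<bar>(w x y - 1) * c\<bar> \<le> 1/1000 * 1"
      unfolding abs_mult by (intro mult_mono w1 c1) auto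
    moreover have "w x y * c = (w x y - 1) * c + c" by (simp add: algebra_simps)
    ultimately show "\<bar>w x y * c - 1/2\<bar> \<le> 1/20" using c by linarith
    have "\<bar>c / w x y - c\<bar> = \<bar>c * (1 - w x y) / w x y\<bar>"
      using wn[of x y] by (simp add: field_simps)
    also have "\<dots> = \<bar>c\<bar> * \<bar>w x y - 1\<bar> / w x y"
      using wpos[of x y] by (simp add: abs_mult abs_minus_commute)
    also have "\<dots> \<le> (1 * (1/1000)) / (999/1000)"
      by (intro frac_le mult_mono c1 w1 w3) auto
    also have "\<dots> \<le> 1/900" by simp
    finally have "\<bar>c / w x y - c\<bar> \<le> 1/900" .
    then show "\<bar>c / w x y - 1/2\<bar> \<le> 1/20" using c by linarith
  qed
  have bds: "\<bar>p x y - 1/2\<bar> \<le> 1/20" "\<bar>q x y - 1/2\<bar> \<le> 1/20"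
      "\<bar>k x y * p x y - 1/2\<bar> \<le> 1/20" "\<bar>k x y * q x y - 1/2\<bar> \<le> 1/20" for x y
    unfolding kp kq unfolding p_def q_def using mulw P1 Q1 by auto
  have ck': "cont2 k" using ck by (simp add: case_prod_unfold)

  \<comment> \<open>Inversion of the coordinate change\<close>
  obtain A B where inv: "\<And>t x. T (A t x) (B t x) = t" "\<And>t x. X (A t x) (B t x) = x"
    "\<And>\<alpha> \<beta>. A (T \<alpha> \<beta>) (X \<alpha> \<beta>) = \<alpha>" "\<And>\<alpha> \<beta>. B (T \<alpha> \<beta>) (X \<alpha> \<beta>) = \<beta>"
    and cA: "cont2 A" and cB: "cont2 B"
    and dA: "\<And>t x. ((\<lambda>t. A t x) has_real_derivative 1 / (2 * p (A t x) (B t x))) (at t)"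
    "\<And>t x. (A t has_real_derivative 1 / (2 * k (A t x) (B t x) * p (A t x) (B t x))) (at x)"
    and dB: "\<And>t x. ((\<lambda>t. B t x) has_real_derivative - 1 / (2 * q (A t x) (B t x))) (at t)"
    "\<And>t x. (B t has_real_derivative 1 / (2 * k (A t x) (B t x) * q (A t x) (B t x))) (at x)"
    by (rule near_identity_coordinates[OF T X cp cq ck' bds kpos]) blast
  define \<kappa> where "\<kappa> = (\<lambda>t x. k (A t x) (B t x))"
  define a' where "a' = (\<lambda>t x. 1 / (2 * k (A t x) (B t x) * p (A t x) (B t x)))"
  define b' where "b' = (\<lambda>t x. 1 / (2 * k (A t x) (B t x) * q (A t x) (B t x)))"
  have pos: "p x y > 0" "q x y > 0" for x y using bds(1,2)[of x y] by linarith+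
  have cA': "continuous_on UNIV (\<lambda>z. A (fst z) (snd z))" and cB': "continuous_on UNIV (\<lambda>z. B (fst z) (snd z))"
    using cA cB by (simp_all add: case_prod_unfold)
  show ?thesis
  proof (rule that[of A B \<kappa> a' b'])
    show "A 0 x = x" "B 0 x = x" for x using inv(3,4)[of x x] by (simp_all add: Td Xd)
    show "((\<lambda>t. A t x) has_real_derivative \<kappa> t x * a' t x) (at t)" for t x
      using dA(1)[of x t] kpos[of "A t x" "B t x"] by (simp add: \<kappa>_def a'_def)
    show "((\<lambda>t. B t x) has_real_derivative - \<kappa> t x * b' t x) (at t)" for t x
      using dB(1)[of x t] kpos[of "A t x" "B t x"] by (simp add: \<kappa>_def b'_def)
    show "(A t has_real_derivative a' t x) (at x)" "(B t has_real_derivative b' t x) (at x)" for t x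
      using dA(2) dB(2) by (simp_all add: a'_def b'_def)
    have c1: "continuous_on UNIV (\<lambda>z. k (A (fst z) (snd z)) (B (fst z) (snd z)))"
      "continuous_on UNIV (\<lambda>z. p (A (fst z) (snd z)) (B (fst z) (snd z)))"
      "continuous_on UNIV (\<lambda>z. q (A (fst z) (snd z)) (B (fst z) (snd z)))"
      by (rule cont2_compose[OF ck' cA' cB'] cont2_compose[OF cp cA' cB'] cont2_compose[OF cq cA' cB'])+
    have nz: "k x y \<noteq> 0" "p x y \<noteq> 0" "q x y \<noteq> 0" for x y using kpos[of x y] pos[of x y] by auto
    show "cont2 \<kappa>" "cont2 a'"
      "cont2 b'"
      unfolding \<kappa>_def a'_def b'_def case_prod_unfold
      by (intro continuous_intros c1; simp add: nz)+
    have "\<bar>1 / (2 * k x y * p x y)\<bar> \<le> 2" "\<bar>1 / (2 * k x y * q x y)\<bar> \<le> 2" for x y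
    proof -
      have "2 * k x y * p x y \<ge> 1/2" "2 * k x y * q x y \<ge> 1/2"
        using bds(3,4)[of x y] by linarith+
      then show "\<bar>1 / (2 * k x y * p x y)\<bar> \<le> 2" "\<bar>1 / (2 * k x y * q x y)\<bar> \<le> 2"
        by (auto simp: abs_if divide_simps)
    qed
    then show "\<bar>a' t x\<bar> \<le> 2" "\<bar>b' t x\<bar> \<le> 2" for t x by (simp_all add: a'_def b'_def)
    \<comment> \<open>The function \<open>T - (A - B) / 2\<close> vanishes on the diagonal and has
      slope at most 1/20 in the first coordinate. Thus \<open>\<bar>t\<bar> < L / 4\<close> forces
      \<open>\<bar>A - B\<bar> \<le> L\<close>, where the cutoff equals 1.\<close>
    show "\<kappa> t x = k0 (A t x) (B t x)" if t: "\<bar>t\<bar> < L / 4" for t x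
    proof -
      let ?A = "A t x" and ?B = "B t x"
      have "\<bar>(T ?A ?B - ?A / 2) - (T ?B ?B - ?B / 2)\<bar> \<le> 1/20 * \<bar>?A - ?B\<bar>"
        by (rule DERIV_bound[where f="\<lambda>x. p x ?B - 1/2"])
          (use bds(1) in \<open>auto intro!: derivative_eq_intros T\<close>)
      then have "\<bar>?A - ?B\<bar> \<le> L" unfolding Td inv(1)
      proof -
        assume *: "\<bar>t - ?A / 2 - (0 - ?B / 2)\<bar> \<le> 1/20 * \<bar>?A - ?B\<bar>"
        have "(?A - ?B) / 2 = t - (t - ?A / 2 - (0 - ?B / 2))" by (simp add: diff_divide_distrib)
        then have "\<bar>?A - ?B\<bar> / 2 \<le> \<bar>t\<bar> + \<bar>t - ?A / 2 - (0 - ?B / 2)\<bar>"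
          by (metis abs_divide abs_numeral abs_triangle_ineq4)
        with * t show ?thesis by linarith
      qed
      then have "\<bar>(?A - ?B) / L\<bar> \<le> 1" using L by simp
      then show ?thesis using \<rho>(4) by (simp add: \<kappa>_def k_def)
    qed
  qed (rule cA cB)+
qed

section \<open>Solutions on a strip\<close>

lemma at_within_Ico_neq_bot:
  fixes T :: real
  assumes "t \<in> {0..<T}" shows "at t within {0..<T} \<noteq> bot"
proof -
  have "t islimpt {0..<T}"
  proof (rule connected_imp_perfect)
    have "T / 2 \<in> {0..<T}" "0 \<in> {0..<T}" "0 \<noteq> T / 2" using assms by auto
    then show "{0..<T} \<noteq> {x}" for x by (metis singletonD)
  qed (use assms in auto)
  then show ?thesis by (simp add: trivial_limit_within)
qed

lemma Dt_eqI:
  assumes "t \<in> {0..<T}" "((\<lambda>\<tau>. w \<tau> x) has_real_derivative d) (at t within {0..<T})"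
  shows "Dt T w t x = d"
  unfolding Dt_def using assms
  by (intro vector_derivative_within at_within_Ico_neq_bot)
    (auto simp: has_real_derivative_iff_has_vector_derivative)

lemma Dx_eqI: "(w t has_real_derivative d) (at x) \<Longrightarrow> Dx w t x = d"
  unfolding Dx_def by (rule DERIV_imp_deriv)

text \<open>\<open>w\<close> is compared with the explicit formula \<open>w0\<close> on the strip
  only, because the values of \<open>Dt T u\<close> outside it are not controlled.\<close>

lemma C1_stripI:
  assumes eq: "\<And>t x. t \<in> {0..<T} \<Longrightarrow> w t x = w0 t x"
    and dt: "\<And>t x. t \<in> {0..<T} \<Longrightarrow> ((\<lambda>\<tau>. w0 \<tau> x) has_real_derivative wt t x) (at t within {0..<T})"
    and dx: "\<And>t x. t \<in> {0..<T} \<Longrightarrow> (w0 t has_real_derivative wx t x) (at x)"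
    and c: "cont2_on {0..<T} w0"
      "cont2_on {0..<T} wt" "cont2_on {0..<T} wx"
  shows "C1_strip T w" "\<And>t x. t \<in> {0..<T} \<Longrightarrow> Dt T w t x = wt t x"
    "\<And>t x. t \<in> {0..<T} \<Longrightarrow> Dx w t x = wx t x"
proof -
  have 1: "((\<lambda>\<tau>. w \<tau> x) has_real_derivative wt t x) (at t within {0..<T})" if "t \<in> {0..<T}" for t x
    by (rule has_field_derivative_transform_within[OF dt[OF that], of 1]) (use that eq in auto)
  have 2: "(w t has_real_derivative wx t x) (at x)" if "t \<in> {0..<T}" for t x
  proof -
    have "w t = w0 t" using eq[OF that] by auto
    then show ?thesis using dx[OF that] by simp
  qed
  show 3: "Dt T w t x = wt t x" "Dx w t x = wx t x" if "t \<in> {0..<T}" for t x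
    using Dt_eqI[OF that 1[OF that]] Dx_eqI[of w t _ x, OF 2[OF that]] by auto
  have c': "cont2_on {0..<T} w"
    "cont2_on {0..<T} (Dt T w)" "cont2_on {0..<T} (Dx w)"
    by (rule continuous_on_eq[OF c(1)] continuous_on_eq[OF c(2)] continuous_on_eq[OF c(3)]; auto simp: 3 eq)+
  then show "C1_strip T w"
    unfolding C1_strip_def real_differentiable_def using 1 2 by blast
qed

lemma Linf_norm_le:
  assumes "continuous_on UNIV h" "\<And>x. \<bar>h x\<bar> \<le> K"
  shows "Linf_norm h \<le> ereal K"
  unfolding Linf_norm_def
proof (rule esssup_I)
  have "h \<in> borel_measurable borel" by (rule borel_measurable_continuous_onI[OF assms(1)])
  then show "(\<lambda>x. ereal \<bar>h x\<bar>) \<in> borel_measurable lborel" by measurable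
qed (use assms in auto)

text \<open>Here \<open>v\<close> stands for \<open>u\<^sub>t\<close> and \<open>\<theta>\<close> for \<open>u\<^sub>x\<close>.\<close>

locale wave_system =
  fixes c :: "real \<Rightarrow> real" and T :: real and v \<theta> vx \<theta>x :: "real \<Rightarrow> real \<Rightarrow> real"
  assumes v_x: "\<And>t x. t \<in> {0..<T} \<Longrightarrow> (v t has_real_derivative vx t x) (at x)"
    and \<theta>_x: "\<And>t x. t \<in> {0..<T} \<Longrightarrow> (\<theta> t has_real_derivative \<theta>x t x) (at x)"
    and v_t: "\<And>t x. t \<in> {0..<T} \<Longrightarrow>
      ((\<lambda>\<tau>. v \<tau> x) has_real_derivative (c (\<theta> t x))\<^sup>2 * \<theta>x t x) (at t within {0..<T})"
    and \<theta>_t: "\<And>t x. t \<in> {0..<T} \<Longrightarrow> ((\<lambda>\<tau>. \<theta> \<tau> x) has_real_derivative vx t x) (at t within {0..<T})"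
    and cont_v: "cont2_on {0..<T} v"
    and cont_\<theta>: "cont2_on {0..<T} \<theta>"
    and cont_vx: "cont2_on {0..<T} vx"
    and cont_\<theta>x: "cont2_on {0..<T} \<theta>x"

lemma lifespan_geI:
  assumes sys: "wave_system c T v \<theta> vx \<theta>x" and T: "T > 0"
    and ut: "\<And>t x. t \<in> {0..<T} \<Longrightarrow> ((\<lambda>\<tau>. u \<tau> x) has_real_derivative v t x) (at t within {0..<T})"
    and ux: "\<And>t x. t \<in> {0..<T} \<Longrightarrow> (u t has_real_derivative \<theta> t x) (at x)"
    and cu: "cont2_on {0..<T} u"
    and vt: "continuous_on ({0..<T} \<times> UNIV) (\<lambda>(t, x). (c (\<theta> t x))\<^sup>2 * \<theta>x t x)"
    and init: "\<And>x. u 0 x = f x" "\<And>x. v 0 x = g x"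
    and bd: "\<And>t x. t \<in> {0..<T} \<Longrightarrow> \<bar>u t x\<bar> \<le> K" "\<And>t x. t \<in> {0..<T} \<Longrightarrow> \<bar>v t x\<bar> \<le> K"
      "\<And>t x. t \<in> {0..<T} \<Longrightarrow> \<bar>vx t x\<bar> \<le> K"
      "\<And>t x. t \<in> {0..<T} \<Longrightarrow> \<bar>\<theta>x t x\<bar> \<le> K" "\<And>t x. t \<in> {0..<T} \<Longrightarrow> \<bar>(c (\<theta> t x))\<^sup>2 * \<theta>x t x\<bar> \<le> K"
    and \<theta>: "\<And>t x. t \<in> {0..<T} \<Longrightarrow> \<bar>\<theta> t x\<bar> \<le> m" "{-m..m} \<subseteq> U"
  shows "ereal T \<le> lifespan c U f g"
proof -
  let ?N = "\<lambda>t. Linf_norm (u t) + Linf_norm (Dt T u t) + Linf_norm (Dx u t)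
               + Linf_norm (Dt T (Dt T u) t) + Linf_norm (Dx (Dt T u) t)
               + Linf_norm (Dx (Dx u) t)"
  interpret wave_system c T v \<theta> vx \<theta>x by (rule sys)
  note u = C1_stripI[of T u u v \<theta>, OF refl ut ux cu cont_v cont_\<theta>]
  note ut = C1_stripI[of T "Dt T u" v "\<lambda>t x. (c (\<theta> t x))\<^sup>2 * \<theta>x t x" vx, OF u(2) v_t v_x cont_v vt cont_vx]
  note ux = C1_stripI[of T "Dx u" \<theta> vx \<theta>x, OF u(3) \<theta>_t \<theta>_x cont_\<theta> cont_vx cont_\<theta>x]
  have "classical_solution c f g T u"
    unfolding classical_solution_def C2_strip_def
    using u ut ux init T by simp
  moreover have "(SUP t\<in>{0..<T}. ?N t) < \<infinity>"
  proof -
    have sec: "continuous_on UNIV (w t)" if "cont2_on {0..<T} w" "t \<in> {0..<T}"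
      for w :: "real \<Rightarrow> real \<Rightarrow> real" and t
      by (rule continuous_on_compose_pair[OF that(1), where g="\<lambda>_. t" and h="\<lambda>x. x"])
        (use that in \<open>auto intro!: continuous_intros\<close>)
    have "?N t \<le> ereal K + ereal K + ereal m + ereal K + ereal K + ereal K"
      if t: "t \<in> {0..<T}" for t
    proof -
      have e: "Dt T u t = v t" "Dx u t = \<theta> t" "Dt T (Dt T u) t = (\<lambda>x. (c (\<theta> t x))\<^sup>2 * \<theta>x t x)"
        "Dx (Dt T u) t = vx t" "Dx (Dx u) t = \<theta>x t"
        using u ut ux t by (auto simp: fun_eq_iff)
      show ?thesis unfolding e
        by (intro add_mono Linf_norm_le sec[OF cu t] sec[OF cont_v t] sec[OF cont_\<theta> t] sec[OF vt t]
            sec[OF cont_vx t] sec[OF cont_\<theta>x t] bd[OF t] \<theta>(1)[OF t])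
    qed
    then have "(SUP t\<in>{0..<T}. ?N t) \<le> ereal K + ereal K + ereal m + ereal K + ereal K + ereal K"
      by (rule SUP_least)
    then show ?thesis by (rule order.strict_trans1) simp
  qed
  moreover have "closure ((\<lambda>(t, x). Dx u t x) ` ({0..<T} \<times> UNIV)) \<subseteq> U"
  proof -
    have "(\<lambda>(t, x). Dx u t x) ` ({0..<T} \<times> UNIV) \<subseteq> {-m..m}"
      using u(3) \<theta>(1) by (auto simp: abs_le_iff minus_le_iff)
    then have "closure ((\<lambda>(t, x). Dx u t x) ` ({0..<T} \<times> UNIV)) \<subseteq> {-m..m}"
      by (rule closure_minimal) simp
    with \<theta>(2) show ?thesis by blast
  qed
  ultimately show ?thesis
    unfolding lifespan_def using T by (intro Sup_upper) blast
qed

text \<open>The point to prove is that the two mixed derivatives agree, since the strip conditions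
  treat them as separate functions. Differentiating \<open>u\<close> in \<open>x\<close>, written as
  its initial value plus the time integral of \<open>u_t\<close>, shows that \<open>u_x\<close> is a
  time primitive of \<open>u_tx\<close>; this also covers the one-sided derivative at time
  0.\<close>

lemma classical_solution_wave_system:
  assumes sol: "classical_solution c f g T u"
  shows "wave_system c T (Dt T u) (Dx u) (Dx (Dt T u)) (Dx (Dx u))"
proof -
  have C1: "C1_strip T u" "C1_strip T (Dt T u)" "C1_strip T (Dx u)"
    and eq: "\<And>t x. t \<in> {0..<T} \<Longrightarrow> Dt T (Dt T u) t x = (c (Dx u t x))\<^sup>2 * Dx (Dx u) t x"
    using sol by (auto simp: classical_solution_def C2_strip_def)
  have dt: "((\<lambda>\<tau>. w \<tau> x) has_real_derivative Dt T w t x) (at t within {0..<T})"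
    if "C1_strip T w" "t \<in> {0..<T}" for w t x
    using that vector_derivative_works[of "\<lambda>\<tau>. w \<tau> x" "at t within {0..<T}"]
    by (auto simp: C1_strip_def Dt_def has_real_derivative_iff_has_vector_derivative)
  have dx: "(w t has_real_derivative Dx w t x) (at x)" if "C1_strip T w" "t \<in> {0..<T}" for w t x
    using that DERIV_deriv_iff_real_differentiable by (auto simp: C1_strip_def Dx_def)
  have mixed: "Dt T (Dx u) t x = Dx (Dt T u) t x" if t: "t \<in> {0..<T}" for t x
  proof -
    have sec: "continuous_on {0..<T} (\<lambda>t. w t x)"
      if "cont2_on {0..<T} w" for w :: "real \<Rightarrow> real \<Rightarrow> real" and x
      by (rule continuous_on_compose_pair[OF that, where g="\<lambda>t. t" and h="\<lambda>_. x"])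
        (auto intro!: continuous_intros)
    have cs: "continuous_on (UNIV \<times> {0..<T}) (\<lambda>(x, t). w t x)"
      if "cont2_on {0..<T} w" for w :: "real \<Rightarrow> real \<Rightarrow> real"
      unfolding case_prod_unfold by (rule continuous_on_compose_pair[OF that]) (auto intro!: continuous_intros)
    have cvx: "cont2_on {0..<T} (Dx (Dt T u))"
      and cv: "cont2_on {0..<T} (Dt T u)"
      using C1 by (auto simp: C1_strip_def)
    have I: "prim (\<lambda>\<tau>. Dx (Dt T u) \<tau> x) t = Dx u t x - Dx u 0 x" if t: "t \<in> {0..<T}" for t
    proof -
      have e: "u t y = u 0 y + prim (\<lambda>\<tau>. Dt T u \<tau> y) t" for y
        using prim_eq_diff[of "{0..<T}" t "\<lambda>t. u t y" "\<lambda>\<tau>. Dt T u \<tau> y"] t dt[OF C1(1)] by simp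
      have "((\<lambda>y. prim (\<lambda>\<tau>. Dt T u \<tau> y) t) has_real_derivative prim (\<lambda>\<tau>. Dx (Dt T u) \<tau> x) t) (at x)"
        by (rule DERIV_prim_param[where A=UNIV and S="{0..<T}"])
          (use t dx[OF C1(2)] sec[OF cv] cs[OF cvx] in auto)
      then have "((\<lambda>y. u 0 y + prim (\<lambda>\<tau>. Dt T u \<tau> y) t) has_real_derivative
          Dx u 0 x + prim (\<lambda>\<tau>. Dx (Dt T u) \<tau> x) t) (at x)"
        using dx[OF C1(1), of 0 x] t by (auto intro!: derivative_intros)
      then have "(u t has_real_derivative Dx u 0 x + prim (\<lambda>\<tau>. Dx (Dt T u) \<tau> x) t) (at x)"
        unfolding e[abs_def, symmetric] by simp
      with dx[OF C1(1) t, of x] show ?thesis using DERIV_unique by fastforce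
    qed
    have "((\<lambda>\<tau>. Dx u 0 x + prim (\<lambda>\<tau>. Dx (Dt T u) \<tau> x) \<tau>) has_real_derivative Dx (Dt T u) t x)
        (at t within {0..<T})"
      using DERIV_prim_Ico[OF sec[OF cvx] t] by (auto intro!: derivative_eq_intros)
    then have "((\<lambda>\<tau>. Dx u \<tau> x) has_real_derivative Dx (Dt T u) t x) (at t within {0..<T})"
      by (rule has_field_derivative_transform_within[where d=1]) (use I t in auto)
    then show ?thesis by (rule Dt_eqI[OF t])
  qed
  show ?thesis
  proof
    show "((\<lambda>\<tau>. Dt T u \<tau> x) has_real_derivative (c (Dx u t x))\<^sup>2 * Dx (Dx u) t x) (at t within {0..<T})"
      if "t \<in> {0..<T}" for t x using dt[OF C1(2) that] eq[OF that] by simp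
    show "((\<lambda>\<tau>. Dx u \<tau> x) has_real_derivative Dx (Dt T u) t x) (at t within {0..<T})"
      if "t \<in> {0..<T}" for t x using dt[OF C1(3) that] mixed[OF that] by simp
  qed (use C1 dx in \<open>auto simp: C1_strip_def\<close>)
qed

section \<open>Long-time existence\<close>

text \<open>Freezing the speed outside the interval where it is close to \<open>1\<close> makes \<open>F\<close> and its
  inverse global.\<close>

lemma speed_primitive:
  fixes c :: "real \<Rightarrow> real"
  assumes c: "continuous_on {-\<delta>..\<delta>} c" "\<And>\<theta>. \<bar>\<theta>\<bar> \<le> \<delta> \<Longrightarrow> \<bar>c \<theta> - 1\<bar> \<le> 1/2" and \<delta>: "\<delta> > 0"
  obtains cc F G where "continuous_on UNIV cc" "\<And>\<theta>. \<bar>\<theta>\<bar> \<le> \<delta> \<Longrightarrow> cc \<theta> = c \<theta>" "\<And>\<theta>. \<bar>cc \<theta> - 1\<bar> \<le> 1/2"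
    "\<And>\<theta>. (F has_real_derivative cc \<theta>) (at \<theta>)" "\<And>w. (G has_real_derivative 1 / cc (G w)) (at w)"
    "\<And>w. F (G w) = w" "\<And>\<theta>. G (F \<theta>) = \<theta>" "\<And>w. \<bar>G w\<bar> \<le> 2 * \<bar>w\<bar>" "\<And>\<theta>. \<bar>F \<theta>\<bar> \<le> 2 * \<bar>\<theta>\<bar>"
proof -
  define cc where "cc = (\<lambda>\<theta>. c (max (-\<delta>) (min \<delta> \<theta>)))"
  have ccc: "continuous_on UNIV cc"
    unfolding cc_def by (rule continuous_on_compose2[OF c(1)]) (use \<delta> in \<open>auto intro!: continuous_intros\<close>)
  have cc: "cc \<theta> = c \<theta>" if "\<bar>\<theta>\<bar> \<le> \<delta>" for \<theta>
  proof -
    have "max (-\<delta>) (min \<delta> \<theta>) = \<theta>" using that by linarith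
    then show ?thesis by (simp add: cc_def)
  qed
  have cc1: "\<bar>cc \<theta> - 1\<bar> \<le> 1/2" for \<theta> unfolding cc_def by (rule c(2)) (use \<delta> in \<open>auto simp: abs_le_iff\<close>)
  define F where "F = prim cc"
  have F: "(F has_real_derivative cc \<theta>) (at \<theta>)" for \<theta> unfolding F_def by (rule DERIV_prim[OF ccc])
  have F0: "F 0 = 0" by (simp add: F_def)
  \<comment> \<open>\<open>F\<close> differs from the identity by a function of slope
    \<open>cc - 1\<close>, at most 1/2 in absolute value, so it is invertible on the whole
    line.\<close>
  have E: "norm ((F z - z) - (F w - w)) \<le> norm (z - w) / 2" for z w
  proof -
    have "\<bar>(F z - z) - (F w - w)\<bar> \<le> 1/2 * \<bar>z - w\<bar>"
      by (rule DERIV_bound[of "\<lambda>z. F z - z", OF DERIV_diff[OF F DERIV_ident] cc1])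
    then show ?thesis by simp
  qed
  obtain G where G: "\<And>w. F (G w) = w" "\<And>z. G (F z) = z" and cG: "continuous_on UNIV G"
    using near_identity_inverse[of "\<lambda>z. F z - z"] E by auto
  have nz: "cc \<theta> \<noteq> 0" for \<theta> using cc1[of \<theta>] by auto
  have dG: "(G has_real_derivative 1 / cc (G w)) (at w)" for w
    using DERIV_inverse_function[OF F nz, where g=G and x=w and a="w-1" and b="w+1"] G cG
    by (auto simp: divide_inverse continuous_on_eq_continuous_at)
  have bF: "\<bar>(F \<theta> - \<theta>)\<bar> \<le> \<bar>\<theta>\<bar> / 2" for \<theta> using E[of \<theta> 0] F0 by simp
  have "\<bar>F \<theta>\<bar> \<le> 2 * \<bar>\<theta>\<bar>" for \<theta> using bF[of \<theta>] by linarith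
  moreover have "\<bar>G w\<bar> \<le> 2 * \<bar>w\<bar>" for w using bF[of "G w"] unfolding G by linarith
  ultimately show ?thesis using that[of cc F G] ccc cc cc1 F dG G by blast
qed

lemma abs_half_le:
  fixes a b m :: real
  assumes "\<bar>a\<bar> \<le> m" "\<bar>b\<bar> \<le> m"
  shows "\<bar>(a + b) / 2\<bar> \<le> m" "\<bar>(a - b) / 2\<bar> \<le> m"
proof -
  have "\<bar>a + b\<bar> \<le> 2 * m" "\<bar>a - b\<bar> \<le> 2 * m" using assms by linarith+
  then show "\<bar>(a + b) / 2\<bar> \<le> m" "\<bar>(a - b) / 2\<bar> \<le> m" by simp_all
qed

text \<open>As \<open>F\<close> and its inverse at most double absolute values, the invariants are
  at most \<open>3 * \<mu>\<close> and \<open>u_x\<close> is at most \<open>6 * \<mu>\<close>, where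
  \<open>\<bar>c'\<bar> \<le> \<omega>\<close>. The speed then deviates from 1 by at most
  \<open>6 * \<mu> * \<omega>\<close>, and its derivatives in characteristic coordinates are at most
  \<open>3 * \<mu> * \<omega>\<close>. Inserted in the smallness condition of
  \<open>characteristic_coordinates\<close>, this gives the factor
  \<open>6 * L + 192\<close>.\<close>

lemma wave_lifespan_ge:
  fixes c c' f f1 f2 g g1 :: "real \<Rightarrow> real"
  assumes U: "{-\<delta>..\<delta>} \<subseteq> U"
    and c: "\<And>\<theta>. \<bar>\<theta>\<bar> \<le> \<delta> \<Longrightarrow> (c has_real_derivative c' \<theta>) (at \<theta>)" "continuous_on {-\<delta>..\<delta>} c'"
      "\<And>\<theta>. \<bar>\<theta>\<bar> \<le> \<delta> \<Longrightarrow> \<bar>c \<theta> - 1\<bar> \<le> 1/2" "c 0 = 1"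
    and f: "\<And>x. (f has_real_derivative f1 x) (at x)" "\<And>x. (f1 has_real_derivative f2 x) (at x)"
      "continuous_on UNIV f2" "\<And>x. \<bar>f x\<bar> \<le> \<mu>" "\<And>x. \<bar>f1 x\<bar> \<le> \<mu>" "\<And>x. \<bar>f2 x\<bar> \<le> \<mu>"
    and g: "\<And>x. (g has_real_derivative g1 x) (at x)" "continuous_on UNIV g1"
      "\<And>x. \<bar>g x\<bar> \<le> \<mu>" "\<And>x. \<bar>g1 x\<bar> \<le> \<mu>"
    and \<mu>: "6 * \<mu> < \<delta>" and \<omega>: "\<And>\<theta>. \<bar>\<theta>\<bar> \<le> 6 * \<mu> \<Longrightarrow> \<bar>c' \<theta>\<bar> \<le> \<omega>"
    and L: "L > 0" and small: "(6 * L + 192) * (\<mu> * \<omega>) \<le> 1/100"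
  shows "ereal (L / 4) \<le> lifespan c U f g"
proof -
  have \<mu>0: "\<mu> \<ge> 0" using f(4)[of 0] by linarith
  then have \<delta>: "\<delta> > 0" using \<mu> by linarith
  have \<omega>0: "\<omega> \<ge> 0" using \<omega>[of 0] \<mu>0 by fastforce
  have cc0: "continuous_on {-\<delta>..\<delta>} c"
    by (intro continuous_at_imp_continuous_on ballI DERIV_isCont[OF c(1)]) (auto simp: abs_le_iff)
  obtain C F G where C: "continuous_on UNIV C" "\<And>\<theta>. \<bar>\<theta>\<bar> \<le> \<delta> \<Longrightarrow> C \<theta> = c \<theta>" "\<And>\<theta>. \<bar>C \<theta> - 1\<bar> \<le> 1/2"
    and F: "\<And>\<theta>. (F has_real_derivative C \<theta>) (at \<theta>)" and G: "\<And>w. (G has_real_derivative 1 / C (G w)) (at w)"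
    and FG: "\<And>w. F (G w) = w" "\<And>\<theta>. G (F \<theta>) = \<theta>" and Gb: "\<And>w. \<bar>G w\<bar> \<le> 2 * \<bar>w\<bar>"
    and Fb: "\<And>\<theta>. \<bar>F \<theta>\<bar> \<le> 2 * \<bar>\<theta>\<bar>"
    using speed_primitive[OF cc0 c(3) \<delta>] by blast
  have Cpos: "C \<theta> \<ge> 1/2" "C \<theta> \<le> 3/2" "C \<theta> > 0" "C \<theta> \<noteq> 0" for \<theta>
    using C(3)[of \<theta>] by linarith+
  have dC: "(C has_real_derivative c' \<theta>) (at \<theta>)" if "\<bar>\<theta>\<bar> < \<delta>" for \<theta>
    by (rule has_field_derivative_transform_within_open[OF c(1), where S="{-\<delta><..<\<delta>}"])
      (use that C(2) in auto)

  \<comment> \<open>Invariants and speed as functions of the characteristic coordinates\<close>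
  define R S where "R = (\<lambda>x. g x + F (f1 x))" and "S = (\<lambda>x. g x - F (f1 x))"
  define R' S' where "R' = (\<lambda>x. g1 x + C (f1 x) * f2 x)" and "S' = (\<lambda>x. g1 x - C (f1 x) * f2 x)"
  have dR: "(R has_real_derivative R' x) (at x)" and dS: "(S has_real_derivative S' x) (at x)" for x
    unfolding R_def S_def R'_def S'_def by (auto intro!: derivative_eq_intros DERIV_chain2[OF F] f g)
  have cf1: "continuous_on UNIV f1" by (rule DERIV_continuous_on[OF f(2)])
  have cR': "continuous_on UNIV R'" and cS': "continuous_on UNIV S'"
    unfolding R'_def S'_def
    by (intro continuous_intros g f continuous_on_compose2[OF C(1) cf1]; simp)+
  have cR: "continuous_on UNIV R" and cS: "continuous_on UNIV S"
    by (rule DERIV_continuous_on[OF dR] DERIV_continuous_on[OF dS])+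
  have F1: "\<bar>F (f1 x)\<bar> \<le> 2 * \<mu>" for x using Fb[of "f1 x"] f(5)[of x] by linarith
  have Rb: "\<bar>R x\<bar> \<le> 3 * \<mu>" "\<bar>S x\<bar> \<le> 3 * \<mu>" for x
    unfolding R_def S_def using F1[of x] g(3)[of x] by linarith+
  have R'b: "\<bar>R' x\<bar> \<le> 3 * \<mu>" "\<bar>S' x\<bar> \<le> 3 * \<mu>" for x
  proof -
    have "\<bar>C (f1 x) * f2 x\<bar> \<le> 2 * \<mu>"
      unfolding abs_mult using Cpos[of "f1 x"] f(6) \<mu>0 by (intro mult_mono) auto
    then show "\<bar>R' x\<bar> \<le> 3 * \<mu>" "\<bar>S' x\<bar> \<le> 3 * \<mu>"
      unfolding R'_def S'_def using g(4)[of x] by linarith+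
  qed
  \<comment> \<open>Where the characteristics with feet \<open>x\<close> and \<open>y\<close> meet,
    \<open>F(u_x)\<close> is half the difference of their invariants. Hence \<open>G (W x y)\<close>
    is \<open>u_x\<close> and \<open>k0\<close> the speed at that point, known before the solution
    is.\<close>
  define W where "W = (\<lambda>x y. (R x - S y) / 2)"
  have Wb: "\<bar>W x y\<bar> \<le> 3 * \<mu>" for x y unfolding W_def by (intro abs_half_le Rb)
  have GWb: "\<bar>G (W x y)\<bar> \<le> 6 * \<mu>" for x y using Gb[of "W x y"] Wb[of x y] by linarith
  have GWd: "\<bar>G (W x y)\<bar> < \<delta>" for x y using GWb[of x y] \<mu> by linarith
  define k0 where "k0 = (\<lambda>x y. C (G (W x y)))"
  define k0x where "k0x = (\<lambda>x y. c' (G (W x y)) * (1 / C (G (W x y)) * (R' x / 2)))"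
  define k0y where "k0y = (\<lambda>x y. c' (G (W x y)) * (1 / C (G (W x y)) * (- S' y / 2)))"
  have cG: "continuous_on UNIV G" by (rule DERIV_continuous_on[OF G])
  have cW: "continuous_on UNIV (\<lambda>z. W (fst z) (snd z))"
    unfolding W_def by (intro continuous_intros continuous_on_compose2[OF cR] continuous_on_compose2[OF cS]) auto
  have cGW: "continuous_on UNIV (\<lambda>z. G (W (fst z) (snd z)))"
    by (rule continuous_on_compose2[OF cG cW]) simp
  have cCGW: "continuous_on UNIV (\<lambda>z. C (G (W (fst z) (snd z))))"
    by (rule continuous_on_compose2[OF C(1) cGW]) simp
  have cc'GW: "continuous_on UNIV (\<lambda>z. c' (G (W (fst z) (snd z))))"
    by (rule continuous_on_compose2[OF c(2) cGW]) (use GWd in \<open>auto simp: abs_less_iff less_imp_le minus_less_iff\<close>)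
  have c0: "cont2 k0" "cont2 k0x" "cont2 k0y"
    unfolding k0_def k0x_def k0y_def case_prod_unfold
    by (intro continuous_intros cCGW cc'GW continuous_on_compose2[OF cR'] continuous_on_compose2[OF cS'];
        simp add: Cpos)+
  have dCG: "((\<lambda>w. C (G w)) has_real_derivative c' (G w) * (1 / C (G w))) (at w)" if "\<bar>G w\<bar> < \<delta>" for w
    by (rule DERIV_chain2[where f=C and g=G, OF dC[OF that] G])
  have dW: "((\<lambda>x. W x y) has_real_derivative R' x / 2) (at x)" "(W x has_real_derivative - S' y / 2) (at y)" for x y
    unfolding W_def by (auto intro!: derivative_eq_intros dR dS)
  have d0: "((\<lambda>x. k0 x y) has_real_derivative k0x x y) (at x)" "(k0 x has_real_derivative k0y x y) (at y)" for x y
    using DERIV_chain2[where f="\<lambda>w. C (G w)" and g="\<lambda>x. W x y", OF dCG[OF GWd[of x y]] dW(1)]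
      DERIV_chain2[where f="\<lambda>w. C (G w)" and g="W x", OF dCG[OF GWd[of x y]] dW(2)]
    unfolding k0_def k0x_def k0y_def by (simp_all add: mult.assoc)
  have b0: "\<bar>k0 x y - 1\<bar> \<le> 6 * \<mu> * \<omega>" for x y
  proof -
    have "\<bar>c (G (W x y)) - c 0\<bar> \<le> \<omega> * \<bar>G (W x y) - 0\<bar>"
    proof -
      have "norm (c (G (W x y)) - c 0) \<le> \<omega> * norm (G (W x y) - 0)"
      proof (rule field_differentiable_bound[where S="{-6*\<mu>..6*\<mu>}" and f'=c'])
        show "(c has_real_derivative c' z) (at z within {-6*\<mu>..6*\<mu>})" if "z \<in> {-6*\<mu>..6*\<mu>}" for z
          using c(1)[of z] that \<mu> by (auto simp: abs_le_iff intro: has_field_derivative_at_within)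
      qed (use \<omega> GWb[of x y] \<mu>0 in \<open>auto simp: abs_le_iff\<close>)
      then show ?thesis by simp
    qed
    also have "\<omega> * \<bar>G (W x y) - 0\<bar> \<le> \<omega> * (6 * \<mu>)" using GWb[of x y] by (intro mult_left_mono \<omega>0) simp
    finally show ?thesis using C(2)[of "G (W x y)"] GWd[of x y] c(4) by (simp add: k0_def mult_ac)
  qed
  have b1: "\<bar>k0x x y\<bar> \<le> 3 * \<mu> * \<omega>" "\<bar>k0y x y\<bar> \<le> 3 * \<mu> * \<omega>" for x y
  proof -
    have 1: "\<bar>1 / C (G (W x y))\<bar> \<le> 2" using Cpos[of "G (W x y)"] by (simp add: field_simps abs_if)
    have 2: "\<bar>k0x x y\<bar> \<le> \<omega> * (2 * (3 * \<mu> / 2))"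
      unfolding k0x_def abs_mult by (intro mult_mono \<omega> GWb 1 \<omega>0) (use R'b(1)[of x] in auto)
    have 3: "\<bar>k0y x y\<bar> \<le> \<omega> * (2 * (3 * \<mu> / 2))"
      unfolding k0y_def abs_mult by (intro mult_mono \<omega> GWb 1 \<omega>0) (use R'b(2)[of y] in auto)
    show "\<bar>k0x x y\<bar> \<le> 3 * \<mu> * \<omega>" "\<bar>k0y x y\<bar> \<le> 3 * \<mu> * \<omega>" using 2 3 by (simp_all add: mult_ac)
  qed
  have small': "2 * L * (3 * \<mu> * \<omega>) + 32 * (6 * \<mu> * \<omega>) \<le> 1/100"
    using small by (simp add: algebra_simps)
  obtain A B \<kappa> a b :: "real \<Rightarrow> real \<Rightarrow> real" where AB0: "\<And>x. A 0 x = x" "\<And>x. B 0 x = x"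
    and dA: "\<And>t x. ((\<lambda>t. A t x) has_real_derivative \<kappa> t x * a t x) (at t)"
    "\<And>t x. (A t has_real_derivative a t x) (at x)"
    and dB: "\<And>t x. ((\<lambda>t. B t x) has_real_derivative - \<kappa> t x * b t x) (at t)"
    "\<And>t x. (B t has_real_derivative b t x) (at x)"
    and cAB: "cont2 A" "cont2 B"
    "cont2 \<kappa>"
    "cont2 a" "cont2 b"
    and ab: "\<And>t x. \<bar>a t x\<bar> \<le> 2" "\<And>t x. \<bar>b t x\<bar> \<le> 2"
    and \<kappa>: "\<And>t x. \<bar>t\<bar> < L / 4 \<Longrightarrow> \<kappa> t x = k0 (A t x) (B t x)"
    by (rule characteristic_coordinates[OF d0 c0 b0 b1 L small']) blast

  \<comment> \<open>The solution in physical coordinates\<close>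
  define T where "T = L / 4"
  have T0: "T > 0" using L by (simp add: T_def)
  define v where "v = (\<lambda>t x. (R (A t x) + S (B t x)) / 2)"
  define \<theta> where "\<theta> = (\<lambda>t x. G (W (A t x) (B t x)))"
  define vx where "vx = (\<lambda>t x. (R' (A t x) * a t x + S' (B t x) * b t x) / 2)"
  \<comment> \<open>This is the \<open>x\<close>-derivative of \<open>F(u_x)\<close>, that is,
    \<open>c(u_x) * u_xx\<close>.\<close>
  define dd where "dd = (\<lambda>t x. (R' (A t x) * a t x - S' (B t x) * b t x) / 2)"
  define \<theta>x where "\<theta>x = (\<lambda>t x. dd t x / C (\<theta> t x))"
  \<comment> \<open>Before time \<open>T\<close> the cut-off speed agrees with
    \<open>c(u_x)\<close>; this turns the transport equations for \<open>A\<close> and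
    \<open>B\<close> into the wave system.\<close>
  have \<kappa>C: "\<kappa> t x = C (\<theta> t x)" "c (\<theta> t x) = C (\<theta> t x)" if "\<bar>t\<bar> < T" for t x
    using \<kappa>[of t x] that C(2)[of "\<theta> t x"] GWd by (auto simp: T_def k0_def \<theta>_def less_imp_le)
  have d_v_x: "(v t has_real_derivative vx t x) (at x)" for t x
    unfolding v_def vx_def
    by (auto intro!: derivative_eq_intros DERIV_chain2[OF dR dA(2)] DERIV_chain2[OF dS dB(2)])
  have d_v_t: "((\<lambda>t. v t x) has_real_derivative \<kappa> t x * dd t x) (at t)" for t x
    unfolding v_def dd_def
    by (auto intro!: derivative_eq_intros DERIV_chain2[OF dR dA(1)] DERIV_chain2[OF dS dB(1)] simp: field_simps)
  have d_\<theta>_x: "(\<theta> t has_real_derivative \<theta>x t x) (at x)" for t x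
    unfolding \<theta>_def \<theta>x_def W_def dd_def
    by (rule DERIV_chain2[OF G, THEN DERIV_cong])
      (auto intro!: derivative_eq_intros DERIV_chain2[OF dR dA(2)] DERIV_chain2[OF dS dB(2)] simp: field_simps Cpos(4))
  have d_\<theta>_t: "((\<lambda>t. \<theta> t x) has_real_derivative \<kappa> t x * vx t x / C (\<theta> t x)) (at t)" for t x
    unfolding \<theta>_def vx_def W_def
    by (rule DERIV_chain2[OF G, THEN DERIV_cong])
      (auto intro!: derivative_eq_intros DERIV_chain2[OF dR dA(1)] DERIV_chain2[OF dS dB(1)] simp: field_simps Cpos(4))
  have d_\<theta>_t': "((\<lambda>t. \<theta> t x) has_real_derivative vx t x) (at t)" if "\<bar>t\<bar> < T" for t x
  proof -
    have "\<kappa> t x * vx t x / C (\<theta> t x) = vx t x"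
      unfolding \<kappa>C(1)[OF that] using Cpos(4)[of "\<theta> t x"] by simp
    then show ?thesis using d_\<theta>_t[where t=t and x=x] by (rule subst)
  qed
  note cAB' = cAB[unfolded case_prod_unfold]
  have c1: "continuous_on UNIV (\<lambda>z. R (A (fst z) (snd z)))" "continuous_on UNIV (\<lambda>z. R' (A (fst z) (snd z)))"
    "continuous_on UNIV (\<lambda>z. S (B (fst z) (snd z)))" "continuous_on UNIV (\<lambda>z. S' (B (fst z) (snd z)))"
    by (rule continuous_on_compose2[OF cR cAB'(1)] continuous_on_compose2[OF cR' cAB'(1)]
      continuous_on_compose2[OF cS cAB'(2)] continuous_on_compose2[OF cS' cAB'(2)]; simp)+
  have c\<theta>: "continuous_on UNIV (\<lambda>z. \<theta> (fst z) (snd z))"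
    unfolding \<theta>_def W_def by (rule continuous_on_compose2[OF cG _ subset_UNIV]) (intro continuous_intros c1; simp)+
  have cC\<theta>: "continuous_on UNIV (\<lambda>z. C (\<theta> (fst z) (snd z)))"
    by (rule continuous_on_compose2[OF C(1) c\<theta>]) simp
  have cv: "continuous_on UNIV (\<lambda>z. v (fst z) (snd z))"
    unfolding v_def by (intro continuous_intros c1) simp
  have cvx: "continuous_on UNIV (\<lambda>z. vx (fst z) (snd z))"
    unfolding vx_def by (intro continuous_intros c1 cAB') simp
  have cdd: "continuous_on UNIV (\<lambda>z. dd (fst z) (snd z))"
    unfolding dd_def by (intro continuous_intros c1 cAB') simp
  have c\<theta>x: "continuous_on UNIV (\<lambda>z. \<theta>x (fst z) (snd z))"
    unfolding \<theta>x_def by (intro continuous_intros cdd cC\<theta>) (simp add: Cpos)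
  have cc\<theta>: "continuous_on UNIV (\<lambda>z. c (\<theta> (fst z) (snd z)))"
    by (rule continuous_on_compose2[OF cc0 c\<theta>]) (use GWd in \<open>auto simp: \<theta>_def abs_less_iff less_imp_le minus_less_iff\<close>)
  \<comment> \<open>Built to satisfy \<open>u_t = v\<close>; then \<open>u_x = \<theta>\<close>
    follows from \<open>v_x = \<theta>_t\<close> and the initial value \<open>f1\<close> of
    \<open>\<theta>\<close>.\<close>
  define u where "u = (\<lambda>t x. f x + prim (\<lambda>\<tau>. v \<tau> x) t)"
  have cvs: "continuous_on UNIV (\<lambda>\<tau>. v \<tau> x)" for x
    by (rule continuous_on_compose2[OF cv, of _ "\<lambda>\<tau>. (\<tau>, x)", simplified]) (auto intro!: continuous_intros)
  have d_u_t: "((\<lambda>t. u t x) has_real_derivative v t x) (at t)" for t x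
    unfolding u_def by (auto intro!: derivative_eq_intros DERIV_prim[OF cvs])
  have d_u_x: "(u t has_real_derivative \<theta> t x) (at x)" if t: "\<bar>t\<bar> < T" for t x
  proof -
    have c2: "continuous_on (UNIV \<times> UNIV) (\<lambda>(x, \<tau>). vx \<tau> x)"
      using cont2_compose[of "\<lambda>\<tau> x. vx \<tau> x" UNIV snd fst] cvx
      by (simp add: case_prod_unfold continuous_on_snd continuous_on_fst)
    have "((\<lambda>x. prim (\<lambda>\<tau>. v \<tau> x) t) has_real_derivative prim (\<lambda>\<tau>. vx \<tau> x) t) (at x)"
      by (rule DERIV_prim_param[OF _ _ c2]) (use d_v_x cvs in auto)
    moreover have "prim (\<lambda>\<tau>. vx \<tau> x) t = \<theta> t x - \<theta> 0 x"
    proof (rule prim_eq_diff[where S="{-T<..<T}"])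
      show "((\<lambda>t. \<theta> t x) has_real_derivative vx \<tau> x) (at \<tau> within {-T<..<T})" if "\<tau> \<in> {-T<..<T}" for \<tau>
        using that by (intro has_field_derivative_at_within[OF d_\<theta>_t']) auto
    qed (use t T0 in auto)
    moreover have "\<theta> 0 x = f1 x" by (simp add: \<theta>_def W_def AB0 R_def S_def FG)
    ultimately show ?thesis
      unfolding u_def using f(1)[of x] by (auto intro!: derivative_eq_intros)
  qed
  have cu: "continuous_on UNIV (\<lambda>z. u (fst z) (snd z))"
  proof -
    have "continuous_on (UNIV \<times> UNIV) (\<lambda>(x, t). prim (\<lambda>\<tau>. v \<tau> x) t)"
      by (rule continuous_on_prim)
        (use cont2_compose[of "\<lambda>\<tau> x. v \<tau> x" UNIV snd fst] cv in
          \<open>simp_all add: case_prod_unfold continuous_on_snd continuous_on_fst\<close>)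
    from continuous_on_compose_pair[OF this, of UNIV snd fst]
    have "continuous_on UNIV (\<lambda>z. prim (\<lambda>\<tau>. v \<tau> (snd z)) (fst z))"
      by (simp add: continuous_on_snd continuous_on_fst)
    moreover have "continuous_on UNIV (\<lambda>z. f (snd z))"
      by (rule continuous_on_compose2[OF DERIV_continuous_on[OF f(1)] continuous_on_snd[OF continuous_on_id]]) auto
    ultimately show ?thesis
      unfolding u_def by (intro continuous_on_add)
  qed

  \<comment> \<open>Bounds on the strip\<close>
  have vb: "\<bar>v t x\<bar> \<le> 3 * \<mu>" for t x
    unfolding v_def by (intro abs_half_le Rb)
  have ub: "\<bar>u t x\<bar> \<le> \<mu> + 3 * \<mu> * T" if t: "\<bar>t\<bar> < T" for t x
  proof -
    have "\<bar>u t x - u 0 x\<bar> \<le> 3 * \<mu> * \<bar>t - 0\<bar>"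
      by (rule DERIV_bound[OF d_u_t vb])
    also have "\<dots> \<le> 3 * \<mu> * T" using t \<mu>0 by (intro mult_left_mono) auto
    finally show ?thesis using f(4)[of x] by (simp add: u_def)
  qed
  have prodb: "\<bar>R' x * a t y\<bar> \<le> 6 * \<mu>" "\<bar>S' x * b t y\<bar> \<le> 6 * \<mu>" for x t y
  proof -
    have "\<bar>R' x\<bar> * \<bar>a t y\<bar> \<le> (3 * \<mu>) * 2" "\<bar>S' x\<bar> * \<bar>b t y\<bar> \<le> (3 * \<mu>) * 2"
      using \<mu>0 by (intro mult_mono R'b ab; simp)+
    then show "\<bar>R' x * a t y\<bar> \<le> 6 * \<mu>" "\<bar>S' x * b t y\<bar> \<le> 6 * \<mu>" by (simp_all add: abs_mult)
  qed
  have vxb: "\<bar>vx t x\<bar> \<le> 6 * \<mu>" "\<bar>dd t x\<bar> \<le> 6 * \<mu>" for t x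
    unfolding vx_def dd_def
    by (intro abs_half_le prodb)+
  have \<theta>xb: "\<bar>\<theta>x t x\<bar> \<le> 12 * \<mu>" for t x
  proof -
    have "\<bar>dd t x\<bar> / \<bar>C (\<theta> t x)\<bar> \<le> 6 * \<mu> / (1/2)"
      using vxb(2)[of t x] Cpos[of "\<theta> t x"] \<mu>0 by (intro frac_le) auto
    then show ?thesis by (simp add: \<theta>x_def)
  qed
  have c\<theta>x_eq: "(c (\<theta> t x))\<^sup>2 * \<theta>x t x = \<kappa> t x * dd t x" if "\<bar>t\<bar> < T" for t x
    unfolding \<kappa>C[OF that] using Cpos(4)[of "\<theta> t x"] by (simp add: \<theta>x_def power2_eq_square)
  have vtb: "\<bar>(c (\<theta> t x))\<^sup>2 * \<theta>x t x\<bar> \<le> 12 * \<mu>" if "\<bar>t\<bar> < T" for t x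
  proof -
    have "\<bar>C (\<theta> t x)\<bar> * \<bar>dd t x\<bar> \<le> 2 * (6 * \<mu>)"
      using Cpos[of "\<theta> t x"] by (intro mult_mono vxb) auto
    then show ?thesis unfolding c\<theta>x_eq[OF that] unfolding \<kappa>C(1)[OF that] by (simp add: abs_mult)
  qed
  have sys: "wave_system c T v \<theta> vx \<theta>x"
  proof
    show "((\<lambda>\<tau>. v \<tau> x) has_real_derivative (c (\<theta> t x))\<^sup>2 * \<theta>x t x) (at t within {0..<T})"
      if "t \<in> {0..<T}" for t x
    proof -
      have e: "(c (\<theta> t x))\<^sup>2 * \<theta>x t x = \<kappa> t x * dd t x" using that by (intro c\<theta>x_eq) auto
      show ?thesis unfolding e by (rule has_field_derivative_at_within[OF d_v_t])
    qed
    show "((\<lambda>\<tau>. \<theta> \<tau> x) has_real_derivative vx t x) (at t within {0..<T})" if "t \<in> {0..<T}" for t x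
      using that by (intro has_field_derivative_at_within[OF d_\<theta>_t']) auto
  qed (use d_v_x d_\<theta>_x cv c\<theta> cvx c\<theta>x in \<open>auto simp: case_prod_unfold intro: continuous_on_subset\<close>)
  have KT: "3 * \<mu> * T \<ge> 0" using \<mu>0 T0 by simp
  have "ereal T \<le> lifespan c U f g"
  proof (rule lifespan_geI[OF sys T0, where u=u and K="12 * \<mu> + 3 * \<mu> * T" and m="6 * \<mu>"])
    show "continuous_on ({0..<T} \<times> UNIV) (\<lambda>(t, x). (c (\<theta> t x))\<^sup>2 * \<theta>x t x)"
      unfolding case_prod_unfold
      by (rule continuous_on_subset[OF _ subset_UNIV]) (intro continuous_intros cc\<theta> c\<theta>x)
    show "cont2_on {0..<T} u"
      unfolding case_prod_unfold by (rule continuous_on_subset[OF cu subset_UNIV])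
    show "u 0 x = f x" for x by (simp add: u_def)
    show "v 0 x = g x" for x by (simp add: v_def AB0 R_def S_def)
    show "\<bar>u t x\<bar> \<le> 12 * \<mu> + 3 * \<mu> * T" "\<bar>(c (\<theta> t x))\<^sup>2 * \<theta>x t x\<bar> \<le> 12 * \<mu> + 3 * \<mu> * T"
      "\<bar>v t x\<bar> \<le> 12 * \<mu> + 3 * \<mu> * T" "\<bar>vx t x\<bar> \<le> 12 * \<mu> + 3 * \<mu> * T" "\<bar>\<theta>x t x\<bar> \<le> 12 * \<mu> + 3 * \<mu> * T"
      if "t \<in> {0..<T}" for t x
    proof -
      have t: "\<bar>t\<bar> < T" using that by simp
      show "\<bar>u t x\<bar> \<le> 12 * \<mu> + 3 * \<mu> * T" "\<bar>(c (\<theta> t x))\<^sup>2 * \<theta>x t x\<bar> \<le> 12 * \<mu> + 3 * \<mu> * T"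
        "\<bar>v t x\<bar> \<le> 12 * \<mu> + 3 * \<mu> * T" "\<bar>vx t x\<bar> \<le> 12 * \<mu> + 3 * \<mu> * T" "\<bar>\<theta>x t x\<bar> \<le> 12 * \<mu> + 3 * \<mu> * T"
        using ub[OF t, of x] vtb[OF t, of x] vb[of t x] vxb(1)[of t x] \<theta>xb[of t x] KT \<mu>0 by linarith+
    qed
    show "\<bar>\<theta> t x\<bar> \<le> 6 * \<mu>" for t x unfolding \<theta>_def by (rule GWb)
    show "{- (6 * \<mu>)..6 * \<mu>} \<subseteq> U" using U \<mu> by (force simp: subset_iff)
  qed (use d_u_t d_u_x in \<open>auto intro: has_field_derivative_at_within[OF d_u_t]\<close>)
  then show ?thesis by (simp add: T_def)
qed

section \<open>Riemann invariants along characteristics\<close>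

lemma DERIV_within_mono:
  fixes f :: "real \<Rightarrow> real"
  assumes "a \<le> b" "{a..b} \<subseteq> S"
    and "\<And>t. t \<in> {a..b} \<Longrightarrow> (f has_real_derivative f' t) (at t within S)"
    and "\<And>t. t \<in> {a..b} \<Longrightarrow> f' t \<ge> 0"
  shows "f a \<le> f b"
proof -
  have "\<exists>x\<in>{a..b}. f b - f a = (*) (f' x) (b - a)"
    by (rule mvt_very_simple[OF assms(1)])
      (use assms in \<open>auto simp: has_field_derivative_def[symmetric] intro: DERIV_subset\<close>)
  then obtain x where "x \<in> {a..b}" "f b - f a = f' x * (b - a)" by auto
  moreover have "0 \<le> f' x * (b - a)" using assms(1,4) calculation by (intro mult_nonneg_nonneg) auto
  ultimately show ?thesis by linarith
qed

lemma DERIV_within_bound: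
  fixes f :: "real \<Rightarrow> real"
  assumes "a \<le> b" "{a..b} \<subseteq> S"
    and "\<And>t. t \<in> {a..b} \<Longrightarrow> (f has_real_derivative f' t) (at t within S)"
    and "\<And>t. t \<in> {a..b} \<Longrightarrow> \<bar>f' t\<bar> \<le> M"
  shows "\<bar>f b - f a\<bar> \<le> M * (b - a)"
proof -
  have M: "M - f' t \<ge> 0" "M + f' t \<ge> 0" if "t \<in> {a..b}" for t using assms(4)[OF that] by linarith+
  have "M * a - f a \<le> M * b - f b"
    by (rule DERIV_within_mono[where S=S and f="\<lambda>t. M * t - f t" and f'="\<lambda>t. M - f' t"])
      (use assms M in \<open>auto intro!: derivative_eq_intros\<close>)
  moreover have "M * a + f a \<le> M * b + f b"
    by (rule DERIV_within_mono[where S=S and f="\<lambda>t. M * t + f t" and f'="\<lambda>t. M + f' t"])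
      (use assms M(2) in \<open>auto intro!: derivative_eq_intros simp: algebra_simps\<close>)
  ultimately show ?thesis by (simp add: abs_le_iff algebra_simps)
qed

text \<open>Integration gains a factor \<open>1 / \<nu>\<close> against the exponential weight,
  which is what makes Picard iteration a contraction. The proof compares \<open>prim h\<close> with
  primitives of the weight, on each side of 0.\<close>

lemma prim_exp_bound:
  assumes h: "continuous_on UNIV h" and b: "\<And>s. \<bar>h s\<bar> \<le> d * exp (\<nu> * \<bar>s\<bar>)" and \<nu>: "\<nu> > 0"
  shows "\<bar>prim h t\<bar> \<le> d / \<nu> * (exp (\<nu> * \<bar>t\<bar>) - 1)"
proof -
  have hb: "0 \<le> d * exp (\<nu> * \<bar>s\<bar>) - h s" "0 \<le> d * exp (\<nu> * \<bar>s\<bar>) + h s" for s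
    using b[of s] by linarith+
  have hb1: "0 \<le> d * exp (\<nu> * s) - h s" "0 \<le> d * exp (\<nu> * s) + h s" if "s \<ge> 0" for s
    using hb[of s] that by simp_all
  have hb2: "0 \<le> d * exp (\<nu> * - s) - h s" "0 \<le> d * exp (\<nu> * - s) + h s" if "s \<le> 0" for s
    using hb[of s] that by simp_all
  have G: "((\<lambda>s. d / \<nu> * exp (\<nu> * s)) has_real_derivative d * exp (\<nu> * s)) (at s)"
    "((\<lambda>s. - (d / \<nu> * exp (\<nu> * - s))) has_real_derivative d * exp (\<nu> * - s)) (at s)" for s
    using \<nu> by (auto intro!: derivative_eq_intros)
  note P = DERIV_prim[OF h]
  consider "t \<ge> 0" | "t \<le> 0" by linarith
  then show ?thesis
  proof cases
    case 1
    have "d / \<nu> * exp (\<nu> * 0) - prim h 0 \<le> d / \<nu> * exp (\<nu> * t) - prim h t"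
      by (rule DERIV_within_mono[OF 1 subset_UNIV DERIV_diff[OF G(1) P]]) (rule hb1, simp)
    moreover have "d / \<nu> * exp (\<nu> * 0) + prim h 0 \<le> d / \<nu> * exp (\<nu> * t) + prim h t"
      by (rule DERIV_within_mono[OF 1 subset_UNIV DERIV_add[OF G(1) P]]) (rule hb1, simp)
    ultimately show ?thesis using 1 by (simp add: abs_le_iff algebra_simps)
  next
    case 2
    have "- (d / \<nu> * exp (\<nu> * - t)) - prim h t \<le> - (d / \<nu> * exp (\<nu> * - 0)) - prim h 0"
      by (rule DERIV_within_mono[OF 2 subset_UNIV DERIV_diff[OF G(2) P]]) (rule hb2, simp)
    moreover have "- (d / \<nu> * exp (\<nu> * - t)) + prim h t \<le> - (d / \<nu> * exp (\<nu> * - 0)) + prim h 0"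
      by (rule DERIV_within_mono[OF 2 subset_UNIV DERIV_add[OF G(2) P]]) (rule hb2, simp)
    ultimately show ?thesis using 2 by (simp add: abs_le_iff algebra_simps)
  qed
qed

text \<open>Picard iteration is a contraction for the norm \<open>sup (exp (- \<nu> * \<bar>t\<bar>) * \<bar>X t\<bar>)\<close> when \<open>\<nu>\<close>
  exceeds twice the Lipschitz constant, which yields a global solution in one step.\<close>

lemma ode_solution_exists:
  fixes f :: "real \<Rightarrow> real \<Rightarrow> real"
  assumes cf: "cont2 f"
    and lip: "\<And>t x y. \<bar>f t x - f t y\<bar> \<le> \<Lambda> * \<bar>x - y\<bar>" and bd: "\<And>t x. \<bar>f t x\<bar> \<le> M"
  obtains X where "X t0 = x0" "\<And>t. (X has_real_derivative f t (X t)) (at t)"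
proof -
  have \<Lambda>0: "\<Lambda> \<ge> 0" using lip[of 0 1 0] by simp
  have M0: "M \<ge> 0" using bd[of 0 0] by linarith
  define \<nu> where "\<nu> = 2 * \<Lambda> + 1"
  have \<nu>: "\<nu> > 0" using \<Lambda>0 by (simp add: \<nu>_def)
  define e where "e = (\<lambda>t. exp (\<nu> * \<bar>t\<bar>))"
  \<comment> \<open>The unknown is rescaled: \<open>X (t0 + s) = x0 + e s * y s\<close>. The plain
    sup norm of \<open>y\<close> is then the weighted norm of the displacement from
    \<open>x0\<close>.\<close>
  define h where "h = (\<lambda>(y :: real \<Rightarrow>\<^sub>C real) s. f (t0 + s) (x0 + e s * y s))"
  have ch: "continuous_on UNIV (h y)" for y
    unfolding h_def e_def by (rule cont2_compose[OF cf]) (intro continuous_intros; simp)+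
  define K where "K = (\<lambda>y t. prim (h y) t / e t)"
  have Kb: "K y \<in> bcontfun" for y
  proof -
    have "continuous_on UNIV (prim (h y))" by (rule DERIV_continuous_on[OF DERIV_prim[OF ch]])
    then have "continuous_on UNIV (K y)"
      unfolding K_def e_def by (intro continuous_intros) auto
    moreover have "\<bar>K y t\<bar> \<le> M / \<nu>" for t
    proof -
      have "\<bar>h y s\<bar> \<le> M * exp (\<nu> * \<bar>s\<bar>)" for s
      proof -
        have "M * 1 \<le> M * exp (\<nu> * \<bar>s\<bar>)" using M0 \<nu> by (intro mult_left_mono) auto
        then show ?thesis using bd[of "t0 + s" "x0 + e s * y s"] by (simp add: h_def)
      qed
      from prim_exp_bound[OF ch this \<nu>, of t]
      have "\<bar>prim (h y) t\<bar> \<le> M / \<nu> * e t" using divide_nonneg_pos[OF M0 \<nu>] by (simp add: e_def algebra_simps)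
      then show ?thesis by (simp add: K_def e_def field_simps)
    qed
    ultimately show ?thesis unfolding bcontfun_def by (auto intro!: boundedI[of _ "M / \<nu>"])
  qed
  have "dist (Bcontfun (K y)) (Bcontfun (K z)) \<le> 1/2 * dist y z" for y z
  proof (rule dist_bound)
    fix t
    have e1: "prim (\<lambda>s. h y s - h z s) t = prim (h y) t - prim (h z) t"
      by (rule prim_eq_diff[where S=UNIV and F="\<lambda>t. prim (h y) t - prim (h z) t", simplified])
        (auto intro!: derivative_intros DERIV_prim ch)
    have "\<bar>h y s - h z s\<bar> \<le> (\<Lambda> * dist y z) * exp (\<nu> * \<bar>s\<bar>)" for s
    proof -
      have "\<bar>h y s - h z s\<bar> \<le> \<Lambda> * \<bar>(x0 + e s * y s) - (x0 + e s * z s)\<bar>"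
        unfolding h_def by (rule lip)
      also have "\<dots> = \<Lambda> * (e s * dist (y s) (z s))"
        by (simp add: dist_real_def e_def abs_mult right_diff_distrib[symmetric])
      also have "\<dots> \<le> \<Lambda> * (e s * dist y z)"
        by (intro mult_left_mono dist_bounded \<Lambda>0) (simp add: e_def)
      finally show ?thesis by (simp add: e_def mult_ac)
    qed
    from prim_exp_bound[OF continuous_on_diff[OF ch ch] this \<nu>, of t]
    have "\<bar>prim (h y) t - prim (h z) t\<bar> \<le> (\<Lambda> * dist y z) / \<nu> * (e t - 1)"
      unfolding e1 e_def .
    also have "\<dots> \<le> (1/2 * dist y z) * e t"
    proof (rule mult_mono)
      show "\<Lambda> * dist y z / \<nu> \<le> 1/2 * dist y z"
        using \<Lambda>0 \<nu> by (simp add: \<nu>_def field_simps)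
    qed (auto simp: e_def \<nu> less_imp_le)
    finally have "\<bar>prim (h y) t - prim (h z) t\<bar> / e t \<le> 1/2 * dist y z"
      by (simp add: e_def field_simps)
    moreover have "dist (K y t) (K z t) = \<bar>prim (h y) t - prim (h z) t\<bar> / e t"
      by (simp add: K_def dist_real_def diff_divide_distrib[symmetric] e_def)
    ultimately show "dist (Bcontfun (K y) t) (Bcontfun (K z) t) \<le> 1/2 * dist y z"
      by (simp add: Bcontfun_inverse Kb)
  qed
  then obtain y where "Bcontfun (K y) = y"
    using banach_fix_type[where c="1/2" and f="\<lambda>y. Bcontfun (K y)"] by auto
  then have y: "y t = K y t" for t using Bcontfun_inverse[OF Kb[of y]] by simp
  have ey: "e t * y t = prim (h y) t" for t unfolding y[of t] by (simp add: K_def e_def)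
  show ?thesis
  proof (rule that[of "\<lambda>t. x0 + prim (h y) (t - t0)"])
    show "((\<lambda>t. x0 + prim (h y) (t - t0)) has_real_derivative f t (x0 + prim (h y) (t - t0))) (at t)" for t
    proof -
      have "h y (t - t0) = f t (x0 + prim (h y) (t - t0))"
        unfolding ey[symmetric] by (simp add: h_def)
      then show ?thesis
        by (auto intro!: derivative_eq_intros DERIV_chain2[OF DERIV_prim[OF ch]])
    qed
  qed simp
qed

text \<open>The sign of \<open>d\<close> is not known beforehand, so the argument runs on squares:
  \<open>(d s)\<^sup>2 * exp (2 * \<Lambda> * s)\<close> is nondecreasing and never 0, which gives
  positivity by the intermediate value theorem, and
  \<open>(d s)\<^sup>2 * exp (- 2 * \<Lambda> * s)\<close> is nonincreasing. Applied to neighbouring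
  characteristics: they never meet, and their distance tends to 0 with that of their feet.\<close>

lemma gronwall_two_sided:
  assumes d: "\<And>t. t \<in> {0..T} \<Longrightarrow> (d has_real_derivative d' t) (at t within {0..T})"
    and b: "\<And>t. t \<in> {0..T} \<Longrightarrow> \<bar>d' t\<bar> \<le> \<Lambda> * \<bar>d t\<bar>" and d0: "d 0 > 0" and t: "t \<in> {0..T}"
  shows "0 < d t" "d t \<le> d 0 * exp (\<Lambda> * t)"
proof -
  have b': "0 \<le> \<Lambda> * (d t)\<^sup>2 + d t * d' t" "0 \<le> \<Lambda> * (d t)\<^sup>2 - d t * d' t" if "t \<in> {0..T}" for t
  proof -
    have "\<bar>d t * d' t\<bar> \<le> \<bar>d t\<bar> * (\<Lambda> * \<bar>d t\<bar>)" unfolding abs_mult by (intro mult_left_mono b that) simp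
    then have "\<bar>d t * d' t\<bar> \<le> \<Lambda> * (d t)\<^sup>2" by (simp add: power2_eq_square mult_ac abs_mult[symmetric])
    then show "0 \<le> \<Lambda> * (d t)\<^sup>2 + d t * d' t" "0 \<le> \<Lambda> * (d t)\<^sup>2 - d t * d' t" by linarith+
  qed
  have low: "d s \<noteq> 0" if s: "s \<in> {0..T}" for s
  proof -
    have "(d 0)\<^sup>2 * exp (2 * \<Lambda> * 0) \<le> (d s)\<^sup>2 * exp (2 * \<Lambda> * s)"
    proof (rule DERIV_within_mono[where S="{0..T}" and f="\<lambda>s. (d s)\<^sup>2 * exp (2 * \<Lambda> * s)"
          and f'="\<lambda>s. 2 * (\<Lambda> * (d s)\<^sup>2 + d s * d' s) * exp (2 * \<Lambda> * s)"])
      show "((\<lambda>s. (d s)\<^sup>2 * exp (2 * \<Lambda> * s)) has_real_derivative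
          2 * (\<Lambda> * (d r)\<^sup>2 + d r * d' r) * exp (2 * \<Lambda> * r)) (at r within {0..T})" if "r \<in> {0..s}" for r
        using that s by (auto intro!: derivative_eq_intros d simp: algebra_simps power2_eq_square)
      show "0 \<le> 2 * (\<Lambda> * (d r)\<^sup>2 + d r * d' r) * exp (2 * \<Lambda> * r)" if "r \<in> {0..s}" for r
        using b'(1)[of r] that s by simp
    qed (use s in auto)
    then show ?thesis using d0 by auto
  qed
  have cd: "continuous_on {0..T} d" by (rule DERIV_continuous_on[OF d])
  show pos: "0 < d t"
  proof (rule ccontr)
    assume "\<not> 0 < d t"
    then have "\<exists>x\<ge>0. x \<le> t \<and> d x = 0"
      using t d0 by (intro IVT2') (auto intro: continuous_on_subset[OF cd])
    then show False using low t by auto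
  qed
  have "- ((d 0)\<^sup>2 * exp (- 2 * \<Lambda> * 0)) \<le> - ((d t)\<^sup>2 * exp (- 2 * \<Lambda> * t))"
  proof (rule DERIV_within_mono[where S="{0..T}" and f="\<lambda>s. - ((d s)\<^sup>2 * exp (- 2 * \<Lambda> * s))"
        and f'="\<lambda>s. 2 * (\<Lambda> * (d s)\<^sup>2 - d s * d' s) * exp (- 2 * \<Lambda> * s)"])
    show "((\<lambda>s. - ((d s)\<^sup>2 * exp (- 2 * \<Lambda> * s))) has_real_derivative
          2 * (\<Lambda> * (d r)\<^sup>2 - d r * d' r) * exp (- 2 * \<Lambda> * r)) (at r within {0..T})" if "r \<in> {0..t}" for r
      using that t by (auto intro!: derivative_eq_intros d simp: algebra_simps power2_eq_square)
    show "0 \<le> 2 * (\<Lambda> * (d r)\<^sup>2 - d r * d' r) * exp (- 2 * \<Lambda> * r)" if "r \<in> {0..t}" for r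
      using b'(2)[of r] that t by simp
  qed (use t in auto)
  then have "(d t)\<^sup>2 * exp (- 2 * \<Lambda> * t) \<le> (d 0)\<^sup>2" by simp
  then have "(d t)\<^sup>2 \<le> (d 0)\<^sup>2 * exp (2 * \<Lambda> * t)" by (simp add: exp_minus field_simps)
  also have "\<dots> = (d 0 * exp (\<Lambda> * t))\<^sup>2" by (simp add: power_mult_distrib exp_double[symmetric] mult_ac)
  finally show "d t \<le> d 0 * exp (\<Lambda> * t)" using d0 by (auto intro: power2_le_imp_le)
qed

text \<open>In terms of the Riemann invariants \<open>R\<close>, \<open>S\<close> and of \<open>k = c(u\<^sub>x)\<close> the coefficient \<open>b\<close>
  is \<open>c'(u\<^sub>x) / (2 c(u\<^sub>x))\<close>.\<close>

locale riemann_system =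
  fixes T M :: real and R S Rx Sx k b :: "real \<Rightarrow> real \<Rightarrow> real"
  assumes T: "0 \<le> T"
    and R_x: "\<And>t x. t \<in> {0..T} \<Longrightarrow> (R t has_real_derivative Rx t x) (at x)"
    and S_x: "\<And>t x. t \<in> {0..T} \<Longrightarrow> (S t has_real_derivative Sx t x) (at x)"
    and k_x: "\<And>t x. t \<in> {0..T} \<Longrightarrow> (k t has_real_derivative b t x * (Rx t x - Sx t x)) (at x)"
    and R_t: "\<And>t x. t \<in> {0..T} \<Longrightarrow> ((\<lambda>t. R t x) has_real_derivative k t x * Rx t x) (at t within {0..T})"
    and S_t: "\<And>t x. t \<in> {0..T} \<Longrightarrow> ((\<lambda>t. S t x) has_real_derivative - k t x * Sx t x) (at t within {0..T})"
    and k_t: "\<And>t x. t \<in> {0..T} \<Longrightarrow>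
      ((\<lambda>t. k t x) has_real_derivative k t x * b t x * (Rx t x + Sx t x)) (at t within {0..T})"
    and cont_Rx: "cont2_on {0..T} Rx"
    and cont_Sx: "cont2_on {0..T} Sx"
    and cont_b: "cont2_on {0..T} b"
    and cont_k: "cont2_on {0..T} k"
    and k_pos: "\<And>t x. t \<in> {0..T} \<Longrightarrow> 0 < k t x" and k_le: "\<And>t x. t \<in> {0..T} \<Longrightarrow> k t x \<le> M"
begin

definition kx where "kx t x = b t x * (Rx t x - Sx t x)"

lemma M_pos: "M > 0"
  using k_pos[of 0 0] k_le[of 0 0] T by auto

lemma cont_kx: "cont2_on {0..T} kx"
  using cont_b cont_Rx cont_Sx unfolding kx_def case_prod_unfold by (intro continuous_intros)

lemma kx_bounded:
  obtains \<Lambda> where "\<Lambda> \<ge> 0" "\<And>t x. t \<in> {0..T} \<Longrightarrow> x \<in> {p..q} \<Longrightarrow> \<bar>kx t x\<bar> \<le> \<Lambda>"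
proof -
  have "compact ((\<lambda>(t, x). kx t x) ` ({0..T} \<times> {p..q}))"
    by (intro compact_continuous_image continuous_on_subset[OF cont_kx] compact_Times) auto
  then obtain B where "\<And>z. z \<in> (\<lambda>(t, x). kx t x) ` ({0..T} \<times> {p..q}) \<Longrightarrow> norm z \<le> B"
    using compact_imp_bounded bounded_iff by metis
  then have "\<bar>kx t x\<bar> \<le> max B 0" if "t \<in> {0..T}" "x \<in> {p..q}" for t x
    using that by (fastforce simp: le_max_iff_disj)
  then show ?thesis using that[of "max B 0"] by auto
qed

lemma kx_lipschitz:
  assumes "\<And>x. x \<in> {p..q} \<Longrightarrow> \<bar>kx t x\<bar> \<le> \<Lambda>" "t \<in> {0..T}" "x \<in> {p..q}" "y \<in> {p..q}"
  shows "\<bar>k t x - k t y\<bar> \<le> \<Lambda> * \<bar>x - y\<bar>"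
proof -
  have "norm (k t x - k t y) \<le> \<Lambda> * norm (x - y)"
    by (rule field_differentiable_bound[where S="{p..q}" and f'="kx t"])
      (use assms k_x in \<open>auto simp: kx_def intro: has_field_derivative_at_within\<close>)
  then show ?thesis by simp
qed

text \<open>\<open>\<sigma>\<close> is the direction of travel: -1 for the family that carries
  \<open>R\<close>, 1 for the family that carries \<open>S\<close>.\<close>

definition characteristic where
  "characteristic \<sigma> X \<longleftrightarrow> (\<forall>t\<in>{0..T}. (X has_real_derivative \<sigma> * k t (X t)) (at t within {0..T}))"

text \<open>\<open>k\<close> is Lipschitz in \<open>x\<close> only on bounded sets, so it is first
  frozen outside the window of radius \<open>M * T + 1\<close> around \<open>x0\<close>. As speeds
  are at most \<open>M\<close>, the solution stays in the window during \<open>{0..T}\<close> and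
  solves the original equation there.\<close>

lemma characteristic_exists:
  assumes \<sigma>: "\<bar>\<sigma>\<bar> = 1" and t0: "t0 \<in> {0..T}"
  obtains X where "X t0 = x0" "characteristic \<sigma> X"
proof -
  define \<rho> where "\<rho> = M * T + 1"
  have \<rho>: "\<rho> > 0" using M_pos T by (simp add: \<rho>_def add_nonneg_pos)
  obtain \<Lambda> where \<Lambda>: "\<Lambda> \<ge> 0" "\<And>t x. t \<in> {0..T} \<Longrightarrow> x \<in> {x0-\<rho>..x0+\<rho>} \<Longrightarrow> \<bar>kx t x\<bar> \<le> \<Lambda>"
    using kx_bounded by blast
  define ct where "ct = (\<lambda>t. max 0 (min T t))"
  define cx where "cx = (\<lambda>x. max (x0-\<rho>) (min (x0+\<rho>) x))"
  have ct: "ct t \<in> {0..T}" for t using T by (auto simp: ct_def)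
  have cx: "cx x \<in> {x0-\<rho>..x0+\<rho>}" for x using \<rho> by (auto simp: cx_def)
  have cxl: "\<bar>cx x - cx y\<bar> \<le> \<bar>x - y\<bar>" for x y unfolding cx_def by linarith
  define f where "f = (\<lambda>t x. \<sigma> * k (ct t) (cx x))"
  have cf: "cont2 f"
    unfolding f_def case_prod_unfold
    by (intro continuous_intros continuous_on_compose_pair[OF cont_k])
      (use ct in \<open>auto simp: ct_def cx_def intro!: continuous_intros\<close>)
  have lf: "\<bar>f t x - f t y\<bar> \<le> \<Lambda> * \<bar>x - y\<bar>" for t x y
  proof -
    have "\<bar>f t x - f t y\<bar> = \<bar>k (ct t) (cx x) - k (ct t) (cx y)\<bar>"
      using \<sigma> by (simp add: f_def right_diff_distrib[symmetric] abs_mult)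
    also have "\<dots> \<le> \<Lambda> * \<bar>cx x - cx y\<bar>" by (rule kx_lipschitz[OF \<Lambda>(2)]) (use ct cx in auto)
    also have "\<dots> \<le> \<Lambda> * \<bar>x - y\<bar>" by (intro mult_left_mono cxl \<Lambda>)
    finally show ?thesis .
  qed
  have bf: "\<bar>f t x\<bar> \<le> M" for t x
    using \<sigma> k_pos[OF ct[of t], of "cx x"] k_le[OF ct[of t], of "cx x"] by (simp add: f_def abs_mult)
  obtain X where X: "X t0 = x0" "\<And>t. (X has_real_derivative f t (X t)) (at t)"
    using ode_solution_exists[OF cf lf bf] by blast
  have "\<bar>X t - X t0\<bar> \<le> M * \<bar>t - t0\<bar>" for t by (rule DERIV_bound[OF X(2) bf])
  moreover have "M * \<bar>t - t0\<bar> \<le> M * T" if "t \<in> {0..T}" for t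
    using that t0 M_pos by (intro mult_left_mono) auto
  ultimately have Xb: "\<bar>X t - x0\<bar> \<le> \<rho>" if "t \<in> {0..T}" for t
    using that X(1) unfolding \<rho>_def by (smt (verit))
  have "(X has_real_derivative \<sigma> * k t (X t)) (at t within {0..T})" if "t \<in> {0..T}" for t
  proof -
    have "cx (X t) = X t" using Xb[OF that] unfolding cx_def by linarith
    moreover have "ct t = t" using that by (simp add: ct_def)
    ultimately show ?thesis using has_field_derivative_at_within[OF X(2)[of t]] by (simp add: f_def)
  qed
  then show ?thesis using that X(1) by (auto simp: characteristic_def)
qed

lemma DERIV_along_characteristic:
  assumes "characteristic \<sigma> X" and t: "t \<in> {0..T}"
    and "((\<lambda>s. f s (X t)) has_real_derivative ft) (at t within {0..T})"
    and "\<And>t x. t \<in> {0..T} \<Longrightarrow> (f t has_real_derivative fx t x) (at x)"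
    and "cont2_on {0..T} fx"
  shows "((\<lambda>t. f t (X t)) has_real_derivative ft + fx t (X t) * (\<sigma> * k t (X t))) (at t within {0..T})"
  using DERIV_along_curve[of f X t ft "{0..T}" fx "\<sigma> * k t (X t)"] assms by (auto simp: characteristic_def)

lemma R_constant:
  assumes "characteristic (-1) X" "t \<in> {0..T}"
  shows "R t (X t) = R 0 (X 0)"
proof -
  have "((\<lambda>t. R t (X t)) has_real_derivative 0) (at t within {0..T})" if "t \<in> {0..T}" for t
    using DERIV_along_characteristic[OF assms(1) that R_t[OF that] R_x cont_Rx] by simp
  then have "\<bar>R t (X t) - R 0 (X 0)\<bar> \<le> 0 * (t - 0)"
    using assms(2) by (intro DERIV_within_bound[where S="{0..T}" and f'="\<lambda>_. 0"]) auto
  then show ?thesis by simp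
qed

lemma S_constant:
  assumes "characteristic 1 X" "t \<in> {0..T}"
  shows "S t (X t) = S 0 (X 0)"
proof -
  have "((\<lambda>t. S t (X t)) has_real_derivative 0) (at t within {0..T})" if "t \<in> {0..T}" for t
    using DERIV_along_characteristic[OF assms(1) that S_t[OF that] S_x cont_Sx] by simp
  then have "\<bar>S t (X t) - S 0 (X 0)\<bar> \<le> 0 * (t - 0)"
    using assms(2) by (intro DERIV_within_bound[where S="{0..T}" and f'="\<lambda>_. 0"]) auto
  then show ?thesis by simp
qed

text \<open>The characteristic through \<open>(t, x)\<close> is followed back to time 0. This
  carries bounds on the data over to all times.\<close>

lemma R_range:
  assumes "t \<in> {0..T}" shows "R t x \<in> range (R 0)"
proof -
  obtain X where "X t = x" "characteristic (-1) X" using characteristic_exists[of "-1" t] assms by auto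
  then show ?thesis using R_constant[of X t] assms by auto
qed

lemma S_range:
  assumes "t \<in> {0..T}" shows "S t x \<in> range (S 0)"
proof -
  obtain X where "X t = x" "characteristic 1 X" using characteristic_exists[of 1 t] assms by auto
  then show ?thesis using S_constant[of X t] assms by auto
qed

lemma characteristic_bound:
  assumes "characteristic \<sigma> X" "\<bar>\<sigma>\<bar> = 1" "t \<in> {0..T}"
  shows "\<bar>X t - X 0\<bar> \<le> M * T"
proof -
  have "\<bar>\<sigma> * k s (X s)\<bar> \<le> M" if "s \<in> {0..T}" for s
    using k_pos[OF that, of "X s"] k_le[OF that, of "X s"] assms(2) by (simp add: abs_mult)
  then have "\<bar>X t - X 0\<bar> \<le> M * (t - 0)"
    using assms by (intro DERIV_within_bound[where S="{0..T}" and f'="\<lambda>s. \<sigma> * k s (X s)"])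
      (auto simp: characteristic_def)
  also have "\<dots> \<le> M * T" using assms(3) M_pos by (intro mult_left_mono) auto
  finally show ?thesis .
qed

text \<open>Difference quotients over neighbouring characteristics replace the derivative of the flow:
  their logarithms converge together with their derivatives, so no second derivative of \<open>R\<close> is used.\<close>

lemma Rx_along_characteristic:
  assumes X: "characteristic (-1) X"
  obtains g where "g 0 = 0"
    "\<And>t. t \<in> {0..T} \<Longrightarrow> (g has_real_derivative - kx t (X t)) (at t within {0..T})"
    "\<And>t. t \<in> {0..T} \<Longrightarrow> Rx t (X t) = Rx 0 (X 0) * exp (- g t)"
proof -
  define x0 where "x0 = X 0"
  define h where "h = (\<lambda>n. 1 / real (Suc n))"
  have h: "h n > 0" "h n \<le> 1" for n by (auto simp: h_def)
  have h0: "h \<longlonglongrightarrow> 0" unfolding h_def by (rule lim_1_over_real_power[of 1, simplified] LIMSEQ_Suc[OF lim_1_over_n])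
  have "\<exists>Y. Y 0 = x0 + h n \<and> characteristic (-1) Y" for n
    using characteristic_exists[of "-1" 0 "x0 + h n"] T by auto
  then obtain Y where Y0: "\<And>n. Y n 0 = x0 + h n" and Y: "\<And>n. characteristic (-1) (Y n)" by metis
  define p q where "p = x0 - M * T" and "q = x0 + 1 + M * T"
  have Xb: "X t \<in> {p..q}" and Yb: "Y n t \<in> {p..q}" if "t \<in> {0..T}" for n t
    using characteristic_bound[OF X _ that] characteristic_bound[OF Y[of n] _ that] Y0[of n] h[of n]
    unfolding p_def q_def x0_def abs_le_iff by auto
  obtain \<Lambda> where \<Lambda>: "\<Lambda> \<ge> 0" "\<And>t x. t \<in> {0..T} \<Longrightarrow> x \<in> {p..q} \<Longrightarrow> \<bar>kx t x\<bar> \<le> \<Lambda>"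
    using kx_bounded by blast
  define d where "d = (\<lambda>n t. Y n t - X t)"
  define d' where "d' = (\<lambda>n t. - (k t (Y n t) - k t (X t)))"
  have dd: "(d n has_real_derivative d' n t) (at t within {0..T})" if "t \<in> {0..T}" for n t
    unfolding d_def d'_def using X Y[of n] that
    by (auto intro!: derivative_eq_intros simp: characteristic_def)
  have lip: "\<bar>d' n t\<bar> \<le> \<Lambda> * \<bar>d n t\<bar>" if "t \<in> {0..T}" for n t
    using kx_lipschitz[OF \<Lambda>(2) that Yb[OF that] Xb[OF that], of n] that by (simp add: d_def d'_def)
  have d0: "d n 0 = h n" for n by (simp add: d_def Y0 x0_def)
  have dpos: "0 < d n t" and "d n t \<le> h n * exp (\<Lambda> * t)" if "t \<in> {0..T}" for n t
    using gronwall_two_sided[OF dd[of _ n] lip[of _ n] _ that] d0[of n] h(1)[of n] by auto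
  moreover have "h n * exp (\<Lambda> * t) \<le> h n * exp (\<Lambda> * T)" if "t \<in> {0..T}" for n t
    using that \<Lambda>(1) h(1)[of n] by (auto intro!: mult_left_mono)
  ultimately have dle: "d n t \<le> h n * exp (\<Lambda> * T)" if "t \<in> {0..T}" for n t
    using that order_trans by blast
  \<comment> \<open>The derivative of this logarithm is minus a difference quotient of the speed,
    which by the mean value theorem and uniform continuity tends to \<open>- kx t (X t)\<close>
    uniformly in \<open>t\<close>; its value at time 0 is 0. So the logarithms converge to a
    differentiable limit, the logarithm of the derivative of the flow.\<close>
  define f where "f = (\<lambda>n t. ln (d n t / h n))"
  have df: "(f n has_real_derivative d' n t / d n t) (at t within {0..T})" if "t \<in> {0..T}" for n t
    unfolding f_def using dd[OF that, of n] dpos[OF that, of n] h(1)[of n]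
    by (auto intro!: derivative_eq_intros simp: field_simps)
  have uc: "uniformly_continuous_on ({0..T} \<times> {p..q}) (\<lambda>(t, x). kx t x)"
    by (intro compact_uniformly_continuous continuous_on_subset[OF cont_kx] compact_Times) auto
  have unif: "\<forall>\<^sub>F n in sequentially. \<forall>t\<in>{0..T}. \<forall>c. norm (d' n t / d n t * c - (- kx t (X t)) * c) \<le> e * norm c"
    if e: "e > 0" for e
  proof -
    obtain \<delta> where \<delta>: "\<delta> > 0" "\<And>z w. z \<in> {0..T} \<times> {p..q} \<Longrightarrow> w \<in> {0..T} \<times> {p..q} \<Longrightarrow> dist w z < \<delta>
        \<Longrightarrow> dist (case w of (t, x) \<Rightarrow> kx t x) (case z of (t, x) \<Rightarrow> kx t x) < e"
      using uc e unfolding uniformly_continuous_on_def by meson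
    have "(\<lambda>n. h n * exp (\<Lambda> * T)) \<longlonglongrightarrow> 0 * exp (\<Lambda> * T)" by (intro tendsto_intros h0)
    then have "\<forall>\<^sub>F n in sequentially. h n * exp (\<Lambda> * T) < \<delta>"
      using \<delta>(1) by (intro order_tendstoD) auto
    then show ?thesis
    proof eventually_elim
      case (elim n)
      show ?case
      proof (intro ballI allI)
        fix t c assume t: "t \<in> {0..T}"
        have pos: "X t < Y n t" using dpos[OF t, of n] by (simp add: d_def)
        obtain \<xi> where \<xi>: "X t < \<xi>" "\<xi> < Y n t" "k t (Y n t) - k t (X t) = (Y n t - X t) * kx t \<xi>"
          using MVT2[OF pos, of "k t" "kx t"] k_x[OF t] by (auto simp: kx_def)
        have "dist (kx t \<xi>) (kx t (X t)) < e"
          using \<delta>(2)[of "(t, X t)" "(t, \<xi>)"] t Xb[OF t] Yb[OF t, of n] \<xi>(1,2) dle[OF t, of n] elim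
          by (auto simp: dist_Pair_Pair dist_real_def d_def)
        moreover have "d' n t / d n t = - kx t \<xi>"
          using pos \<xi>(3) by (simp add: d'_def d_def field_simps)
        ultimately have "norm (d' n t / d n t - (- kx t (X t))) \<le> e"
          by (simp add: dist_real_def)
        then show "norm (d' n t / d n t * c - (- kx t (X t)) * c) \<le> e * norm c"
          unfolding left_diff_distrib[symmetric] norm_mult by (intro mult_right_mono) auto
      qed
    qed
  qed
  have "\<exists>g. \<forall>t\<in>{0..T}. (\<lambda>n. f n t) \<longlonglongrightarrow> g t \<and> (g has_derivative (*) (- kx t (X t))) (at t within {0..T})"
    by (rule has_derivative_sequence[where f'="\<lambda>n t. (*) (d' n t / d n t)" and ?x0.0=0 and l=0])
      (use df unif T in \<open>auto simp: has_field_derivative_def f_def d0 h(1) less_imp_neq[THEN not_sym]\<close>)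
  then obtain g where gg: "\<forall>t\<in>{0..T}. (\<lambda>n. f n t) \<longlonglongrightarrow> g t \<and> (g has_derivative (*) (- kx t (X t))) (at t within {0..T})"
    by blast
  then have g: "(\<lambda>n. f n t) \<longlonglongrightarrow> g t" "(g has_real_derivative - kx t (X t)) (at t within {0..T})"
    if "t \<in> {0..T}" for t
    using that by (auto simp: has_field_derivative_def)
  have hn: "h n \<noteq> 0" for n using h(1)[of n] by simp
  have "g 0 = 0"
  proof (rule LIMSEQ_unique[OF g(1)])
    show "(\<lambda>n. f n 0) \<longlonglongrightarrow> 0" by (simp add: f_def d0 hn)
  qed (use T in auto)
  have quot: "(\<lambda>n. (R t (x + s n) - R t x) / s n) \<longlonglongrightarrow> Rx t x"
    if "t \<in> {0..T}" "s \<longlonglongrightarrow> 0" "\<And>n. s n > 0" for t x s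
  proof -
    have "((\<lambda>c. (R t (x + c) - R t x) / c) \<longlongrightarrow> Rx t x) (at 0)"
      using R_x[OF that(1), of x] unfolding DERIV_def .
    moreover have "filterlim s (at 0) sequentially"
      using that(2,3) by (auto simp: filterlim_at less_imp_neq[THEN not_sym])
    ultimately show ?thesis by (rule filterlim_compose)
  qed
  have "Rx t (X t) = Rx 0 (X 0) * exp (- g t)" if t: "t \<in> {0..T}" for t
  proof -
    have dlim: "(\<lambda>n. d n t) \<longlonglongrightarrow> 0"
    proof (rule tendsto_sandwich[where f="\<lambda>_. 0" and h="\<lambda>n. h n * exp (\<Lambda> * T)"])
      show "(\<lambda>n. h n * exp (\<Lambda> * T)) \<longlonglongrightarrow> 0"
        using tendsto_mult_left_zero[OF h0] by simp
    qed (use dpos[OF t] dle[OF t] in \<open>auto intro!: always_eventually less_imp_le\<close>)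
    \<comment> \<open>\<open>R\<close> is constant along both characteristics, so its increment
      between them is conserved. Multiplying the quotient at time \<open>t\<close> by
      \<open>d n t / h n\<close> therefore gives back the quotient at time 0.\<close>
    have "(\<lambda>n. (R t (X t + d n t) - R t (X t)) / d n t * exp (f n t)) \<longlonglongrightarrow> Rx t (X t) * exp (g t)"
      by (intro tendsto_intros quot[OF t dlim dpos[OF t]] g(1)[OF t])
    moreover have "(R t (X t + d n t) - R t (X t)) / d n t * exp (f n t) = (R 0 (x0 + h n) - R 0 x0) / h n" for n
    proof -
      have "R t (X t + d n t) = R 0 (x0 + h n)" "R t (X t) = R 0 x0"
        using R_constant[OF Y[of n] t] R_constant[OF X t] by (simp_all add: d_def Y0 x0_def)
      moreover have "exp (f n t) = d n t / h n"
        unfolding f_def using dpos[OF t, of n] h(1)[of n] by simp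
      ultimately show ?thesis using dpos[OF t, of n] by simp
    qed
    moreover have "(\<lambda>n. (R 0 (x0 + h n) - R 0 x0) / h n) \<longlonglongrightarrow> Rx 0 x0"
      using T by (intro quot h0 h) auto
    ultimately have "Rx t (X t) * exp (g t) = Rx 0 x0"
      using LIMSEQ_unique by auto
    then show ?thesis by (simp add: x0_def exp_minus field_simps)
  qed
  then show ?thesis using that g(2) \<open>g 0 = 0\<close> by blast
qed

text \<open>For the reciprocal \<open>y\<close> of \<open>sqrt k * Rx\<close> the Riccati equation
  reduces to \<open>y' = - b / sqrt k\<close>; the weight \<open>sqrt k\<close> is the integrating
  factor that removes the terms with \<open>Sx\<close>. Since \<open>y\<close> is positive up to
  time \<open>T\<close>, does not increase before \<open>t0\<close> and falls at rate at least
  \<open>\<beta>\<close> afterwards, \<open>T - t0\<close> is at most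
  \<open>y 0 / \<beta>\<close>.\<close>

lemma riccati_bound:
  assumes X: "characteristic (-1) X" and r0: "Rx 0 (X 0) > 0" and t0: "t0 \<in> {0..T}"
    and b0: "\<And>t. t \<in> {0..T} \<Longrightarrow> b t (X t) \<ge> 0"
    and b1: "\<And>t. t \<in> {t0..T} \<Longrightarrow> \<beta> \<le> b t (X t) / sqrt (k t (X t))" and \<beta>: "\<beta> > 0"
  shows "T \<le> t0 + 1 / (\<beta> * sqrt (k 0 (X 0)) * Rx 0 (X 0))"
proof -
  obtain g where g0: "g 0 = 0"
    and g: "\<And>t. t \<in> {0..T} \<Longrightarrow> (g has_real_derivative - kx t (X t)) (at t within {0..T})"
    and Rxg: "\<And>t. t \<in> {0..T} \<Longrightarrow> Rx t (X t) = Rx 0 (X 0) * exp (- g t)"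
    using Rx_along_characteristic[OF X] by blast
  define K where "K = (\<lambda>t. k t (X t))"
  have K: "K t > 0" if "t \<in> {0..T}" for t using k_pos[OF that] by (simp add: K_def)
  have dK: "(K has_real_derivative 2 * K t * b t (X t) * Sx t (X t)) (at t within {0..T})" if t: "t \<in> {0..T}" for t
    using DERIV_along_characteristic[OF X t k_t[OF t] k_x cont_kx[unfolded kx_def]]
    by (simp add: K_def algebra_simps)
  define w where "w = (\<lambda>t. sqrt (K t))"
  have dw: "(w has_real_derivative w t * b t (X t) * Sx t (X t)) (at t within {0..T})" if t: "t \<in> {0..T}" for t
  proof -
    have "sqrt (K t) \<noteq> 0" "K t = sqrt (K t) * sqrt (K t)" using K[OF t] by auto
    then show ?thesis
      unfolding w_def by (intro DERIV_cong[OF DERIV_chain2[OF DERIV_real_sqrt[OF K[OF t]] dK[OF t]]])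
        (simp add: field_simps)
  qed
  \<comment> \<open>By \<open>Rxg\<close> this is \<open>1 / (sqrt k * Rx)\<close> along
    \<open>X\<close>, written so that only \<open>g\<close> and \<open>w\<close> have to be
    differentiated.\<close>
  define y where "y = (\<lambda>t. exp (g t) / (w t * Rx 0 (X 0)))"
  have dy: "((\<lambda>t. - y t) has_real_derivative b t (X t) / w t) (at t within {0..T})" if t: "t \<in> {0..T}" for t
  proof -
    let ?r = "Rx 0 (X 0)"
    have wn: "w t \<noteq> 0" using K[OF t] by (simp add: w_def)
    have "((\<lambda>t. - y t) has_real_derivative exp (g t) / (w t * ?r) * (kx t (X t) + b t (X t) * Sx t (X t)))
        (at t within {0..T})"
      unfolding y_def using wn r0
      by (auto intro!: derivative_eq_intros g[OF t] dw[OF t] simp: field_simps)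
    moreover have "exp (g t) / (w t * ?r) * (kx t (X t) + b t (X t) * Sx t (X t)) = b t (X t) / w t"
    proof -
      have "kx t (X t) + b t (X t) * Sx t (X t) = b t (X t) * (?r * exp (- g t))"
        unfolding Rxg[OF t, symmetric] by (simp add: kx_def algebra_simps)
      then show ?thesis using wn r0 by (simp add: exp_minus field_simps)
    qed
    ultimately show ?thesis by simp
  qed
  have "- y 0 \<le> - y t0"
    by (rule DERIV_within_mono[where S="{0..T}" and f="\<lambda>t. - y t" and f'="\<lambda>t. b t (X t) / w t"])
      (use t0 dy b0 K in \<open>auto simp: w_def less_imp_le intro!: divide_nonneg_nonneg\<close>)
  moreover have "- y t0 - \<beta> * t0 \<le> - y T - \<beta> * T"
  proof (rule DERIV_within_mono[where S="{0..T}" and f="\<lambda>t. - y t - \<beta> * t" and f'="\<lambda>t. b t (X t) / w t - \<beta>"])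
    show "((\<lambda>t. - y t - \<beta> * t) has_real_derivative b t (X t) / w t - \<beta>) (at t within {0..T})" if "t \<in> {t0..T}" for t
      by (rule DERIV_diff[OF dy]) (use that t0 in \<open>auto intro!: derivative_eq_intros\<close>)
  qed (use t0 b1 in \<open>auto simp: K_def w_def\<close>)
  moreover have "y T > 0" using K[of T] T r0 by (simp add: y_def w_def)
  ultimately have "\<beta> * (T - t0) \<le> y 0" by (simp add: algebra_simps)
  then have "T - t0 \<le> y 0 / \<beta>" using \<beta> by (simp add: field_simps)
  then show ?thesis by (simp add: y_def w_def g0 K_def algebra_simps)
qed

text \<open>Speeds are at least 1/2. Hence at time \<open>t\<close> the first-family characteristic
  from \<open>x0\<close> has reached \<open>x0 - t / 2\<close> or beyond, and the second-family
  characteristic through that point started at least another \<open>t / 2\<close> to the left. So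
  \<open>S\<close> there is an initial value at some \<open>y \<le> x0 - t\<close>, the case that
  \<open>b1\<close> controls. The factor 2 comes from \<open>sqrt k \<ge> 1/2\<close>.\<close>

lemma blowup_time_bound:
  assumes k: "\<And>t x. t \<in> {0..T} \<Longrightarrow> k t x \<ge> 1/2" and b0: "\<And>t x. t \<in> {0..T} \<Longrightarrow> b t x \<ge> 0"
    and r0: "Rx 0 x0 > 0" and t0: "t0 \<ge> 0" and \<beta>: "\<beta> > 0"
    and b1: "\<And>t x y. t \<in> {0..T} \<Longrightarrow> t0 \<le> t \<Longrightarrow> R t x = R 0 x0 \<Longrightarrow> S t x = S 0 y \<Longrightarrow> y \<le> x0 - t
      \<Longrightarrow> \<beta> \<le> b t x / sqrt (k t x)"
  shows "T \<le> t0 + 2 / (\<beta> * Rx 0 x0)"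
proof (cases "t0 \<le> T")
  case False
  then show ?thesis using r0 \<beta> by (simp add: add_increasing2)
next
  case True
  obtain X where X0: "X 0 = x0" and X: "characteristic (-1) X"
    using characteristic_exists[of "-1" 0 x0] T by auto
  have speed: "\<sigma> * (Z t - Z 0) \<ge> t / 2" if "characteristic \<sigma> Z" "\<bar>\<sigma>\<bar> = 1" "t \<in> {0..T}" for \<sigma> Z t
  proof -
    have \<sigma>: "\<sigma> * \<sigma> = 1" using that(2) by (metis abs_mult_self_eq mult_1)
    have "\<sigma> * Z 0 - 0 / 2 \<le> \<sigma> * Z t - t / 2"
    proof (rule DERIV_within_mono[where S="{0..T}" and f="\<lambda>s. \<sigma> * Z s - s / 2" and f'="\<lambda>s. k s (Z s) - 1/2"])
      show "((\<lambda>s. \<sigma> * Z s - s / 2) has_real_derivative k s (Z s) - 1/2) (at s within {0..T})" if "s \<in> {0..t}" for s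
        using \<open>characteristic \<sigma> Z\<close> that \<open>t \<in> {0..T}\<close> \<sigma>
        by (auto intro!: derivative_eq_intros simp: characteristic_def mult.assoc[symmetric])
    qed (use that k in auto)
    then show ?thesis by (simp add: algebra_simps)
  qed
  have "T \<le> t0 + 1 / (\<beta> * sqrt (k 0 (X 0)) * Rx 0 (X 0))"
  proof (rule riccati_bound[OF X])
    fix t assume t: "t \<in> {t0..T}"
    then have t': "t \<in> {0..T}" using t0 by auto
    obtain Z where Zt: "Z t = X t" and Z: "characteristic 1 Z"
      using characteristic_exists[of 1 t "X t"] t' by auto
    have "Z 0 \<le> x0 - t" using speed[OF X _ t'] speed[OF Z _ t'] Zt X0 by simp
    then show "\<beta> \<le> b t (X t) / sqrt (k t (X t))"
      using b1[OF t', of "X t" "Z 0"] t R_constant[OF X t'] S_constant[OF Z t'] X0 Zt by simp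
  qed (use r0 t0 True b0 \<beta> X0 in auto)
  also have "1 / (\<beta> * sqrt (k 0 (X 0)) * Rx 0 (X 0)) \<le> 1 / (\<beta> * (1/2) * Rx 0 (X 0))"
  proof -
    have "1/2 \<le> sqrt (k 0 (X 0))"
      by (rule real_le_rsqrt) (use k[of 0 "X 0"] T in \<open>auto simp: power2_eq_square\<close>)
    then show ?thesis using r0 \<beta> X0 k_pos[of 0 "X 0"] T
      by (intro divide_left_mono mult_right_mono mult_left_mono mult_pos_pos) auto
  qed
  finally show ?thesis by (simp add: X0 algebra_simps)
qed

end

section \<open>Flat Gevrey functions and blow-up\<close>

text \<open>Taylor's formula at 0 bounds \<open>\<bar>deriv c \<theta>\<bar>\<close> by
  \<open>C * A ^ Suc m * fact (Suc m) powr s / fact m * r ^ m\<close> for every \<open>m\<close>.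
  The factorials contribute at most \<open>exp (s * m) * m powr ((s - 1) * m)\<close>, so
  \<open>m\<close> just below \<open>(P * r) powr (- a)\<close> makes each of the \<open>m\<close>
  factors at most \<open>exp (- 1)\<close>. The bound is uniform over
  \<open>\<bar>\<theta>\<bar> \<le> r\<close>, as needed for a supremum over the range of
  \<open>u_x\<close>.\<close>

lemma gevrey_flat:
  fixes c :: "real \<Rightarrow> real"
  assumes s: "s > 1" and c: "c \<in> gevrey s U" and flat: "\<forall>m\<ge>1. (deriv ^^ m) c 0 = 0"
    and U: "{-\<delta>..\<delta>} \<subseteq> U"
  obtains B \<beta> where "B > 0" "\<beta> > 0"
    "\<And>\<theta> r. \<bar>\<theta>\<bar> \<le> r \<Longrightarrow> 0 < r \<Longrightarrow> r \<le> \<delta> \<Longrightarrow> \<bar>deriv c \<theta>\<bar> \<le> B * exp (- \<beta> * r powr (- (1 / (s - 1))))"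
proof -
  obtain C A where C: "C > 0" and A: "A > 0"
    and diff: "\<And>m \<theta>. \<theta> \<in> U \<Longrightarrow> (deriv ^^ m) c differentiable (at \<theta>)"
    and bd: "\<And>m \<theta>. \<theta> \<in> U \<Longrightarrow> \<bar>(deriv ^^ m) c \<theta>\<bar> \<le> C * A ^ m * fact m powr s"
    using c by (auto simp: gevrey_def)
  define a where "a = 1 / (s - 1)"
  have a: "a > 0" "a * (s - 1) = 1" using s by (auto simp: a_def)
  \<comment> \<open>Chosen so that \<open>exp s * A / P\<close> is exactly
    \<open>exp (- 1)\<close>.\<close>
  define P where "P = exp (s + 1) * A"
  have P: "P > 0" using A by (simp add: P_def)
  define B where "B = C * A * exp 1"
  define \<beta> where "\<beta> = P powr (- a)"
  have "\<bar>deriv c \<theta>\<bar> \<le> B * exp (- \<beta> * r powr (- a))"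
    if \<theta>: "\<bar>\<theta>\<bar> \<le> r" and r: "0 < r" "r \<le> \<delta>" for \<theta> r
  proof -
    have inU: "t \<in> U" if "\<bar>t\<bar> \<le> \<bar>\<theta>\<bar>" for t
    proof -
      have "\<bar>t\<bar> \<le> \<delta>" using that \<theta> r by linarith
      then show ?thesis using U by (auto simp: abs_le_iff)
    qed
    have taylor: "\<bar>deriv c \<theta>\<bar> \<le> C * A ^ Suc m * fact (Suc m) powr s / fact m * r ^ m" for m
    proof -
      have "\<exists>t. \<bar>t\<bar> \<le> \<bar>\<theta>\<bar> \<and> deriv c \<theta> = (\<Sum>j<m. (deriv ^^ Suc j) c 0 / fact j * \<theta> ^ j) + (deriv ^^ Suc m) c t / fact m * \<theta> ^ m"
      proof (rule Maclaurin_bi_le[where diff="\<lambda>j. (deriv ^^ Suc j) c"])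
        show "\<forall>j t. j < m \<and> \<bar>t\<bar> \<le> \<bar>\<theta>\<bar> \<longrightarrow> ((deriv ^^ Suc j) c has_real_derivative (deriv ^^ Suc (Suc j)) c t) (at t)"
          using diff[OF inU, of _ "Suc _"] by (simp add: DERIV_deriv_iff_real_differentiable)
      qed simp
      then obtain t where t: "\<bar>t\<bar> \<le> \<bar>\<theta>\<bar>"
        "deriv c \<theta> = (\<Sum>j<m. (deriv ^^ Suc j) c 0 / fact j * \<theta> ^ j) + (deriv ^^ Suc m) c t / fact m * \<theta> ^ m"
        by blast
      have "(\<Sum>j<m. (deriv ^^ Suc j) c 0 / fact j * \<theta> ^ j) = 0"
      proof (rule sum.neutral, rule ballI)
        fix j
        have "(deriv ^^ Suc j) c 0 = 0" using flat[rule_format, of "Suc j"] by (simp del: funpow.simps)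
        then show "(deriv ^^ Suc j) c 0 / fact j * \<theta> ^ j = 0" by (simp del: funpow.simps)
      qed
      then have "\<bar>deriv c \<theta>\<bar> = \<bar>(deriv ^^ Suc m) c t\<bar> / fact m * \<bar>\<theta>\<bar> ^ m"
        unfolding t(2) by (simp add: abs_mult power_abs del: funpow.simps)
      also have "\<dots> \<le> C * A ^ Suc m * fact (Suc m) powr s / fact m * r ^ m"
        by (intro mult_mono divide_right_mono power_mono bd inU t(1) \<theta>) (use C A in auto)
      finally show ?thesis .
    qed
    define y where "y = (P * r) powr (- a)"
    have y: "y > 0" using P r by (simp add: y_def)
    have y_eq: "y = \<beta> * r powr (- a)" using P r by (simp add: y_def \<beta>_def powr_mult)
    show ?thesis
    proof (cases "y < 1")
      \<comment> \<open>The order would be 0 here, and the bound of order 0 suffices because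
        \<open>exp (1 - y) \<ge> 1\<close>; rounding \<open>y\<close> down costs the same factor
        \<open>exp 1\<close> in the other case.\<close>
      case True
      have "\<bar>deriv c \<theta>\<bar> \<le> C * A * 1" using taylor[of 0] by simp
      also have "\<dots> \<le> C * A * (exp 1 * exp (- y))"
        using C A True by (intro mult_left_mono) (auto simp: exp_add[symmetric])
      finally show ?thesis by (simp add: B_def y_eq mult_ac)
    next
      case False
      define m where "m = nat \<lfloor>y\<rfloor>"
      have m: "m \<ge> 1" "real m \<le> y" "y \<le> real m + 1" using False by (auto simp: m_def le_nat_iff le_floor_iff; linarith)+
      have m0: "real m > 0" using m(1) by simp
      have f1: "fact (Suc m) powr s / fact m = (real m + 1) powr s * fact m powr (s - 1)"
        by (simp add: powr_mult powr_diff add.commute)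
      have f2: "fact m powr (s - 1) \<le> (real m powr (s - 1)) ^ m"
      proof -
        have "fact m \<le> real (m ^ m)" by (rule fact_le_power)
        then have "fact m powr (s - 1) \<le> (real m ^ m) powr (s - 1)"
          using s by (intro powr_mono2) auto
        also have "\<dots> = (real m powr (s - 1)) ^ m"
          using m0 by (simp add: powr_realpow[symmetric] powr_powr mult.commute)
        finally show ?thesis .
      qed
      have f3: "(real m + 1) powr s \<le> exp s ^ m"
      proof -
        have "(real m + 1) powr s \<le> exp (real m) powr s"
          using s exp_ge_add_one_self[of "real m"] by (intro powr_mono2) (auto simp: add.commute)
        also have "\<dots> = exp s ^ m" by (simp add: powr_def exp_of_nat_mult[symmetric])
        finally show ?thesis .
      qed
      have f4: "real m powr (s - 1) \<le> 1 / (P * r)"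
      proof -
        have "real m powr (s - 1) \<le> y powr (s - 1)" using m s m0 by (intro powr_mono2) auto
        also have "\<dots> = (P * r) powr (- 1)" unfolding y_def powr_powr using a(2) by simp
        also have "\<dots> = 1 / (P * r)" using P r by (simp add: powr_minus divide_inverse)
        finally show ?thesis .
      qed
      have "\<bar>deriv c \<theta>\<bar> \<le> C * A ^ Suc m * (fact (Suc m) powr s / fact m) * r ^ m"
        using taylor[of m] by (simp add: mult.assoc)
      also have "\<dots> \<le> C * A ^ Suc m * (exp s ^ m * (1 / (P * r)) ^ m) * r ^ m"
        unfolding f1
        by (intro mult_right_mono mult_left_mono mult_mono f3 order_trans[OF f2] power_mono f4)
          (use C A r P in auto)
      also have "\<dots> = C * A * (exp s * A * r / (P * r)) ^ m"
        by (simp add: power_mult_distrib power_divide mult_ac)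
      also have "exp s * A * r / (P * r) = exp (- 1)"
        using A r by (simp add: P_def exp_add exp_minus field_simps)
      also have "exp (- 1) ^ m = exp (- real m)" by (simp add: exp_of_nat_mult[symmetric])
      also have "C * A * exp (- real m) \<le> C * A * (exp 1 * exp (- y))"
        using C A m by (intro mult_left_mono) (auto simp: exp_add[symmetric])
      finally show ?thesis by (simp add: B_def y_eq mult_ac)
    qed
  qed
  moreover have "B > 0" "\<beta> > 0" using C A P by (auto simp: B_def \<beta>_def)
  ultimately show ?thesis using that unfolding a_def by blast
qed

text \<open>Passing from \<open>{0..<T}\<close> to a closed subinterval \<open>{0..T'}\<close>
  provides the compactness used along characteristics. \<open>F\<close> and \<open>c\<close> are
  required only on a set \<open>I\<close> that contains all values of \<open>u_x\<close>.\<close>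

lemma wave_riemann:
  assumes "wave_system c T v \<theta> vx \<theta>x" and T': "0 \<le> T'" "T' < T"
    and F: "\<And>z. z \<in> I \<Longrightarrow> (F has_real_derivative c z) (at z)"
    and c: "\<And>z. z \<in> I \<Longrightarrow> (c has_real_derivative c' z) (at z)" "continuous_on I c'"
      "\<And>z. z \<in> I \<Longrightarrow> 0 < c z" "\<And>z. z \<in> I \<Longrightarrow> c z \<le> M"
    and I: "\<And>t x. t \<in> {0..<T} \<Longrightarrow> \<theta> t x \<in> I"
  shows "riemann_system T' M (\<lambda>t x. v t x + F (\<theta> t x)) (\<lambda>t x. v t x - F (\<theta> t x))
    (\<lambda>t x. vx t x + c (\<theta> t x) * \<theta>x t x) (\<lambda>t x. vx t x - c (\<theta> t x) * \<theta>x t x)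
    (\<lambda>t x. c (\<theta> t x)) (\<lambda>t x. c' (\<theta> t x) / (2 * c (\<theta> t x)))"
proof -
  interpret wave_system c T v \<theta> vx \<theta>x by fact
  have mem: "t \<in> {0..<T}" if "t \<in> {0..T'}" for t using that T' by auto
  have sub: "{0..T'} \<subseteq> {0..<T}" using T' by auto
  have sub2: "{0..T'} \<times> UNIV \<subseteq> {0..<T} \<times> (UNIV :: real set)" using sub by auto
  note vt = DERIV_subset[OF v_t[OF mem] sub] and \<theta>t = DERIV_subset[OF \<theta>_t[OF mem] sub]
  have pos: "c (\<theta> t x) > 0" if "t \<in> {0..T'}" for t x using c(3) I mem[OF that] by blast
  have nz: "c (\<theta> t x) \<noteq> 0" if "t \<in> {0..T'}" for t x using pos[OF that, of x] by simp
  have c\<theta>: "continuous_on ({0..T'} \<times> UNIV) (\<lambda>z. \<theta> (fst z) (snd z))"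
    using continuous_on_subset[OF cont_\<theta> sub2] by (simp add: case_prod_unfold)
  have cvx: "continuous_on ({0..T'} \<times> UNIV) (\<lambda>z. vx (fst z) (snd z))"
    using continuous_on_subset[OF cont_vx sub2] by (simp add: case_prod_unfold)
  have c\<theta>x: "continuous_on ({0..T'} \<times> UNIV) (\<lambda>z. \<theta>x (fst z) (snd z))"
    using continuous_on_subset[OF cont_\<theta>x sub2] by (simp add: case_prod_unfold)
  have cc: "continuous_on I c" by (intro continuous_at_imp_continuous_on ballI DERIV_isCont[OF c(1)])
  have \<theta>I: "(\<lambda>z. \<theta> (fst z) (snd z)) ` ({0..T'} \<times> UNIV) \<subseteq> I" using I mem by auto
  note cc\<theta> = continuous_on_compose2[OF cc c\<theta> \<theta>I] and cc'\<theta> = continuous_on_compose2[OF c(2) c\<theta> \<theta>I]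
  have d\<theta>x: "((\<lambda>x. h (\<theta> t x)) has_real_derivative h' (\<theta> t x) * \<theta>x t x) (at x)"
    if "\<And>z. z \<in> I \<Longrightarrow> (h has_real_derivative h' z) (at z)" "t \<in> {0..T'}" for h h' t x
    by (rule DERIV_chain2[where f=h and g="\<theta> t", OF that(1)[OF I[OF mem[OF that(2)]]] \<theta>_x[OF mem[OF that(2)]]])
  have d\<theta>t: "((\<lambda>t. h (\<theta> t x)) has_real_derivative h' (\<theta> t x) * vx t x) (at t within {0..T'})"
    if "\<And>z. z \<in> I \<Longrightarrow> (h has_real_derivative h' z) (at z)" "t \<in> {0..T'}" for h h' t x
    by (rule DERIV_chain2[where f=h and g="\<lambda>t. \<theta> t x", OF that(1)[OF I[OF mem[OF that(2)]]] \<theta>t[OF that(2)]])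
  show ?thesis
  proof
    fix t x assume t: "t \<in> {0..T'}"
    note nz = nz[OF t, of x]
    show "((\<lambda>x. v t x + F (\<theta> t x)) has_real_derivative vx t x + c (\<theta> t x) * \<theta>x t x) (at x)"
      by (intro DERIV_add v_x[OF mem[OF t]] d\<theta>x[OF F t])
    show "((\<lambda>x. v t x - F (\<theta> t x)) has_real_derivative vx t x - c (\<theta> t x) * \<theta>x t x) (at x)"
      by (intro DERIV_diff v_x[OF mem[OF t]] d\<theta>x[OF F t])
    show "((\<lambda>x. c (\<theta> t x)) has_real_derivative c' (\<theta> t x) / (2 * c (\<theta> t x)) *
        (vx t x + c (\<theta> t x) * \<theta>x t x - (vx t x - c (\<theta> t x) * \<theta>x t x))) (at x)"
      by (rule DERIV_cong[OF d\<theta>x[OF c(1) t]]) (use nz in \<open>simp_all add: field_simps\<close>)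
    show "((\<lambda>t. v t x + F (\<theta> t x)) has_real_derivative c (\<theta> t x) * (vx t x + c (\<theta> t x) * \<theta>x t x)) (at t within {0..T'})"
      by (rule DERIV_cong[OF DERIV_add[OF vt[OF t] d\<theta>t[OF F t]]]) (simp_all add: algebra_simps power2_eq_square)
    show "((\<lambda>t. v t x - F (\<theta> t x)) has_real_derivative - c (\<theta> t x) * (vx t x - c (\<theta> t x) * \<theta>x t x)) (at t within {0..T'})"
      by (rule DERIV_cong[OF DERIV_diff[OF vt[OF t] d\<theta>t[OF F t]]]) (simp_all add: algebra_simps power2_eq_square)
    show "((\<lambda>t. c (\<theta> t x)) has_real_derivative c (\<theta> t x) * (c' (\<theta> t x) / (2 * c (\<theta> t x))) *
        (vx t x + c (\<theta> t x) * \<theta>x t x + (vx t x - c (\<theta> t x) * \<theta>x t x))) (at t within {0..T'})"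
      by (rule DERIV_cong[OF d\<theta>t[OF c(1) t]]) (use nz in \<open>simp_all add: field_simps\<close>)
    show "c (\<theta> t x) \<le> M" "0 < c (\<theta> t x)" using c(4) I mem[OF t] pos[OF t] by auto
  next
    show "continuous_on ({0..T'} \<times> UNIV) (\<lambda>(t, x). vx t x + c (\<theta> t x) * \<theta>x t x)"
      "continuous_on ({0..T'} \<times> UNIV) (\<lambda>(t, x). vx t x - c (\<theta> t x) * \<theta>x t x)"
      "continuous_on ({0..T'} \<times> UNIV) (\<lambda>(t, x). c (\<theta> t x))"
      unfolding case_prod_unfold by (intro continuous_intros cvx c\<theta>x cc\<theta>)+
    show "continuous_on ({0..T'} \<times> UNIV) (\<lambda>(t, x). c' (\<theta> t x) / (2 * c (\<theta> t x)))"
      unfolding case_prod_unfold by (intro continuous_intros cc\<theta> cc'\<theta>) (use nz in auto)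
  qed (use T' in auto)
qed

text \<open>Two confinements come first. The range of \<open>u_x\<close> is connected and meets
  \<open>{-\<delta>..\<delta>}\<close>, so it stays in the component \<open>I\<close> of 0 in
  \<open>U\<close>, where \<open>F\<close> is a primitive of \<open>c\<close> and increasing; then
  \<open>\<bar>F(u_x)\<bar> \<le> 3 * \<mu>\<close>, a consequence of the data bounds, forces
  \<open>\<bar>u_x\<bar> \<le> \<delta>\<close>. The number \<open>r\<close> bounds
  \<open>\<bar>R\<bar>\<close> at \<open>x0\<close> from below, and \<open>far\<close> keeps
  \<open>\<bar>S\<bar>\<close> below \<open>r / 2\<close> after time \<open>t0\<close>, so
  \<open>R - S\<close> stays away from 0.\<close>

lemma wave_blowup:
  assumes sys: "wave_system c T v \<theta> vx \<theta>x" and T: "T > 0"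
    and U: "open U" "{-\<delta>..\<delta>} \<subseteq> U" "\<delta> > 0"
    and c: "\<And>z. z \<in> U \<Longrightarrow> (c has_real_derivative c' z) (at z)" "continuous_on U c'"
      "\<And>z. z \<in> U \<Longrightarrow> 0 < c z" "\<And>z. z \<in> U \<Longrightarrow> c z \<le> M"
    and c1: "\<And>z. \<bar>z\<bar> \<le> \<delta> \<Longrightarrow> \<bar>c z - 1\<bar> \<le> 1/2" and c'0: "\<And>z. \<bar>z\<bar> \<le> \<delta> \<Longrightarrow> c' z \<ge> 0"
    and \<theta>U: "\<And>t x. t \<in> {0..<T} \<Longrightarrow> \<theta> t x \<in> U"
    and data: "\<And>x. \<bar>v 0 x\<bar> \<le> \<mu>" "\<And>x. \<bar>\<theta> 0 x\<bar> \<le> \<mu>" and \<mu>: "6 * \<mu> < \<delta>"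
    and r: "r > 0" "r \<le> \<bar>v 0 x0 + prim c (\<theta> 0 x0)\<bar>"
    and far: "\<And>y. y \<le> x0 - t0 \<Longrightarrow> \<bar>v 0 y - prim c (\<theta> 0 y)\<bar> \<le> r / 2" and t0: "t0 \<ge> 0"
    and \<rho>: "\<rho> > 0" "\<rho> \<le> vx 0 x0 + c (\<theta> 0 x0) * \<theta>x 0 x0"
    and \<kappa>: "\<kappa> > 0" "\<And>z. r / 6 \<le> \<bar>z\<bar> \<Longrightarrow> \<bar>z\<bar> \<le> \<delta> \<Longrightarrow> \<kappa> \<le> c' z"
  shows "T \<le> t0 + 8 / (\<kappa> * \<rho>)"
proof -
  interpret wave_system c T v \<theta> vx \<theta>x by (rule sys)
  define I where "I = connected_component_set U 0"
  have "0 \<in> {-\<delta>..\<delta>}" using U(3) by simp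
  then have U0: "0 \<in> U" using U(2) by blast
  have I: "open I" "convex I" "0 \<in> I" "I \<subseteq> U"
    unfolding I_def using U(1) U0
    by (auto simp: open_connected_component connected_convex_1[symmetric] dest: connected_component_in)
  have \<delta>I: "{-\<delta>..\<delta>} \<subseteq> I"
    unfolding I_def by (rule connected_component_maximal) (use U in auto)
  have \<mu>0: "\<mu> \<ge> 0" using data(1)[of 0] by linarith
  have inI: "z \<in> I" if "\<bar>z\<bar> \<le> \<delta>" for z
  proof -
    have "z \<in> {-\<delta>..\<delta>}" using that by (auto simp: abs_le_iff)
    then show ?thesis using \<delta>I by blast
  qed
  have \<theta>I: "\<theta> t x \<in> I" if "t \<in> {0..<T}" for t x
  proof -
    have "connected ((\<lambda>(t, x). \<theta> t x) ` ({0..<T} \<times> UNIV))"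
      by (intro connected_continuous_image cont_\<theta> connected_Times) auto
    then have "connected ((\<lambda>(t, x). \<theta> t x) ` ({0..<T} \<times> UNIV) \<union> {-\<delta>..\<delta>})"
    proof (rule connected_Un)
      have "\<theta> 0 0 \<in> {-\<delta>..\<delta>}" using data(2)[of 0] \<mu> \<mu>0 by (auto simp: abs_le_iff)
      moreover have "\<theta> 0 0 \<in> (\<lambda>(t, x). \<theta> t x) ` ({0..<T} \<times> UNIV)" using T by force
      ultimately show "(\<lambda>(t, x). \<theta> t x) ` ({0..<T} \<times> UNIV) \<inter> {-\<delta>..\<delta>} \<noteq> {}" by blast
    qed simp
    then have "(\<lambda>(t, x). \<theta> t x) ` ({0..<T} \<times> UNIV) \<union> {-\<delta>..\<delta>} \<subseteq> I"
      unfolding I_def by (rule connected_component_maximal[rotated]) (use \<theta>U U in auto)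
    then show ?thesis using that by force
  qed
  define F where "F = prim c"
  have cI: "continuous_on I c"
    using c(1) I(4) by (intro continuous_at_imp_continuous_on ballI DERIV_isCont) blast
  have F: "(F has_real_derivative c z) (at z)" if "z \<in> I" for z
    unfolding F_def by (rule DERIV_prim_open[OF cI I(1-3) that])
  have F0: "F 0 = 0" by (simp add: F_def)
  have F1: "\<bar>F z - z\<bar> \<le> \<bar>z\<bar> / 2" if z: "\<bar>z\<bar> \<le> \<delta>" for z
  proof -
    have "norm ((F z - z) - (F 0 - 0)) \<le> 1/2 * norm (z - 0)"
    proof (rule field_differentiable_bound[where S="{-\<delta>..\<delta>}" and f'="\<lambda>z. c z - 1"])
      show "((\<lambda>z. F z - z) has_real_derivative c w - 1) (at w within {-\<delta>..\<delta>})" if "w \<in> {-\<delta>..\<delta>}" for w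
        by (rule has_field_derivative_at_within[OF DERIV_diff[OF F DERIV_ident]]) (use \<delta>I that in blast)
    qed (use c1 z U(3) in \<open>auto simp: abs_le_iff\<close>)
    then show ?thesis by (simp add: F0)
  qed
  have Fmono: "F z < F w" if "z < w" "z \<in> I" "w \<in> I" for z w
  proof (rule DERIV_pos_imp_increasing[OF that(1)])
    fix u assume "z \<le> u" "u \<le> w"
    then have "u \<in> I"
      using convex_contains_segment[THEN iffD1, OF I(2), rule_format, OF that(2,3)] that(1)
      by (auto simp: closed_segment_eq_real_ivl)
    then show "\<exists>y. (F has_real_derivative y) (at u) \<and> 0 < y" using F c(3) I(4) by blast
  qed
  have Fsmall: "\<bar>z\<bar> \<le> \<delta>" if "z \<in> I" "\<bar>F z\<bar> \<le> 3 * \<mu>" for z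
  proof (rule ccontr)
    assume *: "\<not> \<bar>z\<bar> \<le> \<delta>"
    have "\<bar>F \<delta> - \<delta>\<bar> \<le> \<delta> / 2" "\<bar>F (- \<delta>) - (- \<delta>)\<bar> \<le> \<delta> / 2"
      using F1[of \<delta>] F1[of "-\<delta>"] U(3) by simp_all
    then have "F \<delta> \<ge> \<delta> / 2" "F (- \<delta>) \<le> - (\<delta> / 2)" by linarith+
    moreover have "z > \<delta> \<Longrightarrow> F \<delta> < F z" "z < - \<delta> \<Longrightarrow> F z < F (- \<delta>)"
      using Fmono[of \<delta> z] Fmono[of z "-\<delta>"] that(1) inI[of \<delta>] inI[of "-\<delta>"] U(3) by auto
    moreover have "z > \<delta> \<or> z < - \<delta>" using * by linarith
    ultimately show False using that(2) \<mu> by linarith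
  qed
  have bound: "T' \<le> t0 + 8 / (\<kappa> * \<rho>)" if T': "0 \<le> T'" "T' < T" for T'
  proof -
    interpret r: riemann_system T' M "\<lambda>t x. v t x + F (\<theta> t x)" "\<lambda>t x. v t x - F (\<theta> t x)"
      "\<lambda>t x. vx t x + c (\<theta> t x) * \<theta>x t x" "\<lambda>t x. vx t x - c (\<theta> t x) * \<theta>x t x"
      "\<lambda>t x. c (\<theta> t x)" "\<lambda>t x. c' (\<theta> t x) / (2 * c (\<theta> t x))"
      by (rule wave_riemann[OF sys T' F _ _ _ _ \<theta>I])
        (use c I(4) continuous_on_subset[OF c(2) I(4)] in auto)
    have Fdata: "\<bar>F (\<theta> 0 x)\<bar> \<le> 2 * \<mu>" for x
      using F1[of "\<theta> 0 x"] data(2)[of x] \<mu> \<mu>0 by linarith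
    have \<theta>\<delta>: "\<bar>\<theta> t x\<bar> \<le> \<delta>" if t: "t \<in> {0..T'}" for t x
    proof (rule Fsmall)
      show "\<theta> t x \<in> I" using t T' by (intro \<theta>I) auto
      obtain y where y: "v t x + F (\<theta> t x) = v 0 y + F (\<theta> 0 y)" using r.R_range[OF t, of x] by auto
      obtain z where z: "v t x - F (\<theta> t x) = v 0 z - F (\<theta> 0 z)" using r.S_range[OF t, of x] by auto
      have "\<bar>v 0 y + F (\<theta> 0 y)\<bar> \<le> 3 * \<mu>" "\<bar>v 0 z - F (\<theta> 0 z)\<bar> \<le> 3 * \<mu>"
        using data(1)[of y] data(1)[of z] Fdata[of y] Fdata[of z] by linarith+
      then have "\<bar>((v t x + F (\<theta> t x)) - (v t x - F (\<theta> t x))) / 2\<bar> \<le> 3 * \<mu>"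
        unfolding y z by (rule abs_half_le)
      then show "\<bar>F (\<theta> t x)\<bar> \<le> 3 * \<mu>" by simp
    qed
    have cb: "1/2 \<le> c (\<theta> t x)" "c (\<theta> t x) \<le> 3/2" if "t \<in> {0..T'}" for t x
      using c1[OF \<theta>\<delta>[OF that], of x] by linarith+
    have "T' \<le> t0 + 2 / (\<kappa> / 4 * (vx 0 x0 + c (\<theta> 0 x0) * \<theta>x 0 x0))"
    proof (rule r.blowup_time_bound[OF cb(1) _ _ t0])
      show "0 \<le> c' (\<theta> t x) / (2 * c (\<theta> t x))" if "t \<in> {0..T'}" for t x
        using c'0[OF \<theta>\<delta>[OF that], of x] cb(1)[OF that, of x] by simp
      show "0 < vx 0 x0 + c (\<theta> 0 x0) * \<theta>x 0 x0" using \<rho> by linarith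
      show "0 < \<kappa> / 4" using \<kappa> by simp
      fix t x y
      assume t: "t \<in> {0..T'}" "t0 \<le> t" and R: "v t x + F (\<theta> t x) = v 0 x0 + F (\<theta> 0 x0)"
        and S: "v t x - F (\<theta> t x) = v 0 y - F (\<theta> 0 y)" and y: "y \<le> x0 - t"
      have "\<bar>v 0 y - F (\<theta> 0 y)\<bar> \<le> r / 2" using far[of y] y t unfolding F_def by simp
      \<comment> \<open>\<open>2 * F(u_x) = R - S\<close> is at least \<open>r - r / 2\<close> in
        absolute value; \<open>\<bar>F z\<bar> \<le> 3/2 * \<bar>z\<bar>\<close> then turns
        \<open>r / 4\<close> into \<open>r / 6\<close>.\<close>
      then have "r / 4 \<le> \<bar>F (\<theta> t x)\<bar>" using R S r unfolding F_def by linarith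
      then have "r / 6 \<le> \<bar>\<theta> t x\<bar>" using F1[OF \<theta>\<delta>[OF t(1)], of x] by linarith
      then have k: "\<kappa> \<le> c' (\<theta> t x)" using \<kappa>(2) \<theta>\<delta>[OF t(1)] by blast
      define C where "C = c (\<theta> t x)"
      have C: "1/2 \<le> C" "C \<le> 3/2" using cb[OF t(1)] by (simp_all add: C_def)
      \<comment> \<open>For \<open>C \<le> 3/2\<close> the product \<open>2 * C * sqrt C\<close> is
        at most 15/4, whence the 4 in \<open>\<kappa> / 4\<close>.\<close>
      have "sqrt C \<le> 5/4" by (rule real_le_lsqrt) (use C in \<open>simp_all add: power2_eq_square\<close>)
      then have "2 * C * sqrt C \<le> (2 * (3/2)) * (5/4)" using C by (intro mult_mono) auto
      then have "2 * C * sqrt C \<le> 4" by simp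
      then have "\<kappa> / 4 \<le> c' (\<theta> t x) / (2 * C * sqrt C)"
        using k \<kappa>(1) C by (intro frac_le) auto
      then show "\<kappa> / 4 \<le> c' (\<theta> t x) / (2 * c (\<theta> t x)) / sqrt (c (\<theta> t x))"
        by (simp add: C_def)
    qed
    also have "2 / (\<kappa> / 4 * (vx 0 x0 + c (\<theta> 0 x0) * \<theta>x 0 x0)) \<le> 2 / (\<kappa> / 4 * \<rho>)"
      using \<kappa>(1) \<rho> by (intro divide_left_mono mult_left_mono mult_pos_pos) auto
    finally show ?thesis by (simp add: mult_ac)
  qed
  show ?thesis
  proof (rule dense_le_bounded[OF T])
    show "w \<le> t0 + 8 / (\<kappa> * \<rho>)" if "0 < w" "w < T" for w using bound[of w] that by simp
  qed
qed

lemma prim_near_id: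
  assumes c: "\<And>z. \<bar>z\<bar> < d \<Longrightarrow> isCont c z" "\<And>z. \<bar>z\<bar> < d \<Longrightarrow> \<bar>c z - 1\<bar> \<le> \<eta>" and z: "\<bar>z\<bar> < d"
  shows "\<bar>prim c z - z\<bar> \<le> \<eta> * \<bar>z\<bar>"
proof -
  let ?I = "{-d<..<d}"
  have d: "d > 0" using z by linarith
  have cc: "continuous_on ?I c" by (intro continuous_at_imp_continuous_on ballI c(1)) auto
  have "norm ((prim c z - z) - (prim c 0 - 0)) \<le> \<eta> * norm (z - 0)"
  proof (rule field_differentiable_bound[where S="?I" and f'="\<lambda>z. c z - 1"])
    show "((\<lambda>z. prim c z - z) has_real_derivative c w - 1) (at w within ?I)" if "w \<in> ?I" for w
      by (rule has_field_derivative_at_within[OF DERIV_diff[OF DERIV_prim_open[OF cc] DERIV_ident]])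
        (use that d in auto)
  qed (use c(2) z d in auto)
  then show ?thesis by simp
qed

lemma near_zero_in_domain:
  fixes c :: "real \<Rightarrow> real"
  assumes "open U" "0 \<in> U" "isCont c 0" "c 0 = 1" "\<eta> > 0"
  obtains d where "d > 0" "\<And>z. \<bar>z\<bar> < d \<Longrightarrow> z \<in> U" "\<And>z. \<bar>z\<bar> < d \<Longrightarrow> \<bar>c z - 1\<bar> \<le> \<eta>"
proof -
  obtain e1 where e1: "e1 > 0" "ball 0 e1 \<subseteq> U" using assms(1,2) open_contains_ball by blast
  obtain e2 where e2: "e2 > 0" "\<And>z. \<bar>z\<bar> < e2 \<Longrightarrow> \<bar>c z - 1\<bar> < \<eta>"
    using assms(3-5) unfolding continuous_at_eps_delta
    by (metis dist_0_norm dist_commute dist_real_def real_norm_def)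
  show ?thesis
    by (rule that[of "min e1 e2"]) (use e1 e2 in \<open>auto simp: dist_real_def subset_iff less_imp_le\<close>)
qed

text \<open>The inequality \<open>y / b \<le> exp (y / b)\<close>, raised to the power
  \<open>b\<close>. With \<open>y = \<epsilon> powr (- a)\<close> and \<open>b = s - 1\<close> it
  trades a factor \<open>1 / \<epsilon>\<close> for an exponential.\<close>

lemma powr_le_exp:
  fixes y b :: real
  assumes "b > 0" "y > 0"
  shows "y powr b \<le> b powr b * exp y"
proof -
  have "y / b \<le> exp (y / b)" using exp_ge_add_one_self[of "y / b"] by linarith
  then have "y \<le> b * exp (y / b)" using assms by (simp add: field_simps)
  then have "y powr b \<le> (b * exp (y / b)) powr b" using assms by (intro powr_mono2) auto
  also have "\<dots> = b powr b * exp y" using assms by (simp add: powr_mult exp_powr_real)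
  finally show ?thesis .
qed

text \<open>The symmetry \<open>u(t, x) \<mapsto> -u(t, -x)\<close> exchanges the two families of characteristics.\<close>

lemma wave_system_reflect:
  assumes "wave_system c T v \<theta> vx \<theta>x"
  shows "wave_system c T (\<lambda>t x. - v t (- x)) (\<lambda>t x. \<theta> t (- x)) (\<lambda>t x. vx t (- x)) (\<lambda>t x. - \<theta>x t (- x))"
proof -
  interpret wave_system c T v \<theta> vx \<theta>x by fact
  have refl: "((\<lambda>x. h (- x)) has_real_derivative - h') (at x)" if "(h has_real_derivative h') (at (- x))" for h h' x
    using that by (simp add: DERIV_mirror)
  have cr: "continuous_on ({0..<T} \<times> UNIV) (\<lambda>(t, x). h t (- x))"
    if "cont2_on {0..<T} h" for h :: "real \<Rightarrow> real \<Rightarrow> real"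
    unfolding case_prod_unfold by (rule continuous_on_compose_pair[OF that]) (auto intro!: continuous_intros)
  show ?thesis
  proof
    fix t x assume t: "t \<in> {0..<T}"
    show "((\<lambda>x. - v t (- x)) has_real_derivative vx t (- x)) (at x)"
      using DERIV_minus[OF refl[OF v_x[OF t, of "- x"]]] by simp
    show "((\<lambda>x. \<theta> t (- x)) has_real_derivative - \<theta>x t (- x)) (at x)"
      by (rule refl[OF \<theta>_x[OF t]])
    show "((\<lambda>\<tau>. - v \<tau> (- x)) has_real_derivative (c (\<theta> t (- x)))\<^sup>2 * - \<theta>x t (- x)) (at t within {0..<T})"
      using DERIV_minus[OF v_t[OF t, of "- x"]] by simp
    show "((\<lambda>\<tau>. \<theta> \<tau> (- x)) has_real_derivative vx t (- x)) (at t within {0..<T})"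
      by (rule \<theta>_t[OF t])
  next
    show "continuous_on ({0..<T} \<times> UNIV) (\<lambda>(t, x). - v t (- x))"
      "continuous_on ({0..<T} \<times> UNIV) (\<lambda>(t, x). - \<theta>x t (- x))"
      using continuous_on_minus[OF cr[OF cont_v]] continuous_on_minus[OF cr[OF cont_\<theta>x]]
      by (simp_all add: case_prod_unfold)
  qed (rule cr[OF cont_\<theta>] cr[OF cont_vx])+
qed

text \<open>Formulated for wave systems with given data rather than for the lifespan, so that the
  other sign condition follows by reflection. Accordingly only limits at minus infinity and only the
  sum \<open>\<psi>1 + \<phi>2\<close> occur.\<close>

lemma wave_lifespan_le:
  fixes c c' \<phi>1 \<phi>2 \<psi> \<psi>1 :: "real \<Rightarrow> real"
  assumes s: "s > 1" and U: "open U" "0 \<in> U"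
    and c: "\<And>z. z \<in> U \<Longrightarrow> (c has_real_derivative c' z) (at z)" "continuous_on U c'"
      "\<And>z. z \<in> U \<Longrightarrow> 0 < c z" "\<And>z. z \<in> U \<Longrightarrow> c z \<le> M" "c 0 = 1" "c' 0 = 0"
    and C: "C > 0" "\<forall>\<^sub>F \<theta> in at 0. C * exp (- C * \<bar>\<theta>\<bar> powr (- (1 / (s - 1)))) \<le> c' \<theta>"
    and \<phi>: "\<And>x. (\<phi>1 has_real_derivative \<phi>2 x) (at x)" "continuous_on UNIV \<phi>2"
    and \<psi>: "\<And>x. (\<psi> has_real_derivative \<psi>1 x) (at x)" "continuous_on UNIV \<psi>1"
    and K: "\<And>x. \<bar>\<phi>1 x\<bar> \<le> K" "\<And>x. \<bar>\<phi>2 x\<bar> \<le> K" "\<And>x. \<bar>\<psi> x\<bar> \<le> K" "K > 0"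
    and lim: "(\<phi>1 \<longlongrightarrow> 0) at_bot" "(\<psi> \<longlongrightarrow> 0) at_bot" and x0: "\<psi>1 x0 + \<phi>2 x0 > 0"
  shows "\<exists>\<epsilon>0>0. \<exists>C3>0. \<exists>C4>0. \<forall>\<epsilon> T v \<theta> vx \<theta>x. 0 < \<epsilon> \<and> \<epsilon> \<le> \<epsilon>0 \<and> T > 0 \<and>
    wave_system c T v \<theta> vx \<theta>x \<and> (\<forall>t\<in>{0..<T}. \<forall>x. \<theta> t x \<in> U) \<and>
    (\<forall>x. v 0 x = \<epsilon> * \<psi> x) \<and> (\<forall>x. \<theta> 0 x = \<epsilon> * \<phi>1 x)
    \<longrightarrow> T \<le> C3 * exp (C4 * \<epsilon> powr (- (1 / (s - 1))))"
proof -
  define a where "a = 1 / (s - 1)"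
  have a: "a > 0" "(- a) * (s - 1) = -1" using s by (auto simp: a_def)
  \<comment> \<open>\<open>R\<close> has to be nonzero to first order in \<epsilon> as well as
    increasing. If \<open>\<psi> + \<phi>1\<close> vanishes at \<open>x0\<close>, its positive
    derivative makes it nonzero slightly to the right, where by continuity the derivative is still
    positive.\<close>
  obtain x1 where x1: "\<psi>1 x1 + \<phi>2 x1 > 0" "\<psi> x1 + \<phi>1 x1 \<noteq> 0"
  proof (cases "\<psi> x0 + \<phi>1 x0 = 0")
    case False
    then show ?thesis using that x0 by blast
  next
    case True
    have "((\<lambda>x. \<psi> x + \<phi>1 x) has_real_derivative \<psi>1 x0 + \<phi>2 x0) (at x0)" by (intro DERIV_add \<phi> \<psi>)
    from DERIV_pos_inc_right[OF this x0] obtain d1 where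
      d1: "d1 > 0" "\<And>h. 0 < h \<Longrightarrow> h < d1 \<Longrightarrow> \<psi> x0 + \<phi>1 x0 < \<psi> (x0 + h) + \<phi>1 (x0 + h)" by blast
    have "isCont (\<lambda>x. \<psi>1 x + \<phi>2 x) x0"
      using \<phi>(2) \<psi>(2) by (intro continuous_intros) (auto simp: continuous_on_eq_continuous_at)
    then obtain d2 where d2: "d2 > 0" "\<And>x. \<bar>x - x0\<bar> < d2 \<Longrightarrow> \<bar>\<psi>1 x + \<phi>2 x - (\<psi>1 x0 + \<phi>2 x0)\<bar> < \<psi>1 x0 + \<phi>2 x0"
      using x0 unfolding continuous_at_eps_delta by (metis dist_real_def)
    define e where "e = min d1 d2 / 2"
    have e: "0 < e" "e < d1" "e < d2" using d1(1) d2(1) by (auto simp: e_def)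
    show ?thesis
    proof (rule that[of "x0 + e"])
      show "0 < \<psi>1 (x0 + e) + \<phi>2 (x0 + e)" using d2(2)[of "x0 + e"] e by (simp add: abs_less_iff)
      show "\<psi> (x0 + e) + \<phi>1 (x0 + e) \<noteq> 0" using d1(2)[OF e(1,2)] True by simp
    qed
  qed
  define p q where "p = \<psi>1 x1 + \<phi>2 x1" and "q = \<bar>\<psi> x1 + \<phi>1 x1\<bar>"
  have pq: "p > 0" "q > 0" using x1 by (auto simp: p_def q_def)
  \<comment> \<open>Tolerance for replacing \<open>c\<close> by 1 and its primitive by the identity:
    with \<open>\<eta> * K\<close> at most \<open>q / 2\<close> and \<open>p / 2\<close>, at least
    half of the first-order sizes of \<open>R\<close> and \<open>R_x\<close> at \<open>x1\<close>
    survives.\<close>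
  define \<eta> where "\<eta> = min (1/2) (min (q / (2 * K)) (p / (2 * K)))"
  have \<eta>: "\<eta> > 0" "\<eta> \<le> 1/2" "\<eta> * K \<le> q / 2" "\<eta> * K \<le> p / 2"
  proof -
    show "\<eta> > 0" "\<eta> \<le> 1/2" using pq K(4) by (auto simp: \<eta>_def)
    have "\<eta> \<le> q / (2 * K)" "\<eta> \<le> p / (2 * K)" by (auto simp: \<eta>_def)
    then show "\<eta> * K \<le> q / 2" "\<eta> * K \<le> p / 2" using K(4) by (simp_all add: field_simps)
  qed
  obtain d where d: "d > 0" "\<And>z. \<bar>z\<bar> < d \<Longrightarrow> z \<in> U" "\<And>z. \<bar>z\<bar> < d \<Longrightarrow> \<bar>c z - 1\<bar> \<le> \<eta>"
    "\<And>z. \<bar>z\<bar> < d \<Longrightarrow> z \<noteq> 0 \<Longrightarrow> C * exp (- C * \<bar>z\<bar> powr (- a)) \<le> c' z"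
  proof -
    obtain e1 where e1: "e1 > 0" "\<And>z. \<bar>z\<bar> < e1 \<Longrightarrow> z \<in> U" "\<And>z. \<bar>z\<bar> < e1 \<Longrightarrow> \<bar>c z - 1\<bar> \<le> \<eta>"
      using near_zero_in_domain[OF U DERIV_isCont[OF c(1)[OF U(2)]] c(5) \<eta>(1)] by blast
    obtain e3 where e3: "e3 > 0" "\<And>z. z \<noteq> 0 \<Longrightarrow> \<bar>z\<bar> < e3 \<Longrightarrow> C * exp (- C * \<bar>z\<bar> powr (- a)) \<le> c' z"
      using C(2) unfolding eventually_at a_def by (auto simp: dist_real_def)
    show ?thesis
      by (rule that[of "min e1 e3"]) (use e1 e3 in auto)
  qed
  define \<delta> where "\<delta> = d / 2"
  have \<delta>: "\<delta> > 0" "\<delta> < d" using d(1) by (auto simp: \<delta>_def)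
  have contc: "isCont c z" if "\<bar>z\<bar> < d" for z using c(1)[OF d(2)[OF that]] by (rule DERIV_isCont)
  have "\<forall>\<^sub>F y in at_bot. \<bar>\<psi> y\<bar> < q / 12 \<and> \<bar>\<phi>1 y\<bar> < q / 12"
  proof -
    have "q / 12 > 0" using pq(2) by simp
    from tendstoD[OF lim(1) this] tendstoD[OF lim(2) this] show ?thesis
      by eventually_elim (simp add: dist_real_def)
  qed
  then obtain N where N: "\<And>y. y \<le> N \<Longrightarrow> \<bar>\<psi> y\<bar> < q / 12 \<and> \<bar>\<phi>1 y\<bar> < q / 12"
    unfolding eventually_at_bot_linorder by blast
  \<comment> \<open>From time \<open>t0\<close> on, feet \<open>y \<le> x1 - t\<close> lie left of
    \<open>N\<close>, where the data are below \<open>q / 12\<close> in absolute value.\<close>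
  define t0 where "t0 = max 0 (x1 - N)"
  define D where "D = (s - 1) powr (s - 1)"
  \<comment> \<open>The second summand comes from \<open>r / 6 = \<epsilon> * q / 12\<close>; the 1
    pays for the factor \<open>1 / \<epsilon>\<close>, which is at most
    \<open>D * exp (\<epsilon> powr (- a))\<close>.\<close>
  define C4 where "C4 = 1 + C * (q / 12) powr (- a)"
  define C3 where "C3 = t0 + 16 * D / (C * p)"
  have D: "D > 0" using s by (simp add: D_def)
  have C34: "C4 > 0" "C3 > 0"
    using C(1) D pq by (auto simp: C4_def C3_def t0_def add_pos_nonneg intro!: add_nonneg_pos)
  have main: "T \<le> C3 * exp (C4 * \<epsilon> powr (- a))"
    if \<epsilon>: "0 < \<epsilon>" "\<epsilon> \<le> \<delta> / (7 * K)" and T: "T > 0" and sys: "wave_system c T v \<theta> vx \<theta>x"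
      and \<theta>U: "\<forall>t\<in>{0..<T}. \<forall>x. \<theta> t x \<in> U" and v0: "\<forall>x. v 0 x = \<epsilon> * \<psi> x" and \<theta>0: "\<forall>x. \<theta> 0 x = \<epsilon> * \<phi>1 x"
    for \<epsilon> T v \<theta> vx \<theta>x
  proof -
    interpret wave_system c T v \<theta> vx \<theta>x by (rule sys)
    have \<epsilon>K: "7 * (\<epsilon> * K) \<le> \<delta>" using \<epsilon>(2) K(4) by (simp add: field_simps)
    have \<epsilon>K0: "\<epsilon> * K > 0" using \<epsilon> K(4) by simp
    have b: "\<bar>\<epsilon> * w\<bar> \<le> \<epsilon> * K" if "\<bar>w\<bar> \<le> K" for w
      using that \<epsilon>(1) by (simp add: abs_mult)
    have small: "\<bar>\<epsilon> * \<phi>1 x\<bar> < d" for x using b[OF K(1)[of x]] \<epsilon>K \<epsilon>K0 \<delta> by linarith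
    have vx0: "vx 0 x = \<epsilon> * \<psi>1 x" for x
    proof -
      have "v 0 = (\<lambda>x. \<epsilon> * \<psi> x)" using v0 by auto
      then have "((\<lambda>x. \<epsilon> * \<psi> x) has_real_derivative vx 0 x) (at x)" using v_x[of 0 x] T by auto
      then show ?thesis using DERIV_unique DERIV_cmult[OF \<psi>(1)] by blast
    qed
    have \<theta>x0: "\<theta>x 0 x = \<epsilon> * \<phi>2 x" for x
    proof -
      have "\<theta> 0 = (\<lambda>x. \<epsilon> * \<phi>1 x)" using \<theta>0 by auto
      then have "((\<lambda>x. \<epsilon> * \<phi>1 x) has_real_derivative \<theta>x 0 x) (at x)" using \<theta>_x[of 0 x] T by auto
      then show ?thesis using DERIV_unique DERIV_cmult[OF \<phi>(1)] by blast
    qed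
    have P: "\<bar>prim c (\<epsilon> * \<phi>1 x) - \<epsilon> * \<phi>1 x\<bar> \<le> \<eta> * \<bar>\<epsilon> * \<phi>1 x\<bar>" for x
      by (rule prim_near_id[OF contc d(3) small])
    define r where "r = \<epsilon> * q / 2"
    define \<kappa> where "\<kappa> = C * exp (- C * (r / 6) powr (- a))"
    have r: "r > 0" using \<epsilon> pq by (simp add: r_def)
    have \<kappa>0: "\<kappa> > 0" using C by (simp add: \<kappa>_def)
    have c'_lower: "\<kappa> \<le> c' z" if z: "r / 6 \<le> \<bar>z\<bar>" "\<bar>z\<bar> \<le> \<delta>" for z
    proof -
      have "\<bar>z\<bar> powr (- a) \<le> (r / 6) powr (- a)" using z r a by (intro powr_mono2') auto
      then have "\<kappa> \<le> C * exp (- C * \<bar>z\<bar> powr (- a))" using C by (simp add: \<kappa>_def)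
      also have "\<dots> \<le> c' z" using z r \<delta> by (intro d(4)) auto
      finally show ?thesis .
    qed
    have "T \<le> t0 + 8 / (\<kappa> * (\<epsilon> * p / 2))"
    proof (rule wave_blowup[OF sys T U(1) _ \<delta>(1) c(1-4)])
      show "{- \<delta>..\<delta>} \<subseteq> U" using d(2) \<delta> by (auto simp: subset_iff abs_less_iff)
      show "\<bar>c z - 1\<bar> \<le> 1/2" if "\<bar>z\<bar> \<le> \<delta>" for z using d(3)[of z] that \<delta> \<eta>(2) by linarith
      show "0 \<le> c' z" if "\<bar>z\<bar> \<le> \<delta>" for z
      proof (cases "z = 0")
        case False
        have "0 \<le> C * exp (- C * \<bar>z\<bar> powr (- a))" using C by simp
        also have "\<dots> \<le> c' z" using that \<delta> False by (intro d(4)) auto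
        finally show ?thesis .
      qed (simp add: c(6))
      show "\<theta> t x \<in> U" if "t \<in> {0..<T}" for t x using \<theta>U that by blast
      show "\<bar>v 0 x\<bar> \<le> \<epsilon> * K" "\<bar>\<theta> 0 x\<bar> \<le> \<epsilon> * K" for x using v0 \<theta>0 b K by auto
      show "6 * (\<epsilon> * K) < \<delta>" using \<epsilon>K \<epsilon>K0 by linarith
      show "r \<le> \<bar>v 0 x1 + prim c (\<theta> 0 x1)\<bar>"
      proof -
        have "\<eta> * \<bar>\<epsilon> * \<phi>1 x1\<bar> \<le> \<eta> * (\<epsilon> * K)" using \<eta>(1) by (intro mult_left_mono b K) auto
        also have "\<dots> = \<epsilon> * (\<eta> * K)" by simp
        also have "\<dots> \<le> \<epsilon> * (q / 2)" using \<epsilon> \<eta> by (intro mult_left_mono) auto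
        finally have "\<eta> * \<bar>\<epsilon> * \<phi>1 x1\<bar> \<le> r" by (simp add: r_def)
        moreover have "\<bar>\<epsilon> * \<psi> x1 + \<epsilon> * \<phi>1 x1\<bar> = 2 * r"
          using \<epsilon>(1) by (simp add: r_def q_def abs_mult distrib_left[symmetric])
        ultimately show ?thesis using P[of x1] unfolding v0[rule_format] \<theta>0[rule_format] by linarith
      qed
      show "\<bar>v 0 y - prim c (\<theta> 0 y)\<bar> \<le> r / 2" if "y \<le> x1 - t0" for y
      proof -
        have "y \<le> N" using that by (simp add: t0_def)
        then have "\<bar>\<psi> y\<bar> \<le> q / 12" "\<bar>\<phi>1 y\<bar> \<le> q / 12" using N by (auto intro: less_imp_le)
        then have 1: "\<bar>\<epsilon> * \<psi> y\<bar> \<le> r / 6" "\<bar>\<epsilon> * \<phi>1 y\<bar> \<le> r / 6"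
          using \<epsilon>(1) by (simp_all add: abs_mult r_def)
        have "\<eta> * \<bar>\<epsilon> * \<phi>1 y\<bar> \<le> 1/2 * \<bar>\<epsilon> * \<phi>1 y\<bar>" using \<eta>(2) by (intro mult_right_mono) auto
        then show ?thesis using P[of y] 1 unfolding v0[rule_format] \<theta>0[rule_format] by linarith
      qed
      show "t0 \<ge> 0" by (simp add: t0_def)
      show "0 < \<epsilon> * p / 2" using \<epsilon> pq by simp
      show "\<epsilon> * p / 2 \<le> vx 0 x1 + c (\<theta> 0 x1) * \<theta>x 0 x1"
      proof -
        let ?z = "\<epsilon> * \<phi>1 x1"
        have "\<bar>(c ?z - 1) * (\<epsilon> * \<phi>2 x1)\<bar> \<le> \<eta> * (\<epsilon> * K)"
          unfolding abs_mult[of "c ?z - 1"] by (intro mult_mono d(3) small b K) (use \<eta> in auto)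
        also have "\<dots> = \<epsilon> * (\<eta> * K)" by simp
        also have "\<dots> \<le> \<epsilon> * (p / 2)" using \<epsilon> \<eta> by (intro mult_left_mono) auto
        finally have "\<bar>(c ?z - 1) * (\<epsilon> * \<phi>2 x1)\<bar> \<le> \<epsilon> * p / 2" by simp
        moreover have "vx 0 x1 + c (\<theta> 0 x1) * \<theta>x 0 x1 = \<epsilon> * p + (c ?z - 1) * (\<epsilon> * \<phi>2 x1)"
          using \<theta>0 by (simp add: vx0 \<theta>x0 p_def algebra_simps)
        ultimately show ?thesis by linarith
      qed
    qed (use r \<kappa>0 c'_lower in auto)
    also have "8 / (\<kappa> * (\<epsilon> * p / 2)) = 16 / (C * p) * (1 / \<epsilon>) * exp (C * (q / 12) powr (- a) * \<epsilon> powr (- a))"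
    proof -
      have "(r / 6) powr (- a) = (q / 12) powr (- a) * \<epsilon> powr (- a)"
        using \<epsilon> pq by (simp add: r_def powr_mult[symmetric] mult.commute)
      moreover define X where "X = C * (q / 12) powr (- a) * \<epsilon> powr (- a)"
      ultimately have "\<kappa> = C * exp (- X)" by (simp add: \<kappa>_def mult.assoc)
      also have "exp (- X) = 1 / exp X" by (simp add: exp_minus divide_inverse)
      finally have \<kappa>: "\<kappa> = C * (1 / exp X)" .
      have Y: "8 / (C * (1 / Y) * (\<epsilon> * p / 2)) = 16 / (C * p) * (1 / \<epsilon>) * Y" if "Y > 0" for Y :: real
        using that C(1) pq(1) \<epsilon>(1) by (simp add: divide_simps)
      have "8 / (\<kappa> * (\<epsilon> * p / 2)) = 16 / (C * p) * (1 / \<epsilon>) * exp X"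
        unfolding \<kappa> by (rule Y[OF exp_gt_zero])
      then show ?thesis by (simp only: X_def)
    qed
    also have "\<dots> \<le> 16 / (C * p) * (D * exp (\<epsilon> powr (- a))) * exp (C * (q / 12) powr (- a) * \<epsilon> powr (- a))"
    proof -
      have "1 / \<epsilon> = \<epsilon> powr (- 1)" using \<epsilon>(1) by (simp add: powr_minus_divide)
      also have "\<dots> = (\<epsilon> powr (- a)) powr (s - 1)" by (simp only: powr_powr a(2))
      also have "\<dots> \<le> D * exp (\<epsilon> powr (- a))" unfolding D_def using s \<epsilon> by (intro powr_le_exp) auto
      finally show ?thesis using C pq by (intro mult_right_mono mult_left_mono) auto
    qed
    also have "\<dots> = 16 * D / (C * p) * exp (C4 * \<epsilon> powr (- a))"
      by (simp add: C4_def distrib_right exp_add)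
    also have "t0 \<le> t0 * exp (C4 * \<epsilon> powr (- a))"
    proof -
      have "t0 * 1 \<le> t0 * exp (C4 * \<epsilon> powr (- a))"
        using C34(1) by (intro mult_left_mono) (auto simp: t0_def)
      then show ?thesis by simp
    qed
    finally show ?thesis by (simp add: C3_def distrib_right)
  qed
  have pos: "\<delta> / (7 * K) > 0" using \<delta> K(4) by simp
  show ?thesis
    unfolding a_def[symmetric]
    by (rule exI[of _ "\<delta> / (7 * K)"], rule conjI[OF pos], rule exI[of _ C3], rule conjI[OF C34(2)],
        rule exI[of _ C4], rule conjI[OF C34(1)], intro allI impI, elim conjE, rule main; assumption)
qed

section \<open>Bounded data and the choice of constants in both estimates\<close>

lemma Cb_1D:
  assumes "f \<in> Cb 1"
  shows "(f has_real_derivative deriv f x) (at x)" "continuous_on UNIV (deriv f)"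
    "bounded (range f)" "bounded (range (deriv f))"
proof -
  have "\<And>x. f differentiable (at x)" "continuous_on UNIV (deriv f)" "bounded (range f)" "bounded (range (deriv f))"
    using assms unfolding Cb_def by (force dest: spec[of _ 0] spec[of _ 1])+
  then show "(f has_real_derivative deriv f x) (at x)" "continuous_on UNIV (deriv f)"
    "bounded (range f)" "bounded (range (deriv f))"
    by (auto simp: DERIV_deriv_iff_real_differentiable)
qed

lemma Cb_2D: "f \<in> Cb 2 \<Longrightarrow> f \<in> Cb 1 \<and> deriv f \<in> Cb 1"
proof -
  assume f: "f \<in> Cb 2"
  have 1: "(deriv ^^ k) f differentiable (at x)" if "k < 2" for k x using f that by (auto simp: Cb_def)
  have 2: "continuous_on UNIV ((deriv ^^ k) f)" "bounded (range ((deriv ^^ k) f))" if "k \<le> 2" for k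
    using f that by (auto simp: Cb_def)
  have 3: "(deriv ^^ k) (deriv f) = (deriv ^^ Suc k) f" for k by (simp add: funpow_Suc_right del: funpow.simps)
  show ?thesis unfolding Cb_def mem_Collect_eq 3 by (intro conjI allI impI 1 2; linarith)
qed

lemma bounded_range_abs:
  fixes f :: "real \<Rightarrow> real"
  assumes "bounded (range f)" obtains B where "B \<ge> 1" "\<And>x. \<bar>f x\<bar> \<le> B"
proof -
  obtain B where "\<And>x. \<bar>f x\<bar> \<le> B" using assms unfolding bounded_iff by auto
  then show ?thesis by (intro that[of "max B 1"]) (auto simp: le_max_iff_disj)
qed

theorem theorem7:
  fixes s :: real and U :: "real set" and c \<phi> \<psi> :: "real \<Rightarrow> real"
  assumes "s > 1"
    and "open U" and "0 \<in> U"
    and "\<forall>\<theta>\<in>U. c \<theta> > 0"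
    and "c \<in> gevrey s U"
    and "c 0 = 1"
    and "\<forall>m\<ge>1. (deriv ^^ m) c 0 = 0"
    and "\<phi> \<in> Cb 2" and "\<psi> \<in> Cb 1"
  shows
    "(\<exists>\<epsilon>0>0. \<exists>C1>0. \<exists>C2>0. \<forall>\<epsilon>. 0 < \<epsilon> \<and> \<epsilon> \<le> \<epsilon>0 \<longrightarrow>
        ereal (C1 * exp (C2 * \<epsilon> powr (- (1 / (s - 1)))))
          \<le> lifespan c U (\<lambda>x. \<epsilon> * \<phi> x) (\<lambda>x. \<epsilon> * \<psi> x))
     \<and>
     ((deriv \<phi> \<longlongrightarrow> 0) at_infinity \<and> (\<psi> \<longlongrightarrow> 0) at_infinity \<and>
      (\<exists>x0. deriv \<psi> x0 + deriv (deriv \<phi>) x0 > 0 \<or> deriv \<psi> x0 - deriv (deriv \<phi>) x0 > 0) \<and>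
      (\<exists>C>0. \<forall>\<^sub>F \<theta> in at 0. C * exp (- C * \<bar>\<theta>\<bar> powr (- (1 / (s - 1)))) \<le> deriv c \<theta>)
      \<longrightarrow>
      (\<exists>\<epsilon>0>0. \<exists>C3>0. \<exists>C4>0. \<forall>\<epsilon>. 0 < \<epsilon> \<and> \<epsilon> \<le> \<epsilon>0 \<longrightarrow>
        lifespan c U (\<lambda>x. \<epsilon> * \<phi> x) (\<lambda>x. \<epsilon> * \<psi> x)
          \<le> ereal (C3 * exp (C4 * \<epsilon> powr (- (1 / (s - 1)))))))"
proof -
  define a where "a = 1 / (s - 1)"
  have a: "a > 0" using assms(1) by (simp add: a_def)
  note \<phi>1 = Cb_1D[OF Cb_2D[OF assms(8), THEN conjunct1]]
    and \<phi>2 = Cb_1D[OF Cb_2D[OF assms(8), THEN conjunct2]] and \<psi> = Cb_1D[OF assms(9)]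
  obtain K where K: "K \<ge> 1" "\<And>x. \<bar>\<phi> x\<bar> \<le> K" "\<And>x. \<bar>deriv \<phi> x\<bar> \<le> K" "\<And>x. \<bar>deriv (deriv \<phi>) x\<bar> \<le> K"
    "\<And>x. \<bar>\<psi> x\<bar> \<le> K" "\<And>x. \<bar>deriv \<psi> x\<bar> \<le> K"
  proof -
    obtain B1 B2 B3 B4 B5 where "B1 \<ge> 1" "\<And>x. \<bar>\<phi> x\<bar> \<le> B1" "\<And>x. \<bar>deriv \<phi> x\<bar> \<le> B2"
      "\<And>x. \<bar>deriv (deriv \<phi>) x\<bar> \<le> B3" "\<And>x. \<bar>\<psi> x\<bar> \<le> B4" "\<And>x. \<bar>deriv \<psi> x\<bar> \<le> B5"
      using \<phi>1(3,4) \<phi>2(4) \<psi>(3,4) by (meson bounded_range_abs)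
    then show ?thesis
      by (intro that[of "max B1 (max B2 (max B3 (max B4 B5)))"]) (auto simp: le_max_iff_disj)
  qed
  have K0: "K > 0" using K(1) by linarith
  have dm: "(deriv ^^ m) c differentiable (at \<theta>)" if "\<theta> \<in> U" for m \<theta>
    using assms(5) that by (auto simp: gevrey_def)
  have dc: "(c has_real_derivative deriv c \<theta>) (at \<theta>)" if "\<theta> \<in> U" for \<theta>
    using dm[OF that, of 0] by (simp add: DERIV_deriv_iff_real_differentiable)
  have cdc: "continuous_on U (deriv c)"
    using dm[of _ 1] by (intro continuous_at_imp_continuous_on) (auto intro: differentiable_imp_continuous_within)
  \<comment> \<open>The case \<open>m = 0\<close> of the Gevrey bound provides a finite maximal
    speed on \<open>U\<close>.\<close>
  obtain M where M: "\<And>\<theta>. \<theta> \<in> U \<Longrightarrow> c \<theta> \<le> M"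
  proof -
    obtain C A where "\<forall>m. \<forall>\<theta>\<in>U. \<bar>(deriv ^^ m) c \<theta>\<bar> \<le> C * A ^ m * fact m powr s"
      using assms(5) unfolding gevrey_def by blast
    from this[rule_format, of _ 0] have "c \<theta> \<le> C" if "\<theta> \<in> U" for \<theta>
      using that by (simp add: abs_le_iff)
    then show ?thesis by (rule that)
  qed
  have dc0: "deriv c 0 = 0" using assms(7)[rule_format, of 1] by simp
  show ?thesis
  proof (intro conjI impI; (elim conjE)?)

    \<comment> \<open>Lower bound for the lifespan\<close>
    obtain d where d: "d > 0" "\<And>z. \<bar>z\<bar> < d \<Longrightarrow> z \<in> U" "\<And>z. \<bar>z\<bar> < d \<Longrightarrow> \<bar>c z - 1\<bar> \<le> 1/2"
      using near_zero_in_domain[OF assms(2,3) DERIV_isCont[OF dc[OF assms(3)]] assms(6), of "1/2"] by auto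
    define \<delta> where "\<delta> = d / 2"
    have \<delta>: "\<delta> > 0" "\<delta> < d" using d(1) by (auto simp: \<delta>_def)
    have \<delta>U: "{-\<delta>..\<delta>} \<subseteq> U" using d(2) \<delta> by (auto simp: subset_iff abs_less_iff)
    obtain B \<beta> where B: "B > 0" "\<beta> > 0"
      "\<And>\<theta> r. \<bar>\<theta>\<bar> \<le> r \<Longrightarrow> 0 < r \<Longrightarrow> r \<le> \<delta> \<Longrightarrow> \<bar>deriv c \<theta>\<bar> \<le> B * exp (- \<beta> * r powr (- a))"
      using gevrey_flat[OF assms(1,5,7) \<delta>U] unfolding a_def by blast
    \<comment> \<open>The three conditions give \<open>1 / \<epsilon> \<ge> 1\<close>,
      \<open>6 * \<mu> < \<delta>\<close> and \<open>192 * \<mu> * B \<le> 1/200\<close>, in this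
      order.\<close>
    define \<epsilon>0 where "\<epsilon>0 = min 1 (min (\<delta> / (7 * K)) (1 / (38400 * K * B)))"
    \<comment> \<open>Read off from
      \<open>L / 4 = C1 * exp (C2 * \<epsilon> powr (- a)) / \<epsilon>\<close>; \<open>C2\<close>
      arises from \<open>(6 * \<mu>) powr (- a)\<close> with
      \<open>\<mu> = \<epsilon> * K\<close>.\<close>
    define C1 C2 where "C1 = 1 / (4800 * K * B)" and "C2 = \<beta> * (6 * K) powr (- a)"
    have pos: "\<epsilon>0 > 0" "C1 > 0" "C2 > 0"
      using \<delta> K0 B by (auto simp: \<epsilon>0_def C1_def C2_def)
    have "ereal (C1 * exp (C2 * \<epsilon> powr (- a))) \<le> lifespan c U (\<lambda>x. \<epsilon> * \<phi> x) (\<lambda>x. \<epsilon> * \<psi> x)"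
      if \<epsilon>: "0 < \<epsilon>" "\<epsilon> \<le> \<epsilon>0" for \<epsilon>
    proof -
      define \<mu> where "\<mu> = \<epsilon> * K"
      have \<epsilon>1: "\<epsilon> \<le> 1" "\<epsilon> \<le> \<delta> / (7 * K)" "\<epsilon> \<le> 1 / (38400 * K * B)" using \<epsilon> by (auto simp: \<epsilon>0_def)
      have \<mu>: "\<mu> > 0" "7 * \<mu> \<le> \<delta>" "\<mu> * B \<le> 1 / 38400"
        using \<epsilon> \<epsilon>1 K0 B(1) by (auto simp: \<mu>_def field_simps)
      define \<omega> where "\<omega> = B * exp (- \<beta> * (6 * \<mu>) powr (- a))"
      \<comment> \<open>Makes \<open>6 * L * \<mu> * \<omega>\<close> equal to 1/200, the other half
        of 1/100 being left for \<open>192 * \<mu> * \<omega>\<close>.\<close>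
      define L where "L = 1 / (1200 * (\<mu> * \<omega>))"
      have \<omega>: "\<omega> > 0" "\<omega> \<le> B" using B by (auto simp: \<omega>_def)
      have \<mu>\<omega>: "\<mu> * \<omega> > 0" "\<mu> * \<omega> \<le> 1 / 38400"
        using \<mu>(1) \<omega>(1) order_trans[OF mult_left_mono[OF \<omega>(2)] \<mu>(3)] by auto
      have b: "\<bar>\<epsilon> * w\<bar> \<le> \<mu>" if "\<bar>w\<bar> \<le> K" for w
        using that \<epsilon>(1) by (simp add: abs_mult \<mu>_def)
      have "ereal (L / 4) \<le> lifespan c U (\<lambda>x. \<epsilon> * \<phi> x) (\<lambda>x. \<epsilon> * \<psi> x)"
      proof (rule wave_lifespan_ge[OF \<delta>U])
        show "(c has_real_derivative deriv c \<theta>) (at \<theta>)" if "\<bar>\<theta>\<bar> \<le> \<delta>" for \<theta>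
          using that \<delta> by (intro dc d(2)) auto
        show "continuous_on {-\<delta>..\<delta>} (deriv c)" by (rule continuous_on_subset[OF cdc \<delta>U])
        show "\<bar>c \<theta> - 1\<bar> \<le> 1/2" if "\<bar>\<theta>\<bar> \<le> \<delta>" for \<theta> using that \<delta> by (intro d(3)) auto
        show "((\<lambda>x. \<epsilon> * \<phi> x) has_real_derivative \<epsilon> * deriv \<phi> x) (at x)"
          "((\<lambda>x. \<epsilon> * deriv \<phi> x) has_real_derivative \<epsilon> * deriv (deriv \<phi>) x) (at x)"
          "((\<lambda>x. \<epsilon> * \<psi> x) has_real_derivative \<epsilon> * deriv \<psi> x) (at x)" for x
          by (intro DERIV_cmult \<phi>1 \<phi>2 \<psi>)+
        show "continuous_on UNIV (\<lambda>x. \<epsilon> * deriv (deriv \<phi>) x)" "continuous_on UNIV (\<lambda>x. \<epsilon> * deriv \<psi> x)"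
          by (intro continuous_intros \<phi>2 \<psi>)+
        show "\<bar>deriv c \<theta>\<bar> \<le> \<omega>" if "\<bar>\<theta>\<bar> \<le> 6 * \<mu>" for \<theta>
          unfolding \<omega>_def using that \<mu> by (intro B(3)) auto
        show "L > 0" using \<mu>\<omega> by (simp add: L_def)
        show "(6 * L + 192) * (\<mu> * \<omega>) \<le> 1 / 100"
        proof -
          have "(6 * L + 192) * (\<mu> * \<omega>) = 6 / 1200 + 192 * (\<mu> * \<omega>)"
            using \<mu>(1) \<omega>(1) by (simp add: L_def distrib_right)
          then show ?thesis using \<mu>\<omega>(2) by simp
        qed
      qed (use assms(6) b K \<mu> in auto)
      moreover have "C1 * exp (C2 * \<epsilon> powr (- a)) \<le> L / 4"
      proof -
        have "(6 * \<mu>) powr (- a) = (6 * K) powr (- a) * \<epsilon> powr (- a)"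
          using K0 \<epsilon> by (simp add: \<mu>_def powr_mult[symmetric] mult_ac)
        moreover define X where "X = C2 * \<epsilon> powr (- a)"
        ultimately have "\<omega> = B * exp (- X)" by (simp add: \<omega>_def C2_def mult.assoc)
        also have "exp (- X) = 1 / exp X" by (simp add: exp_minus divide_inverse)
        finally have \<omega>_eq: "\<omega> = B * (1 / exp X)" .
        have Y: "1 / (1200 * (\<epsilon> * K * (B * (1 / Y)))) / 4 = 1 / (4800 * K * B) * Y * (1 / \<epsilon>)" if "Y > 0" for Y :: real
          using that B(1) K0 \<epsilon>(1) by (simp add: divide_simps)
        have "L / 4 = C1 * exp X * (1 / \<epsilon>)"
          unfolding L_def C1_def \<mu>_def \<omega>_eq by (rule Y[OF exp_gt_zero])
        then have "L / 4 = C1 * exp (C2 * \<epsilon> powr (- a)) * (1 / \<epsilon>)" by (simp only: X_def)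
        moreover have "C1 * exp (C2 * \<epsilon> powr (- a)) * 1 \<le> C1 * exp (C2 * \<epsilon> powr (- a)) * (1 / \<epsilon>)"
          using pos \<epsilon> \<epsilon>1(1) by (intro mult_left_mono) (auto simp: field_simps)
        ultimately show ?thesis by simp
      qed
      ultimately show ?thesis by (meson ereal_less_eq(3) order_trans)
    qed
    then show "\<exists>\<epsilon>0>0. \<exists>C1>0. \<exists>C2>0. \<forall>\<epsilon>. 0 < \<epsilon> \<and> \<epsilon> \<le> \<epsilon>0 \<longrightarrow>
        ereal (C1 * exp (C2 * \<epsilon> powr (- (1 / (s - 1)))))
          \<le> lifespan c U (\<lambda>x. \<epsilon> * \<phi> x) (\<lambda>x. \<epsilon> * \<psi> x)"
      using pos unfolding a_def by blast
  next

    \<comment> \<open>Upper bound for the lifespan\<close>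
    assume lim: "(deriv \<phi> \<longlongrightarrow> 0) at_infinity" "(\<psi> \<longlongrightarrow> 0) at_infinity"
      and x0: "\<exists>x0. deriv \<psi> x0 + deriv (deriv \<phi>) x0 > 0 \<or> deriv \<psi> x0 - deriv (deriv \<phi>) x0 > 0"
      and C: "\<exists>C>0. \<forall>\<^sub>F \<theta> in at 0. C * exp (- C * \<bar>\<theta>\<bar> powr (- (1 / (s - 1)))) \<le> deriv c \<theta>"
    obtain C where C: "C > 0" "\<forall>\<^sub>F \<theta> in at 0. C * exp (- C * \<bar>\<theta>\<bar> powr (- (1 / (s - 1)))) \<le> deriv c \<theta>"
      using C by blast
    have cpos: "\<And>z. z \<in> U \<Longrightarrow> 0 < c z" using assms(4) by blast
    note le = wave_lifespan_le[OF assms(1-3) dc cdc cpos M assms(6) dc0 C]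
    define bounded_by where "bounded_by = (\<lambda>w w' \<epsilon>0 C3 C4. \<forall>\<epsilon> T v \<theta> vx \<theta>x. 0 < \<epsilon> \<and> \<epsilon> \<le> \<epsilon>0 \<and> T > 0 \<and>
      wave_system c T v \<theta> vx \<theta>x \<and> (\<forall>t\<in>{0..<T}. \<forall>x. \<theta> t x \<in> U) \<and>
      (\<forall>x. v 0 x = \<epsilon> * w x) \<and> (\<forall>x. \<theta> 0 x = \<epsilon> * w' x)
      \<longrightarrow> T \<le> C3 * exp (C4 * \<epsilon> powr (- (1 / (s - 1)))))"
    have "\<exists>\<epsilon>0>0. \<exists>C3>0. \<exists>C4>0. bounded_by \<psi> (deriv \<phi>) \<epsilon>0 C3 C4"
    proof -
      from x0 consider x0 where "deriv \<psi> x0 + deriv (deriv \<phi>) x0 > 0" | x0 where "deriv \<psi> x0 - deriv (deriv \<phi>) x0 > 0"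
        by blast
      then show ?thesis
      proof cases
        case 1
        show ?thesis unfolding bounded_by_def
          by (rule le[OF _ _ _ \<phi>2(1,2) \<psi>(1,2) K(3-5) K0 tendsto_mono[OF at_bot_le_at_infinity lim(1)]
                tendsto_mono[OF at_bot_le_at_infinity lim(2)] 1]) assumption+
      next
        case 2
        have refl: "((\<lambda>x. h (- x)) has_real_derivative - h') (at x)" if "(h has_real_derivative h') (at (- x))" for h h' x
          using that by (simp add: DERIV_mirror)
        have limr: "((\<lambda>x. h (- x)) \<longlongrightarrow> 0) at_bot" if "(h \<longlongrightarrow> 0) at_infinity" for h :: "real \<Rightarrow> real"
          using tendsto_mono[OF at_top_le_at_infinity that] by (simp add: filterlim_at_bot_mirror)
        \<comment> \<open>Reflection turns the data into \<open>- \<psi> (- x)\<close> and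
          \<open>deriv \<phi> (- x)\<close>. The sum of their derivatives at \<open>- x0\<close> is
          the difference \<open>deriv \<psi> - deriv (deriv \<phi>)\<close> at \<open>x0\<close>,
          and limits at plus infinity become limits at minus infinity.\<close>
        have "\<exists>\<epsilon>0>0. \<exists>C3>0. \<exists>C4>0. bounded_by (\<lambda>x. - \<psi> (- x)) (\<lambda>x. deriv \<phi> (- x)) \<epsilon>0 C3 C4"
          unfolding bounded_by_def
        proof (rule le[where K=K and ?x0.0="- x0"])
          show "((\<lambda>x. deriv \<phi> (- x)) has_real_derivative - deriv (deriv \<phi>) (- x)) (at x)" for x
            by (rule refl[OF \<phi>2(1)])
          show "((\<lambda>x. - \<psi> (- x)) has_real_derivative deriv \<psi> (- x)) (at x)" for x
            using DERIV_minus[OF refl[OF \<psi>(1)]] by simp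
          show "continuous_on UNIV (\<lambda>x. - deriv (deriv \<phi>) (- x))" "continuous_on UNIV (\<lambda>x. deriv \<psi> (- x))"
            by (intro continuous_intros continuous_on_compose2[OF \<phi>2(2)] continuous_on_compose2[OF \<psi>(2)]; simp)+
          show "deriv \<psi> (- (- x0)) + - deriv (deriv \<phi>) (- (- x0)) > 0" using 2 by simp
          show "((\<lambda>x. - \<psi> (- x)) \<longlongrightarrow> 0) at_bot" using tendsto_minus[OF limr[OF lim(2)]] by simp
        qed (use K K0 limr[OF lim(1)] in auto)
        then obtain \<epsilon>0 C3 C4 where E: "\<epsilon>0 > 0" "C3 > 0" "C4 > 0"
          "bounded_by (\<lambda>x. - \<psi> (- x)) (\<lambda>x. deriv \<phi> (- x)) \<epsilon>0 C3 C4"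
          by blast
        have "bounded_by \<psi> (deriv \<phi>) \<epsilon>0 C3 C4"
          unfolding bounded_by_def
        proof (intro allI impI, elim conjE)
          fix \<epsilon> T v \<theta> vx \<theta>x
          assume *: "0 < \<epsilon>" "\<epsilon> \<le> \<epsilon>0" "T > 0" "wave_system c T v \<theta> vx \<theta>x" "\<forall>t\<in>{0..<T}. \<forall>x. \<theta> t x \<in> U"
            "\<forall>x. v 0 x = \<epsilon> * \<psi> x" "\<forall>x. \<theta> 0 x = \<epsilon> * deriv \<phi> x"
          show "T \<le> C3 * exp (C4 * \<epsilon> powr (- (1 / (s - 1))))"
            using *(1-3,5-7) wave_system_reflect[OF *(4)]
            by (intro E(4)[unfolded bounded_by_def, rule_format, where v="\<lambda>t x. - v t (- x)"]) auto
        qed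
        then show ?thesis using E(1-3) by blast
      qed
    qed
    then obtain \<epsilon>0 C3 C4 where E: "\<epsilon>0 > 0" "C3 > 0" "C4 > 0" "bounded_by \<psi> (deriv \<phi>) \<epsilon>0 C3 C4" by blast
    have "lifespan c U (\<lambda>x. \<epsilon> * \<phi> x) (\<lambda>x. \<epsilon> * \<psi> x) \<le> ereal (C3 * exp (C4 * \<epsilon> powr (- (1 / (s - 1)))))"
      if \<epsilon>: "0 < \<epsilon>" "\<epsilon> \<le> \<epsilon>0" for \<epsilon>
      unfolding lifespan_def
    proof (rule Sup_least, clarify)
      fix T u
      assume T: "T > 0" and sol: "classical_solution c (\<lambda>x. \<epsilon> * \<phi> x) (\<lambda>x. \<epsilon> * \<psi> x) T u"
        and cl: "closure ((\<lambda>(t, x). Dx u t x) ` ({0..<T} \<times> UNIV)) \<subseteq> U"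
      have "u 0 = (\<lambda>x. \<epsilon> * \<phi> x)" using sol by (auto simp: classical_solution_def)
      then have "Dx u 0 x = \<epsilon> * deriv \<phi> x" for x
        by (intro Dx_eqI) (simp add: DERIV_cmult[OF \<phi>1(1)])
      moreover have "Dx u t x \<in> U" if "t \<in> {0..<T}" for t x
        using cl closure_subset that by fastforce
      moreover have "Dt T u 0 x = \<epsilon> * \<psi> x" for x using sol by (simp add: classical_solution_def)
      ultimately show "ereal T \<le> ereal (C3 * exp (C4 * \<epsilon> powr (- (1 / (s - 1)))))"
        using E(4)[unfolded bounded_by_def, rule_format, of \<epsilon> T "Dt T u" "Dx u" "Dx (Dt T u)" "Dx (Dx u)"]
          \<epsilon> T classical_solution_wave_system[OF sol] by simp
    qed
    then show "\<exists>\<epsilon>0>0. \<exists>C3>0. \<exists>C4>0. \<forall>\<epsilon>. 0 < \<epsilon> \<and> \<epsilon> \<le> \<epsilon>0 \<longrightarrow>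
        lifespan c U (\<lambda>x. \<epsilon> * \<phi> x) (\<lambda>x. \<epsilon> * \<psi> x)
          \<le> ereal (C3 * exp (C4 * \<epsilon> powr (- (1 / (s - 1)))))"
      using E(1-3) by blast
  qed
qed

end
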